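(* For every $\varepsilon>0$ there exists a constant $c_\varepsilon$ (independent of $u$) such that for every $u\in H^1(\mathbb{S}^2)$ satisfying $\int_{\mathbb{S}^2}u\,d\mu=0$ and $\int_{\mathbb{S}^2}p\,e^{2u}\,d\mu=0$ for every $p\in\overset{\circ}{\mathcal{P}}_2$, one has $$\log\int_{\mathbb{S}^2}e^{2u}\,d\mu\le\left(\frac{1}{16\pi}+\varepsilon\right)\|\nabla u\|_{L^2(\mathbb{S}^2)}^2+c_\varepsilon .$$
   Context: $\mathbb{S}^2\subset\mathbb{R}^3$ is the unit sphere with its standard round metric and $\mu$ is its standard area measure (total mass $4\pi$). $H^1(\mathbb{S}^2)$ is the Sobolev space of real-valued $L^2$ functions with weak gradient in $L^2$. $\overset{\circ}{\mathcal{P}}_2$ is the set of all (real) polynomials $p$ on $\mathbb{R}^3$ of degree at most $2$ with $\int_{\mathbb{S}^2}p\,d\mu=0$. *)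

theory Defs
  imports "HOL-Analysis.Analysis"
begin

text \<open>
  The area measure \<open>\<mu>\<close> of the unit sphere is given by \<open>\<mu> A = 3 \<sqdot> vol {t x | x \<in> A, 0 < t \<le> 1}\<close>,
  three times the Lebesgue volume of the cone over \<open>A\<close>, i.e. it is the surface measure of
  integration in polar coordinates. The cone over \<open>A\<close> is the preimage of \<open>A\<close> under \<open>sgn x = x / norm x\<close>.
\<close>

definition sphere_area :: "(real ^ 3) measure" where
  "sphere_area =
     scale_measure 3
       (distr (restrict_space lborel (cball 0 1 - {0})) (restrict_space borel (sphere 0 1)) sgn)"

lemma space_sphere_area [simp]: "space sphere_area = sphere 0 1"
  by (simp add: sphere_area_def space_scale_measure space_restrict_space)

lemma sets_sphere_area [simp, measurable_cong]:
  "sets sphere_area = sets (restrict_space borel (sphere 0 1))"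
  by (simp add: sphere_area_def)

lemma emeasure_sphere_area_space: "emeasure sphere_area (sphere 0 1) = ennreal (4 * pi)"
proof -
  let ?C = "cball 0 1 - {0} :: (real ^ 3) set"
  let ?M = "restrict_space lborel ?C"
  have C: "?C \<in> sets lborel" by simp
  have sgn_meas: "sgn \<in> ?M \<rightarrow>\<^sub>M restrict_space borel (sphere 0 1)"
  proof (rule measurable_restrict_space2)
    show "sgn \<in> space ?M \<rightarrow> sphere 0 1"
      by (auto simp: space_restrict_space norm_sgn)
    have "(\<lambda>x::real^3. x /\<^sub>R norm x) \<in> borel_measurable borel" by measurable
    then show "sgn \<in> ?M \<rightarrow>\<^sub>M borel"
      by (auto simp: sgn_div_norm[abs_def] intro!: measurable_restrict_space1)
  qed
  have pre: "sgn -` sphere 0 1 \<inter> space ?M = ?C"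
    by (auto simp: space_restrict_space norm_sgn)
  have sp: "sphere 0 1 \<in> sets (restrict_space borel (sphere (0::real^3) 1))"
    by (simp add: sets_restrict_space_iff)
  have "emeasure ?M ?C = emeasure lborel ?C"
    by (rule emeasure_restrict_space) auto
  also have "\<dots> = emeasure lborel (cball (0::real^3) 1)"
    by (rule emeasure_Diff_null_set) (auto simp: null_sets_def)
  also have "\<dots> = ennreal (4 / 3 * pi)"
    by (simp add: emeasure_cball unit_ball_vol_3)
  finally have vol: "emeasure ?M ?C = ennreal (4 / 3 * pi)" .
  have "emeasure sphere_area (sphere 0 1) = 3 * ennreal (4 / 3 * pi)"
    unfolding sphere_area_def emeasure_scale_measure emeasure_distr[OF sgn_meas sp] pre vol ..
  also have "\<dots> = ennreal 3 * ennreal (4 / 3 * pi)" by simp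
  also have "\<dots> = ennreal (3 * (4 / 3 * pi))" by (rule ennreal_mult[symmetric]) auto
  finally show ?thesis by simp
qed

primrec C_k :: "nat \<Rightarrow> ('a::euclidean_space \<Rightarrow> 'b::euclidean_space) \<Rightarrow> bool" where
  "C_k 0 f \<longleftrightarrow> continuous_on UNIV f"
| "C_k (Suc k) f \<longleftrightarrow>
     (\<exists>f'. (\<forall>x. (f has_derivative f' x) (at x)) \<and> (\<forall>h. C_k k (\<lambda>x. f' x h)))"

text \<open>
  Smooth tangential vector fields on the sphere are represented by smooth vector fields on the
  ambient space that are tangential at the points of the sphere; every smooth tangential field on
  the sphere extends in this way.
\<close>

definition smooth_tangent_field :: "(real ^ 3 \<Rightarrow> real ^ 3) \<Rightarrow> bool" where
  "smooth_tangent_field X \<longleftrightarrow> (\<forall>k. C_k k X) \<and> (\<forall>x \<in> sphere 0 1. x \<bullet> X x = 0)"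

text \<open>
  The divergence of a tangential field with respect to the round metric at a point \<open>x\<close> of the
  sphere: the Levi-Civita connection is the tangential part of the ambient derivative, so this is
  the trace of the ambient derivative over the tangent plane, which is the full trace minus the
  contribution of the unit normal \<open>x\<close>.
\<close>

definition sphere_div :: "(real ^ 3 \<Rightarrow> real ^ 3) \<Rightarrow> real ^ 3 \<Rightarrow> real" where
  "sphere_div X x =
     (\<Sum>b\<in>Basis. frechet_derivative X (at x) b \<bullet> b) - frechet_derivative X (at x) x \<bullet> x"

definition sphere_L2 :: "(real ^ 3 \<Rightarrow> 'b::euclidean_space) \<Rightarrow> bool" where
  "sphere_L2 f \<longleftrightarrow>
     f \<in> borel_measurable sphere_area \<and> integrable sphere_area (\<lambda>x. (norm (f x))\<^sup>2)"

definition sphere_L2_norm :: "(real ^ 3 \<Rightarrow> 'b::euclidean_space) \<Rightarrow> real" where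
  "sphere_L2_norm f = sqrt (\<integral>x. (norm (f x))\<^sup>2 \<partial>sphere_area)"

definition is_weak_gradient :: "(real ^ 3 \<Rightarrow> real) \<Rightarrow> (real ^ 3 \<Rightarrow> real ^ 3) \<Rightarrow> bool" where
  "is_weak_gradient u G \<longleftrightarrow>
     sphere_L2 G \<and> (AE x in sphere_area. x \<bullet> G x = 0) \<and>
     (\<forall>X. smooth_tangent_field X \<longrightarrow>
        (\<integral>x. u x * sphere_div X x \<partial>sphere_area) = - (\<integral>x. G x \<bullet> X x \<partial>sphere_area))"

text \<open>
  Elements of \<open>H\<^sup>1\<close> are represented by functions rather than by classes modulo null sets; values
  off the sphere are irrelevant.
\<close>

definition sphere_H1 :: "(real ^ 3 \<Rightarrow> real) set" where
  "sphere_H1 = {u. sphere_L2 u \<and> (\<exists>G. is_weak_gradient u G)}"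

text \<open>The weak gradient is unique up to null sets, so its norm does not depend on the choice.\<close>

definition weak_gradient :: "(real ^ 3 \<Rightarrow> real) \<Rightarrow> real ^ 3 \<Rightarrow> real ^ 3" where
  "weak_gradient u = (SOME G. is_weak_gradient u G)"

definition polynomials_le :: "nat \<Rightarrow> (real ^ 3 \<Rightarrow> real) set" where
  "polynomials_le d =
     {p. \<exists>c :: (3 \<Rightarrow> nat) \<Rightarrow> real.
           p = (\<lambda>x. \<Sum>\<alpha> | (\<Sum>i\<in>UNIV. \<alpha> i) \<le> d. c \<alpha> * (\<Prod>i\<in>UNIV. x $ i ^ \<alpha> i))}"

lemma finite_multi_indices: "finite {\<alpha> :: 3 \<Rightarrow> nat. (\<Sum>i\<in>UNIV. \<alpha> i) \<le> d}"
proof (rule finite_subset)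
  show "{\<alpha> :: 3 \<Rightarrow> nat. (\<Sum>i\<in>UNIV. \<alpha> i) \<le> d} \<subseteq> PiE UNIV (\<lambda>_. {..d})"
  proof (clarsimp simp: PiE_UNIV_domain)
    fix \<alpha> :: "3 \<Rightarrow> nat" and i assume "sum \<alpha> UNIV \<le> d"
    moreover have "\<alpha> i \<le> sum \<alpha> UNIV" by (rule member_le_sum) auto
    ultimately show "\<alpha> i \<le> d" by linarith
  qed
qed (rule finite_PiE; simp)

definition mean_zero_polynomials_le :: "nat \<Rightarrow> (real ^ 3 \<Rightarrow> real) set" where
  "mean_zero_polynomials_le d = {p \<in> polynomials_le d. (\<integral>x. p x \<partial>sphere_area) = 0}"

end

theory Submission
  imports Defs
begin

text \<open>
  The proof is a duality argument. Let \<open>E\<^sub>1, \<dots>, E\<^sub>N\<close> be sets at mutual distance at least \<open>\<delta>\<close>, let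
  \<open>Z\<^sub>i\<close> be the integral of \<open>e\<^sup>2\<^sup>u\<close> over \<open>E\<^sub>i\<close>, let \<open>\<rho>\<^sub>i = 1\<^bsub>E\<^sub>i\<^esub> e\<^sup>2\<^sup>u / Z\<^sub>i\<close>, and let \<open>\<rho>\<close> be the average of the
  \<open>\<rho>\<^sub>i\<close>. Since \<open>ln \<rho>\<^sub>i = 2 u - ln Z\<^sub>i\<close> on \<open>E\<^sub>i\<close>, writing \<open>S\<^sub>i = \<integral> \<rho>\<^sub>i ln \<rho>\<^sub>i\<close> gives
  \<open>(1/N) \<Sum>\<^sub>i ln Z\<^sub>i = 2 \<integral> u \<rho> - (1/N) \<Sum>\<^sub>i S\<^sub>i\<close>.

  As \<open>u\<close> has mean zero, \<open>\<integral> u \<rho>\<close> is the pairing of \<open>\<nabla>u\<close> with the gradient of the potential of \<open>\<rho>\<close>,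
  so for every \<open>A > 0\<close> it satisfies \<open>2 \<integral> u \<rho> \<le> A \<parallel>\<nabla>u\<parallel>\<^sup>2 + (1/A) \<integral>\<integral> g(y,z) \<rho>(y) \<rho>(z)\<close>, where
  \<open>g = (1/2\<pi>) ln (1/|y - z|) + const\<close> is the Green function. The double integral splits into \<open>N\<^sup>2\<close>
  terms of weight \<open>1/N\<^sup>2\<close>. The terms with \<open>i \<noteq> j\<close> are bounded because the sets are separated. For the
  diagonal ones the variational principle \<open>\<integral> \<rho>\<^sub>i h \<le> S\<^sub>i + ln \<integral> e\<^sup>h\<close>, applied to
  \<open>h = 2 s ln (1/|y - z|)\<close>, bounds the potential of \<open>\<rho>\<^sub>i\<close> at each point by a multiple of \<open>S\<^sub>i\<close>
  plus a constant; here \<open>\<integral> |y - z|\<^sup>-\<^sup>2\<^sup>s dz\<close> is finite precisely for \<open>s < 1\<close>. The choice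
  \<open>A = 1/(4 \<pi> N s)\<close> makes the entropies cancel, and what remains is
  \<open>(1/N) \<Sum>\<^sub>i ln Z\<^sub>i \<le> \<parallel>\<nabla>u\<parallel>\<^sup>2 / (4 \<pi> N s) + C\<close>, which is \<open>separated_moser_trudinger\<close>.
  The loss \<open>s < 1\<close> is the \<open>\<epsilon>\<close> of the theorem, and the case \<open>N = 1\<close> shows that \<open>e\<^sup>2\<^sup>u\<close> is integrable.

  The moment conditions supply \<open>N = 4\<close>. The probability measure proportional to \<open>e\<^sup>2\<^sup>u \<mu>\<close> has the same
  moments of degree at most two as the normalised area. Any three points lie on a plane \<open>x \<bullet> w = c\<close>,
  and the polynomial \<open>(x \<bullet> w - c)\<^sup>2\<close> has mean \<open>1/3 + c\<^sup>2\<close> although it is tiny near these points. Hence a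
  definite fraction of the mass lies away from any three points, and a greedy selection from a fixed
  finite cover by small caps yields four separated caps that each carry a definite fraction of the
  mass (\<open>heavy_cap_away_from_three_points\<close>).

  Weak gradients may only be tested against smooth fields, so the Green function is regularised:
  for \<open>a > 1\<close> the function \<open>- ln (a - x \<bullet> y) / (4 \<pi>)\<close> is smooth, and its Laplacian differs from
  \<open>1/(4 \<pi>)\<close> by an explicit kernel that is an approximate identity as \<open>a \<rightarrow> 1\<close>
  (\<open>sphere_div_green_field\<close>, \<open>mollifiable_integrable\<close>). Its energy kernel is bounded
  by the logarithm uniformly in \<open>a\<close> (\<open>green_energy_le\<close>). All spherical integrals reduce to
  integrals over \<open>[-1, 1]\<close> by Archimedes' hat-box theorem.
\<close>

section \<open>Archimedes' hat-box theorem\<close>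

text \<open>
  The points of \<open>\<real>\<^sup>3\<close> are described by a horizontal component in \<open>\<real> \<times> \<real>\<close>, where the area of a disc is
  known, and a height. Volumes can then be computed by horizontal slices.
\<close>

lemma borel_measurable_cylindrical [measurable]:
  "(\<lambda>(p::real \<times> real, z::real). vector [fst p, snd p, z] :: real^3) \<in> borel_measurable (lborel \<Otimes>\<^sub>M lborel)"
proof -
  have "(\<lambda>(p::real \<times> real, z::real). vector [fst p, snd p, z] :: real^3)
      = (\<lambda>q. fst (fst q) *\<^sub>R axis 1 1 + snd (fst q) *\<^sub>R axis 2 1 + snd q *\<^sub>R axis 3 1)"
    by (auto simp: fun_eq_iff vec_eq_iff forall_3 axis_def)
  also have "\<dots> \<in> borel_measurable (borel \<Otimes>\<^sub>M borel)"
    by (simp only: borel_prod) (intro borel_measurable_continuous_onI continuous_intros)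
  finally show ?thesis by (simp add: lborel_prod borel_prod)
qed

lemma lborel_real3_eq_distr:
  "(lborel :: (real^3) measure) =
     distr (lborel \<Otimes>\<^sub>M lborel) borel (\<lambda>(p::real \<times> real, z::real). vector [fst p, snd p, z])"
proof (rule lborel_eqI)
  let ?\<Phi> = "\<lambda>(p::real \<times> real, z::real). vector [fst p, snd p, z] :: real^3"
  note meas = borel_measurable_cylindrical
  fix l u :: "real^3" assume "\<And>b. b \<in> Basis \<Longrightarrow> l \<bullet> b \<le> u \<bullet> b"
  then have le: "l $ i \<le> u $ i" for i
    by (metis axis_in_Basis_iff cart_eq_inner_axis Basis_real_def insertI1)
  have pre: "?\<Phi> -` box l u \<inter> space (lborel \<Otimes>\<^sub>M lborel) =
      ({l$1<..<u$1} \<times> {l$2<..<u$2}) \<times> {l$3<..<u$3}"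
    by (auto simp: box_def Basis_vec_def inner_axis forall_3 space_pair_measure)
  have b: "{l$1<..<u$1} \<times> {l$2<..<u$2} \<in> sets (lborel :: (real \<times> real) measure)"
    by (simp add: borel_open open_Times)
  have "emeasure (distr (lborel \<Otimes>\<^sub>M lborel) borel ?\<Phi>) (box l u)
      = emeasure (lborel \<Otimes>\<^sub>M lborel) (({l$1<..<u$1} \<times> {l$2<..<u$2}) \<times> {l$3<..<u$3})"
    by (subst emeasure_distr) (use meas pre in auto)
  also have "\<dots> = emeasure lborel ({l$1<..<u$1} \<times> {l$2<..<u$2}) * emeasure lborel {l$3<..<u$3}"
    using b by (subst lborel.emeasure_pair_measure_Times) auto
  also have "emeasure lborel ({l$1<..<u$1} \<times> {l$2<..<u$2})
      = emeasure lborel {l$1<..<u$1} * emeasure lborel {l$2<..<u$2}"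
    by (simp add: lborel.emeasure_pair_measure_Times flip: lborel_prod)
  also have "\<dots> * emeasure lborel {l$3<..<u$3} = ennreal ((u$1 - l$1) * (u$2 - l$2) * (u$3 - l$3))"
    using le by (simp add: ennreal_mult)
  also have "(u$1 - l$1) * (u$2 - l$2) * (u$3 - l$3) = (\<Prod>i\<in>UNIV. (u - l) $ i)"
    unfolding UNIV_3 by (simp add: mult.assoc)
  also have "\<dots> = (\<Prod>b\<in>Basis. (u - l) \<bullet> b)"
  proof -
    have B: "(Basis :: (real^3) set) = range (\<lambda>i. axis i 1)" by (auto simp: Basis_vec_def)
    have "inj (\<lambda>i::3. axis i (1::real))" by (auto simp: inj_on_def axis_eq_axis)
    then show ?thesis unfolding B by (subst prod.reindex) (auto simp: inner_axis)
  qed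
  finally show "emeasure (distr (lborel \<Otimes>\<^sub>M lborel) borel ?\<Phi>) (box l u)
      = ennreal (\<Prod>b\<in>Basis. (u - l) \<bullet> b)" .
qed simp

text \<open>
  The slice at height \<open>z\<close> of the intersection of the unit ball with the cone \<open>h |v| \<le> v\<^sub>3\<close> is the disc
  with squared radius \<open>min (1 - z\<^sup>2) (z\<^sup>2 (1/h\<^sup>2 - 1))\<close>; the ball is active above \<open>z = h\<close>, the cone below.
\<close>

lemma emeasure_cone_axis:
  assumes h: "0 < h" "h \<le> 1"
  shows "emeasure lborel {v \<in> cball 0 1. h * norm v \<le> v \<bullet> axis (3::3) (1::real)}
    = ennreal (2 * pi * (1 - h) / 3)"
proof -
  let ?\<Phi> = "\<lambda>(p::real \<times> real, z::real). vector [fst p, snd p, z] :: real^3"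
  let ?C = "{v \<in> cball 0 1. h * norm v \<le> v \<bullet> axis (3::3) (1::real)}"
  define m where "m z = min (1 - z\<^sup>2) (z\<^sup>2 * (1 / h\<^sup>2 - 1))" for z
  have hh: "1 \<le> 1 / h\<^sup>2" using h by (simp add: power_le_one)
  have [measurable]: "?C \<in> sets borel"
    by (intro borel_closed) (auto intro!: closed_Collect_conj closed_Collect_le continuous_intros simp: closed_cball[unfolded cball_def])
  have norm: "norm (?\<Phi> (p, z)) = sqrt ((norm p)\<^sup>2 + z\<^sup>2)" for p z
    unfolding norm_vec_def L2_set_def sum_3 norm_prod_def by simp
  have slice: "emeasure lborel ((\<lambda>p. (p, z)) -` (?\<Phi> -` ?C \<inter> space (lborel \<Otimes>\<^sub>M lborel)))
      = ennreal (pi * m z) * indicator {0..1} z" for z :: real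
  proof (cases "z \<in> {0..1}")
    case True
    then have m: "0 \<le> m z" using hh by (auto simp: m_def power_le_one)
    have "?\<Phi> (p, z) \<in> ?C \<longleftrightarrow> p \<in> cball 0 (sqrt (m z))" for p
    proof -
      have "?\<Phi> (p, z) \<in> ?C \<longleftrightarrow> (norm p)\<^sup>2 + z\<^sup>2 \<le> 1 \<and> sqrt (h\<^sup>2 * ((norm p)\<^sup>2 + z\<^sup>2)) \<le> z"
        using h unfolding mem_Collect_eq mem_cball_0 norm
        by (simp add: real_sqrt_mult inner_axis)
      also have "sqrt (h\<^sup>2 * ((norm p)\<^sup>2 + z\<^sup>2)) \<le> z \<longleftrightarrow> h\<^sup>2 * ((norm p)\<^sup>2 + z\<^sup>2) \<le> z\<^sup>2"
        using True by (metis atLeastAtMost_iff real_sqrt_le_iff real_sqrt_unique)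
      also have "\<dots> \<longleftrightarrow> (norm p)\<^sup>2 \<le> z\<^sup>2 * (1 / h\<^sup>2 - 1)"
        using h by (simp add: field_simps)
      finally have "?\<Phi> (p, z) \<in> ?C \<longleftrightarrow> (norm p)\<^sup>2 \<le> m z" unfolding m_def by auto
      also have "\<dots> \<longleftrightarrow> norm p \<le> sqrt (m z)"
        using m by (metis norm_ge_zero real_le_rsqrt real_sqrt_le_iff real_sqrt_unique sqrt_le_D)
      finally show ?thesis by simp
    qed
    then have "(\<lambda>p. (p, z)) -` (?\<Phi> -` ?C \<inter> space (lborel \<Otimes>\<^sub>M lborel)) = cball 0 (sqrt (m z))"
      by (auto simp: space_pair_measure simp del: mem_cball mem_cball_0)
    then show ?thesis using True m by (simp add: emeasure_cball unit_ball_vol_2)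
  next
    case False
    have "?\<Phi> (p, z) \<notin> ?C" for p
    proof (cases "z < 0")
      case True
      then show ?thesis using h
        by (auto simp: inner_axis not_le intro: less_le_trans[of z 0])
    next
      case zz: False
      then have "1 < z" using False by auto
      then have "1 < z\<^sup>2" by (simp add: one_less_power)
      then have "1 < (norm p)\<^sup>2 + z\<^sup>2" by (meson add_strict_increasing2 zero_le_power2)
      then show ?thesis unfolding mem_Collect_eq mem_cball_0 norm by (simp add: not_le)
    qed
    then have "(\<lambda>p. (p, z)) -` (?\<Phi> -` ?C \<inter> space (lborel \<Otimes>\<^sub>M lborel)) = {}" by auto
    then show ?thesis using False by simp
  qed
  have "emeasure lborel ?C = emeasure (lborel \<Otimes>\<^sub>M lborel) (?\<Phi> -` ?C \<inter> space (lborel \<Otimes>\<^sub>M lborel))"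
    by (subst lborel_real3_eq_distr, subst emeasure_distr) auto
  also have "\<dots> = (\<integral>\<^sup>+z. ennreal (pi * m z) * indicator {0..1} z \<partial>lborel)"
    by (subst lborel_pair.emeasure_pair_measure_alt2) (auto simp only: slice, measurable)
  \<comment> \<open>The overlap of the two closed intervals is a single point.\<close>
  also have "\<dots> = (\<integral>\<^sup>+z. ennreal (pi * (z\<^sup>2 * (1 / h\<^sup>2 - 1))) * indicator {0..h} z
                      + ennreal (pi * (1 - z\<^sup>2)) * indicator {h..1} z \<partial>lborel)"
  proof (rule nn_integral_cong_AE)
    have "m z = z\<^sup>2 * (1 / h\<^sup>2 - 1)" if "0 \<le> z" "z < h" for z
    proof -
      have "z\<^sup>2 \<le> h\<^sup>2" using that by (simp add: power_mono)
      then have "z\<^sup>2 / h\<^sup>2 \<le> 1" using h by simp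
      then show ?thesis by (simp add: m_def min_def algebra_simps)
    qed
    moreover have "m z = 1 - z\<^sup>2" if "h < z" for z
    proof -
      have "h\<^sup>2 \<le> z\<^sup>2" using that h by (simp add: power_mono)
      then have "1 \<le> z\<^sup>2 / h\<^sup>2" using h by simp
      then show ?thesis by (simp add: m_def min_def algebra_simps)
    qed
    ultimately have "ennreal (pi * m z) * indicator {0..1} z =
        ennreal (pi * (z\<^sup>2 * (1 / h\<^sup>2 - 1))) * indicator {0..h} z
          + ennreal (pi * (1 - z\<^sup>2)) * indicator {h..1} z" if zh: "z \<noteq> h" for z
    proof -
      consider "z < 0 \<or> 1 < z" | "0 \<le> z" "z < h" | "h < z" "z \<le> 1"
        using zh by linarith
      then show ?thesis
      proof cases
        case 1
        then have "z \<notin> {0..1}" "z \<notin> {0..h}" "z \<notin> {h..1}" using h by auto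
        then show ?thesis by (simp del: atLeastAtMost_iff)
      next
        case 2
        then have "z \<in> {0..1}" "z \<in> {0..h}" "z \<notin> {h..1}" "m z = z\<^sup>2 * (1 / h\<^sup>2 - 1)"
          using h \<open>\<And>z. 0 \<le> z \<Longrightarrow> z < h \<Longrightarrow> m z = z\<^sup>2 * (1 / h\<^sup>2 - 1)\<close> by auto
        then show ?thesis by (simp del: atLeastAtMost_iff)
      next
        case 3
        then have "z \<in> {0..1}" "z \<notin> {0..h}" "z \<in> {h..1}" "m z = 1 - z\<^sup>2"
          using h \<open>\<And>z. h < z \<Longrightarrow> m z = 1 - z\<^sup>2\<close> by auto
        then show ?thesis by (simp del: atLeastAtMost_iff)
      qed
    qed
    then show "AE z in lborel. ennreal (pi * m z) * indicator {0..1} z =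
        ennreal (pi * (z\<^sup>2 * (1 / h\<^sup>2 - 1))) * indicator {0..h} z
          + ennreal (pi * (1 - z\<^sup>2)) * indicator {h..1} z"
      by (rule eventually_mono[OF AE_lborel_singleton[of h]])
  qed
  also have "\<dots> = (\<integral>\<^sup>+z. ennreal (pi * (z\<^sup>2 * (1 / h\<^sup>2 - 1))) * indicator {0..h} z \<partial>lborel)
      + (\<integral>\<^sup>+z. ennreal (pi * (1 - z\<^sup>2)) * indicator {h..1} z \<partial>lborel)"
    by (rule nn_integral_add) auto
  also have "(\<integral>\<^sup>+z. ennreal (pi * (z\<^sup>2 * (1 / h\<^sup>2 - 1))) * indicator {0..h} z \<partial>lborel)
      = ennreal (pi * (h ^ 3 / 3 * (1 / h\<^sup>2 - 1)) - pi * (0 ^ 3 / 3 * (1 / h\<^sup>2 - 1)))"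
    using h hh by (intro nn_integral_FTC_Icc) (auto intro!: derivative_eq_intros simp: power2_eq_square)
  also have "(\<integral>\<^sup>+z. ennreal (pi * (1 - z\<^sup>2)) * indicator {h..1} z \<partial>lborel)
      = ennreal (pi * (1 - 1 ^ 3 / 3) - pi * (h - h ^ 3 / 3))"
    using h by (intro nn_integral_FTC_Icc) (auto intro!: derivative_eq_intros simp: power2_eq_square mult_le_one)
  also have "ennreal (pi * (h ^ 3 / 3 * (1 / h\<^sup>2 - 1)) - pi * (0 ^ 3 / 3 * (1 / h\<^sup>2 - 1)))
     + ennreal (pi * (1 - 1 ^ 3 / 3) - pi * (h - h ^ 3 / 3)) = ennreal (2 * pi * (1 - h) / 3)"
  proof -
    have "h ^ 3 \<le> h" using power_decreasing[of 1 3 h] h by simp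
    have 1: "h ^ 3 / 3 * (1 / h\<^sup>2 - 1) = (h - h^3) / 3" using h by (simp add: field_simps eval_nat_numeral)
    have "0 \<le> 2 - 3 * h + h^3" 
    proof -
      have "2 - 3 * h + h^3 = (1 - h)\<^sup>2 * (2 + h)" by (simp add: power2_eq_square power3_eq_cube algebra_simps)
      then show ?thesis using h by simp
    qed
    then have 2: "0 \<le> pi * (1 - 1 ^ 3 / 3) - pi * (h - h ^ 3 / 3)" 
      using h by (simp flip: right_diff_distrib) 
    show ?thesis unfolding 1 using \<open>h ^ 3 \<le> h\<close> 2 
      by (subst ennreal_plus[symmetric]) (auto simp: field_simps)
  qed
  finally show ?thesis .
qed

lemma emeasure_cone:
  fixes y :: "real^3" assumes h: "0 < h" "h \<le> 1" and y: "norm y = 1"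
  shows "emeasure lborel {v \<in> cball 0 1. h * norm v \<le> v \<bullet> y} = ennreal (2 * pi * (1 - h) / 3)"
proof -
  let ?e = "axis 3 1 :: real^3"
  let ?S = "\<lambda>y. {v \<in> cball 0 1. h * norm v \<le> v \<bullet> y} :: (real^3) set"
  obtain f where f: "orthogonal_transformation f" "f ?e = y"
    using orthogonal_transformation_exists[of ?e y] y by auto
  have borel: "?S y \<in> sets borel" for y
    by (intro borel_closed) (auto intro!: closed_Collect_conj closed_Collect_le continuous_intros simp: closed_cball[unfolded cball_def])
  have leb: "emeasure lebesgue A = emeasure lborel A" if "A \<in> sets borel" for A :: "(real^3) set"
    using that by simp
  have m: "?S y \<in> lmeasurable" for y
    using borel by (intro bounded_set_imp_lmeasurable) (auto intro: bounded_subset[OF bounded_cball[of 0 1]])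
  have inner: "f v \<bullet> f w = v \<bullet> w" for v w using f(1) by (simp add: orthogonal_transformation_def)
  have norm: "norm (f v) = norm v" for v using f(1) by (simp add: orthogonal_transformation_norm)
  have "f ` ?S ?e = ?S y"
  proof (intro equalityI subsetI)
    fix v assume "v \<in> f ` ?S ?e" then show "v \<in> ?S y" using inner norm f(2)[symmetric] by auto
  next
    fix v assume v: "v \<in> ?S y"
    obtain w where "v = f w" using orthogonal_transformation_surj[OF f(1)] by (metis surjE)
    then show "v \<in> f ` ?S ?e" using v inner norm f(2)[symmetric] by auto
  qed
  then have "measure lebesgue (?S y) = measure lebesgue (?S ?e)"
    using measure_orthogonal_image[OF f(1) m, of ?e] by simp
  then have "emeasure lebesgue (?S y) = emeasure lebesgue (?S ?e)"
    using emeasure_eq_measure2[OF m, of y] emeasure_eq_measure2[OF m, of ?e] by metis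
  then have "emeasure lborel (?S y) = emeasure lborel (?S ?e)"
    unfolding leb[OF borel] .
  then show ?thesis unfolding emeasure_cone_axis[OF h] .
qed

lemma emeasure_sphere_area:
  assumes "A \<in> sets borel" "A \<subseteq> sphere 0 1"
  shows "emeasure sphere_area A = 3 * emeasure lborel {v \<in> cball 0 1 - {0}. sgn v \<in> A}"
proof -
  let ?C = "cball 0 1 - {0} :: (real ^ 3) set"
  let ?M = "restrict_space lborel ?C"
  have "sgn \<in> ?M \<rightarrow>\<^sub>M restrict_space borel (sphere 0 1)"
  proof (rule measurable_restrict_space2)
    show "sgn \<in> space ?M \<rightarrow> sphere 0 1"
      by (auto simp: space_restrict_space norm_sgn)
    have "(\<lambda>x::real^3. x /\<^sub>R norm x) \<in> borel_measurable borel" by measurable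
    then show "sgn \<in> ?M \<rightarrow>\<^sub>M borel"
      by (auto simp: sgn_div_norm[abs_def] intro!: measurable_restrict_space1)
  qed
  moreover have "A \<in> sets (restrict_space borel (sphere 0 1))"
    using assms by (simp add: sets_restrict_space_iff)
  ultimately have "emeasure sphere_area A = 3 * emeasure ?M (sgn -` A \<inter> space ?M)"
    unfolding sphere_area_def emeasure_scale_measure by (subst emeasure_distr) auto
  also have "emeasure ?M (sgn -` A \<inter> space ?M) = emeasure lborel (sgn -` A \<inter> space ?M)"
    by (rule emeasure_restrict_space) (auto simp: space_restrict_space)
  also have "sgn -` A \<inter> space ?M = {v \<in> ?C. sgn v \<in> A}"
    by (auto simp: space_restrict_space)
  finally show ?thesis .
qed

lemma closed_cap: "closed {x \<in> sphere 0 1. h \<le> x \<bullet> (y :: 'a::euclidean_space)}"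
proof -
  have "{x \<in> sphere 0 1. h \<le> x \<bullet> y} = sphere 0 1 \<inter> {x. h \<le> x \<bullet> y}" by auto
  also have "closed \<dots>" by (intro closed_Int closed_sphere closed_Collect_le continuous_intros)
  finally show ?thesis .
qed

text \<open>
  Three times the volume of the cone over the cap. The restriction \<open>h > 0\<close> makes the cone convex;
  the remaining caps follow by complements and limits below.
\<close>

lemma emeasure_cap:
  assumes h: "0 < h" "h \<le> 1" and y: "norm y = 1"
  shows "emeasure sphere_area {x \<in> sphere 0 1. h \<le> x \<bullet> y} = ennreal (2 * pi * (1 - h))"
proof -
  have "emeasure sphere_area {x \<in> sphere 0 1. h \<le> x \<bullet> y}
    = 3 * emeasure lborel {v \<in> cball 0 1 - {0}. sgn v \<in> {x \<in> sphere 0 1. h \<le> x \<bullet> y}}"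
    by (intro emeasure_sphere_area borel_closed closed_cap) auto
  also have "{v \<in> cball 0 1 - {0}. sgn v \<in> {x \<in> sphere 0 1. h \<le> x \<bullet> y}}
      = {v \<in> cball 0 1. h * norm v \<le> v \<bullet> y} - {0}"
    by (auto simp: norm_sgn) (auto simp: sgn_div_norm field_simps)
  also have "emeasure lborel \<dots> = emeasure lborel {v \<in> cball 0 1. h * norm v \<le> v \<bullet> y}"
    by (intro emeasure_Diff_null_set borel_closed)
      (auto simp: null_sets_def intro!: closed_Collect_conj closed_Collect_le continuous_intros closed_cball[unfolded cball_def])
  also have "3 * \<dots> = ennreal 3 * ennreal (2 * pi * (1 - h) / 3)"
    using emeasure_cone[OF h y] by simp
  also have "\<dots> = ennreal (2 * pi * (1 - h))"
    using h by (subst ennreal_mult[symmetric]) auto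
  finally show ?thesis .
qed


text \<open>
  As a simplification rule this equation would unfold the \<open>\<sigma>\<close>-algebra in every goal, so that facts about
  sets measurable for \<open>sphere_area\<close> no longer match.
\<close>

declare sets_sphere_area [simp del]

interpretation sphere: finite_measure sphere_area
  by standard (simp add: emeasure_sphere_area_space)

lemma measure_sphere_area_space [simp]: "measure sphere_area (sphere 0 1) = 4 * pi"
  by (simp add: measure_def emeasure_sphere_area_space)

lemma borel_measurable_sphere_area [measurable]: "(\<lambda>x. x) \<in> borel_measurable sphere_area"
  by (simp add: measurable_cong_sets[OF sets_sphere_area refl] measurable_restrict_space1)

text \<open>
  The caps \<open>c < x \<bullet> y\<close> determine the distribution of \<open>x \<bullet> y\<close>. For \<open>0 \<le> c\<close> their area lies between the areas of
  closed caps of slightly larger height; the point \<open>c = 0\<close> uses that two opposite open hemispheres are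
  disjoint. For \<open>c < 0\<close> the complement is a closed cap around \<open>-y\<close>.
\<close>

lemma distr_sphere_area_inner:
  assumes y: "norm y = 1"
  shows "distr sphere_area borel (\<lambda>x. x \<bullet> y) = density lborel (\<lambda>t. ennreal (2 * pi) * indicator {-1..1} t)"
proof (rule measure_eqI_lessThan)
  define M where "M y c = measure sphere_area {x \<in> sphere 0 1. c < x \<bullet> y}" for y :: "real^3" and c :: real
  have abs: "\<bar>x \<bullet> y\<bar> \<le> 1" if "x \<in> sphere 0 1" "norm y = 1" for x y :: "real^3"
    using Cauchy_Schwarz_ineq2[of x y] that by simp
  have sets: "{x \<in> sphere 0 1. c < x \<bullet> y} \<in> sets sphere_area"
      "{x \<in> sphere 0 1. c \<le> x \<bullet> y} \<in> sets sphere_area" for c and y :: "real^3"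
  proof -
    have "{x \<in> space sphere_area. c < x \<bullet> y} \<in> sets sphere_area"
      "{x \<in> space sphere_area. c \<le> x \<bullet> y} \<in> sets sphere_area" by measurable
    then show "{x \<in> sphere 0 1. c < x \<bullet> y} \<in> sets sphere_area"
      "{x \<in> sphere 0 1. c \<le> x \<bullet> y} \<in> sets sphere_area" by simp_all
  qed
  have W: "measure sphere_area {x \<in> sphere 0 1. c \<le> x \<bullet> y} = 2 * pi * (1 - c)"
    if "0 < c" "c \<le> 1" "norm y = 1" for c y
    using emeasure_cap[OF that] that(2) by (simp add: measure_def)
  have lower: "2 * pi * (1 - c) \<le> M y c" if c: "0 \<le> c" "c < 1" and y: "norm y = 1" for c y
  proof (rule field_le_epsilon)
    fix e :: real assume e: "0 < e"
    define d where "d = min (1 - c) (e / (2 * pi))"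
    have d: "0 < d" "c + d \<le> 1" "2 * pi * d \<le> e" using e c by (auto simp: d_def min_def field_simps)
    have "2 * pi * (1 - (c + d)) = measure sphere_area {x \<in> sphere 0 1. c + d \<le> x \<bullet> y}"
      using W[of "c + d" y] c d y by simp
    also have "\<dots> \<le> M y c" unfolding M_def
      by (rule sphere.finite_measure_mono[OF _ sets(1)]) (use d in auto)
    finally show "2 * pi * (1 - c) \<le> M y c + e" using d by (simp add: algebra_simps)
  qed
  have upper: "M y c \<le> 2 * pi * (1 - c)" if c: "0 \<le> c" "c < 1" and y: "norm y = 1" for c y
  proof (cases "c = 0")
    case False
    have "M y c \<le> measure sphere_area {x \<in> sphere 0 1. c \<le> x \<bullet> y}" unfolding M_def
      by (rule sphere.finite_measure_mono[OF _ sets(2)]) auto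
    then show ?thesis using W[of c y] c y False by simp
  next
    case True
    have "M y 0 + M (- y) 0 = measure sphere_area ({x \<in> sphere 0 1. 0 < x \<bullet> y} \<union> {x \<in> sphere 0 1. 0 < x \<bullet> - y})"
      unfolding M_def by (rule sphere.finite_measure_Union[OF sets(1) sets(1), symmetric]) auto
    also have "\<dots> \<le> 4 * pi"
      using sphere.bounded_measure by simp
    finally show ?thesis using lower[of 0 "- y"] y True by simp
  qed
  show "emeasure (distr sphere_area borel (\<lambda>x. x \<bullet> y)) {c<..} < \<infinity>" for c
    by (subst emeasure_distr) (auto simp: sphere.emeasure_finite less_top[symmetric])
  show "emeasure (distr sphere_area borel (\<lambda>x. x \<bullet> y)) {c<..} =
     emeasure (density lborel (\<lambda>t. ennreal (2 * pi) * indicator {-1..1} t)) {c<..}" for c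
  proof -
    have "emeasure (distr sphere_area borel (\<lambda>x. x \<bullet> y)) {c<..} = ennreal (M y c)"
      unfolding M_def by (subst emeasure_distr) (auto simp: sphere.emeasure_eq_measure intro!: arg_cong2[where f=measure])
    also have "M y c = 2 * pi * measure lborel ({-1..1} \<inter> {c<..})"
    proof -
      consider "c < -1" | "-1 \<le> c" "c < 0" | "0 \<le> c" "c < 1" | "1 \<le> c" by linarith
      then show ?thesis
      proof cases
        case 1
        then have "{x \<in> sphere 0 1. c < x \<bullet> y} = sphere 0 1" "{-1..1} \<inter> {c<..} = {-1..1}" 
          using abs[OF _ y] by force+
        then show ?thesis by (simp add: M_def)
      next
        case 2
        have "M y c = measure sphere_area (space sphere_area - {x \<in> sphere 0 1. - c \<le> x \<bullet> - y})"
          unfolding M_def by (intro arg_cong2[where f=measure]) auto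
        also have "\<dots> = 4 * pi - 2 * pi * (1 - (- c))"
          using 2 y by (subst sphere.finite_measure_compl) (use W[of "- c" "- y"] sets(2)[of "- c" "- y"] in auto)
        also have "{-1..1} \<inter> {c<..} = {c<..1}" using 2 by auto
        ultimately show ?thesis using 2 by (simp add: algebra_simps)
      next
        case 3
        then have "{-1..1} \<inter> {c<..} = {c<..1}" by auto
        then show ?thesis using lower[OF 3 y] upper[OF 3 y] 3 by simp
      next
        case 4
        then have "{x \<in> sphere 0 1. c < x \<bullet> y} = {}" "{-1..1} \<inter> {c<..} = {}" 
          using abs[OF _ y] by force+
        then show ?thesis unfolding M_def by (simp only: measure_empty mult_zero_right)
      qed
    qed
    also have "ennreal \<dots> = emeasure (density lborel (\<lambda>t. ennreal (2 * pi) * indicator {-1..1} t)) {c<..}"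
    proof -
      have "emeasure lborel ({-1..1} \<inter> {c<..}) < \<infinity>" by (rule emeasure_bounded_finite) auto
      then have "emeasure lborel ({-1..1} \<inter> {c<..}) = ennreal (measure lborel ({-1..1} \<inter> {c<..}))"
        by (intro emeasure_eq_ennreal_measure) auto
      then show ?thesis 
        by (subst emeasure_density) (auto simp: mult.assoc indicator_inter_arith[symmetric] nn_integral_cmult ennreal_mult)
    qed
    finally show ?thesis .
  qed
qed simp_all

lemma hat_box:
  assumes y: "norm y = 1" and [measurable]: "f \<in> borel_measurable borel"
  shows "(\<integral>\<^sup>+x. f (x \<bullet> y) \<partial>sphere_area) = ennreal (2 * pi) * (\<integral>\<^sup>+t. f t * indicator {-1..1} t \<partial>lborel)"
proof -
  have "(\<integral>\<^sup>+x. f (x \<bullet> y) \<partial>sphere_area) = (\<integral>\<^sup>+t. f t \<partial>distr sphere_area borel (\<lambda>x. x \<bullet> y))"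
    by (subst nn_integral_distr) auto
  also have "\<dots> = (\<integral>\<^sup>+t. ennreal (2 * pi) * (f t * indicator {-1..1} t) \<partial>lborel)"
    unfolding distr_sphere_area_inner[OF y]
    by (subst nn_integral_density) (auto intro!: nn_integral_cong split: split_indicator)
  also have "\<dots> = ennreal (2 * pi) * (\<integral>\<^sup>+t. f t * indicator {-1..1} t \<partial>lborel)"
    by (subst nn_integral_cmult) auto
  finally show ?thesis .
qed

section \<open>Zonal integrals and the energy of the regularised Green function\<close>

lemma unit_vector_direction:
  fixes w :: "real^3" obtains y where "norm y = 1" "w = norm w *\<^sub>R y"
proof (cases "w = 0")
  case True
  then show ?thesis using that[of "axis 1 1"] by simp
next
  case False
  then show ?thesis using that[of "w /\<^sub>R norm w"] by simp
qed

lemma sphere_inner_le: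
  fixes x y :: "'a::real_inner" assumes "norm x = 1" "norm y \<le> 1"
  shows "x \<bullet> y \<le> 1" "- 1 \<le> x \<bullet> y"
proof -
  have "\<bar>x \<bullet> y\<bar> \<le> 1" using Cauchy_Schwarz_ineq2[of x y] assms by simp
  then show "x \<bullet> y \<le> 1" "- 1 \<le> x \<bullet> y" by linarith+
qed

lemma nn_integral_sphere_inverse_square:
  fixes w :: "real^3" assumes w: "norm w < a"
  shows "(\<integral>\<^sup>+x. ennreal (1 / (a - x \<bullet> w)\<^sup>2) \<partial>sphere_area) = ennreal (4 * pi / (a\<^sup>2 - (norm w)\<^sup>2))"
proof -
  define r where "r = norm w"
  obtain y where y: "norm y = 1" "w = r *\<^sub>R y" unfolding r_def by (rule unit_vector_direction)
  have r: "0 \<le> r" "r < a" "0 < a" using w norm_ge_zero[of w] unfolding r_def by linarith+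
  have pos: "0 < a - r * t" if "t \<in> {-1..1}" for t
  proof -
    have "r * t \<le> r * 1" using that r by (intro mult_left_mono) auto
    then show ?thesis using r by simp
  qed
  have "(\<integral>\<^sup>+x. ennreal (1 / (a - x \<bullet> w)\<^sup>2) \<partial>sphere_area) = (\<integral>\<^sup>+x. ennreal (1 / (a - r * (x \<bullet> y))\<^sup>2) \<partial>sphere_area)"
    by (simp add: y(2))
  also have "\<dots> = ennreal (2 * pi) * (\<integral>\<^sup>+t. ennreal (1 / (a - r * t)\<^sup>2) * indicator {-1..1} t \<partial>lborel)"
    by (rule hat_box[OF y(1), of "\<lambda>t. ennreal (1 / (a - r * t)\<^sup>2)"]) measurable
  also have "(\<integral>\<^sup>+t. ennreal (1 / (a - r * t)\<^sup>2) * indicator {-1..1} t \<partial>lborel)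
      = ennreal (1 / (a * (a - r * 1)) - (- 1) / (a * (a - r * (- 1))))"
  proof (rule nn_integral_FTC_Icc[where F = "\<lambda>t. t / (a * (a - r * t))"])
    fix t :: real assume t: "t \<in> {-1..1}"
    note p = pos[OF t]
    have "((\<lambda>t. t / (a * (a - r * t))) has_real_derivative
        (1 * (a * (a - r * t)) - t * (a * (0 - r * 1))) / ((a * (a - r * t)) * (a * (a - r * t)))) (at t)"
      using p r by (auto intro!: derivative_eq_intros)
    also have "(1 * (a * (a - r * t)) - t * (a * (0 - r * 1))) / ((a * (a - r * t)) * (a * (a - r * t))) = 1 / (a - r * t)\<^sup>2"
      using p r by (simp add: divide_simps power2_eq_square) (simp add: algebra_simps)
    finally show "((\<lambda>t. t / (a * (a - r * t))) has_real_derivative 1 / (a - r * t)\<^sup>2) (at t)" .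
  qed auto
  also have "1 / (a * (a - r * 1)) - (- 1) / (a * (a - r * (- 1))) = 2 / (a\<^sup>2 - r\<^sup>2)"
  proof -
    have "a\<^sup>2 - r\<^sup>2 = (a - r) * (a + r)" by (simp add: power2_eq_square algebra_simps)
    then show ?thesis using r by (simp add: divide_simps)
  qed
  also have "ennreal (2 * pi) * ennreal (2 / (a\<^sup>2 - r\<^sup>2)) = ennreal (4 * pi / (a\<^sup>2 - r\<^sup>2))"
    using r by (subst ennreal_mult[symmetric]) (auto intro!: divide_nonneg_nonneg power_mono)
  finally show ?thesis by (simp add: r_def)
qed

lemma nn_integral_sphere_inverse:
  fixes y :: "real^3" assumes y: "norm y = 1" and a: "1 < a"
  shows "(\<integral>\<^sup>+x. ennreal (1 / (a - x \<bullet> y)) \<partial>sphere_area) = ennreal (2 * pi * ln ((a + 1) / (a - 1)))"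
proof -
  have "(\<integral>\<^sup>+x. ennreal (1 / (a - x \<bullet> y)) \<partial>sphere_area)
      = ennreal (2 * pi) * (\<integral>\<^sup>+t. ennreal (1 / (a - t)) * indicator {-1..1} t \<partial>lborel)"
    by (rule hat_box[OF y, of "\<lambda>t. ennreal (1 / (a - t))"]) measurable
  also have "(\<integral>\<^sup>+t. ennreal (1 / (a - t)) * indicator {-1..1} t \<partial>lborel) = ennreal (- ln (a - 1) - (- ln (a - (- 1))))"
    using a by (intro nn_integral_FTC_Icc) (auto intro!: derivative_eq_intros)
  also have "- ln (a - 1) - (- ln (a - (- 1))) = ln ((a + 1) / (a - 1))"
    using a by (simp add: ln_div)
  also have "ennreal (2 * pi) * ennreal (ln ((a + 1) / (a - 1))) = ennreal (2 * pi * ln ((a + 1) / (a - 1)))"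
    using a by (subst ennreal_mult[symmetric]) auto
  finally show ?thesis .
qed

text \<open>
  On the sphere \<open>a\<^sup>2 + 1 - 2 (x \<bullet> y) = |x - y|\<^sup>2 + (a\<^sup>2 - 1)\<close>, so this bounds the regularised integral of \<open>|x - y|\<^sup>-\<^sup>2\<^sup>s\<close>
  uniformly in \<open>a\<close>. The exponent \<open>s\<close> must stay below \<open>1\<close>, and this restriction is the only source of the
  \<open>\<epsilon>\<close>-loss in the final inequality.
\<close>

lemma nn_integral_sphere_powr:
  fixes y :: "real^3" assumes y: "norm y = 1" and a: "1 < a" "a \<le> 2" and s: "0 < s" "s < 1"
  shows "(\<integral>\<^sup>+x. ennreal ((a\<^sup>2 + 1 - 2 * (x \<bullet> y)) powr - s) \<partial>sphere_area) \<le> ennreal (7 * pi / (1 - s))"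
proof -
  define b where "b = a\<^sup>2 + 1"
  have b: "2 < b" "b \<le> 5" using a power_strict_mono[of 1 a 2] power_mono[of a 2 2] by (auto simp: b_def)
  have "(\<integral>\<^sup>+x. ennreal ((b - 2 * (x \<bullet> y)) powr - s) \<partial>sphere_area)
      = ennreal (2 * pi) * (\<integral>\<^sup>+t. ennreal ((b - 2 * t) powr - s) * indicator {-1..1} t \<partial>lborel)"
    by (rule hat_box[OF y, of "\<lambda>t. ennreal ((b - 2 * t) powr - s)"]) measurable
  also have "(\<integral>\<^sup>+t. ennreal ((b - 2 * t) powr - s) * indicator {-1..1} t \<partial>lborel)
     = ennreal (- ((b - 2 * 1) powr (1 - s)) / (2 * (1 - s)) - (- ((b - 2 * (- 1)) powr (1 - s)) / (2 * (1 - s))))"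
  proof (rule nn_integral_FTC_Icc)
    fix t :: real assume t: "t \<in> {-1..1}"
    then have "0 < b - 2 * t" using b by auto
    then have "((\<lambda>t. (b - 2 * t) powr (1 - s)) has_real_derivative (1 - s) * (b - 2 * t) powr (1 - s - of_nat 1) * (- 2)) (at t)"
      by (intro DERIV_fun_powr) (auto intro!: derivative_eq_intros)
    then have "((\<lambda>t. - ((b - 2 * t) powr (1 - s)) / (2 * (1 - s))) has_real_derivative
        - ((1 - s) * (b - 2 * t) powr (1 - s - of_nat 1) * (- 2)) / (2 * (1 - s))) (at t)"
      by (intro DERIV_cdivide DERIV_minus)
    moreover have "- ((1 - s) * X * (- 2)) / (2 * (1 - s)) = X" for X using s by (simp add: field_simps)
    ultimately show "((\<lambda>t. - ((b - 2 * t) powr (1 - s)) / (2 * (1 - s))) has_real_derivative (b - 2 * t) powr - s) (at t)"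
      by simp
  qed auto
  also have "\<dots> \<le> ennreal (7 / (2 * (1 - s)))"
  proof (rule ennreal_leI)
    have "(b + 2) powr (1 - s) \<le> (b + 2) powr 1" using b s by (intro powr_mono) auto
    then have "(b + 2) powr (1 - s) \<le> 7" using b by simp
    moreover have "0 \<le> (b - 2) powr (1 - s)" by simp
    ultimately have "(b + 2) powr (1 - s) - (b - 2) powr (1 - s) \<le> 7" by linarith
    then have "((b + 2) powr (1 - s) - (b - 2) powr (1 - s)) / (2 * (1 - s)) \<le> 7 / (2 * (1 - s))"
      using s by (intro divide_right_mono) auto
    then show "- ((b - 2 * 1) powr (1 - s)) / (2 * (1 - s)) - (- ((b - 2 * (- 1)) powr (1 - s)) / (2 * (1 - s)))
      \<le> 7 / (2 * (1 - s))" by (simp add: diff_divide_distrib)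
  qed
  also have "ennreal (2 * pi) * ennreal (7 / (2 * (1 - s))) = ennreal (7 * pi / (1 - s))"
    using s by (subst ennreal_mult[symmetric]) (auto simp: field_simps)
  finally show ?thesis unfolding b_def by (simp add: mult_left_mono)
qed

lemma integral_sphere_inner_quadratic:
  fixes y :: "real^3" assumes y: "norm y = 1"
  shows "(\<integral>x. (x \<bullet> y - c)\<^sup>2 \<partial>sphere_area) = 4 * pi * (1 / 3 + c\<^sup>2)"
proof -
  have "(\<integral>x. (x \<bullet> y - c)\<^sup>2 \<partial>sphere_area) = enn2real (\<integral>\<^sup>+x. ennreal ((x \<bullet> y - c)\<^sup>2) \<partial>sphere_area)"
    by (rule integral_eq_nn_integral) auto
  also have "(\<integral>\<^sup>+x. ennreal ((x \<bullet> y - c)\<^sup>2) \<partial>sphere_area)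
      = ennreal (2 * pi) * (\<integral>\<^sup>+t. ennreal ((t - c)\<^sup>2) * indicator {-1..1} t \<partial>lborel)"
    by (rule hat_box[OF y, of "\<lambda>t. ennreal ((t - c)\<^sup>2)"]) measurable
  also have "(\<integral>\<^sup>+t. ennreal ((t - c)\<^sup>2) * indicator {-1..1} t \<partial>lborel) = ennreal ((1 - c) ^ 3 / 3 - (- 1 - c) ^ 3 / 3)"
    by (intro nn_integral_FTC_Icc) (auto intro!: derivative_eq_intros)
  also have "(1 - c) ^ 3 / 3 - (- 1 - c) ^ 3 / 3 = 2 * (1 / 3 + c\<^sup>2)"
    by (simp add: power3_eq_cube power2_eq_square field_simps)
  also have "ennreal (2 * pi) * ennreal (2 * (1 / 3 + c\<^sup>2)) = ennreal (4 * pi * (1 / 3 + c\<^sup>2))"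
    by (subst ennreal_mult[symmetric]) auto
  finally show ?thesis by simp
qed


lemma integrable_sphere_bounded:
  fixes f :: "real^3 \<Rightarrow> 'b::{banach, second_countable_topology}"
  assumes "f \<in> borel_measurable sphere_area" "\<And>x. norm x = 1 \<Longrightarrow> norm (f x) \<le> B"
  shows "integrable sphere_area f"
  using assms by (intro sphere.integrable_const_bound[of _ B]) auto

text \<open>
  Feynman's parametrisation turns the product into a superposition of inverse squares,
  \<open>1/(p q) = \<integral>\<^sub>0\<^sup>1 dt / (t p + (1 - t) q)\<^sup>2\<close>. With \<open>p = a - x \<bullet> y\<close> and \<open>q = a - x \<bullet> z\<close> the denominator is
  \<open>(a - x \<bullet> w)\<^sup>2\<close> for a point \<open>w\<close> of the chord from \<open>z\<close> to \<open>y\<close>, and \<open>|w|\<^sup>2 = 1 - 2 t (1 - t) k\<close>. The integral over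
  the sphere is \<open>4 \<pi> / (\<eta> + 2 t (1 - t) k)\<close>; it is bounded below by a multiple of the derivative of
  \<open>(ln (\<eta> + 2 k t) - ln (\<eta> + 2 k (1 - t))) / 2\<close>, which has an elementary integral over \<open>[0, 1]\<close>.
\<close>

lemma integral_sphere_inverse_product_ge:
  fixes y z :: "real^3"
  assumes y: "norm y = 1" and z: "norm z = 1" and a: "1 < a"
  defines "\<eta> \<equiv> a\<^sup>2 - 1" and "k \<equiv> 1 - y \<bullet> z"
  shows "4 * pi * ln ((\<eta> + 2 * k) / \<eta>) \<le> (\<eta> + k) * (\<integral>x. 1 / ((a - x \<bullet> y) * (a - x \<bullet> z)) \<partial>sphere_area)"
proof -
  interpret pair_sigma_finite sphere_area "lborel :: real measure" ..
  have \<eta>: "0 < \<eta>" using a by (simp add: \<eta>_def)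
  have k: "0 \<le> k" using sphere_inner_le[of y z] y z by (simp add: k_def)
  let ?w = "\<lambda>t. t *\<^sub>R y + (1 - t) *\<^sub>R z"
  have norm_w: "(norm (?w t))\<^sup>2 = 1 - 2 * t * (1 - t) * k" for t
  proof -
    have "y \<bullet> y = 1" "z \<bullet> z = 1" using y z by (simp_all add: dot_square_norm)
    then have "(norm (?w t))\<^sup>2 = t\<^sup>2 + (1 - t)\<^sup>2 + 2 * t * (1 - t) * (y \<bullet> z)"
      unfolding power2_norm_eq_inner by (simp add: inner_simps inner_commute power2_eq_square algebra_simps)
    then show ?thesis by (simp add: k_def power2_eq_square algebra_simps)
  qed
  have norm_w1: "norm (?w t) \<le> 1" if "t \<in> {0..1}" for t
  proof -
    have "norm (?w t) \<le> norm (t *\<^sub>R y) + norm ((1 - t) *\<^sub>R z)" by (rule norm_triangle_ineq)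
    then show ?thesis using that y z by simp
  qed
  have den: "0 < \<eta> + 2 * k * t" "0 < \<eta> + 2 * k * (1 - t)" "0 < \<eta> + 2 * t * (1 - t) * k" if "t \<in> {0..1}" for t
    using that k \<eta> by (auto intro!: add_pos_nonneg)
  have pq: "0 < a - x \<bullet> y" "0 < a - x \<bullet> z" if "norm x = 1" for x
    using sphere_inner_le(1)[of x y] sphere_inner_le(1)[of x z] that y z a by auto
  have nonneg: "0 \<le> 1 / ((a - x \<bullet> y) * (a - x \<bullet> z))" if "norm x = 1" for x
    using pq[OF that] by simp
  have feynman: "ennreal (1 / ((a - x \<bullet> y) * (a - x \<bullet> z)))
      = (\<integral>\<^sup>+t. ennreal (1 / (a - x \<bullet> ?w t)\<^sup>2) * indicator {0..1} t \<partial>lborel)" if x: "norm x = 1" for x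
  proof -
    define p q where "p = a - x \<bullet> y" and "q = a - x \<bullet> z"
    have p: "0 < p" and q: "0 < q" using pq[OF x] by (auto simp: p_def q_def)
    have lin: "a - x \<bullet> ?w t = q + t * (p - q)" for t by (simp add: p_def q_def inner_simps algebra_simps)
    have "(\<integral>\<^sup>+t. ennreal (1 / (a - x \<bullet> ?w t)\<^sup>2) * indicator {0..1} t \<partial>lborel)
        = ennreal (1 / (q * (q + 1 * (p - q))) - 0 / (q * (q + 0 * (p - q))))" unfolding lin
    proof (rule nn_integral_FTC_Icc[where F = "\<lambda>t. t / (q * (q + t * (p - q)))"])
      fix t :: real assume t: "t \<in> {0..1}"
      have "q + t * (p - q) = t * p + (1 - t) * q" by (simp add: algebra_simps)
      also have "0 < \<dots>" using t p q by (cases "t = 0") (auto intro!: add_pos_nonneg)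
      finally have pos: "0 < q + t * (p - q)" .
      have "((\<lambda>t. t / (q * (q + t * (p - q)))) has_real_derivative
        (1 * (q * (q + t * (p - q))) - t * (q * (0 + 1 * (p - q)))) / ((q * (q + t * (p - q))) * (q * (q + t * (p - q))))) (at t)"
        using pos q by (auto intro!: derivative_eq_intros)
      also have "1 * (q * (q + t * (p - q))) - t * (q * (0 + 1 * (p - q))) = q * q"
        by (simp add: algebra_simps)
      also have "q * q / ((q * (q + t * (p - q))) * (q * (q + t * (p - q)))) = 1 / (q + t * (p - q))\<^sup>2"
        using pos q by (simp add: power2_eq_square)
      finally show "((\<lambda>t. t / (q * (q + t * (p - q)))) has_real_derivative 1 / (q + t * (p - q))\<^sup>2) (at t)" .
    qed auto
    then show ?thesis by (simp add: p_def q_def mult.commute)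
  qed
  have "ennreal (4 * pi / (\<eta> + k) * ln ((\<eta> + 2 * k) / \<eta>))
      = ennreal (4 * pi / (\<eta> + k)) * ennreal ((ln (\<eta> + 2 * k * 1) - ln (\<eta> + 2 * k * (1 - 1))) / 2 - (ln (\<eta> + 2 * k * 0) - ln (\<eta> + 2 * k * (1 - 0))) / 2)"
  proof -
    have "(ln (\<eta> + 2 * k * 1) - ln (\<eta> + 2 * k * (1 - 1))) / 2 - (ln (\<eta> + 2 * k * 0) - ln (\<eta> + 2 * k * (1 - 0))) / 2
      = ln ((\<eta> + 2 * k) / \<eta>)" using \<eta> k by (simp add: ln_div field_simps)
    moreover have "0 \<le> ln ((\<eta> + 2 * k) / \<eta>)" using \<eta> k by (intro ln_ge_zero) simp
    ultimately show ?thesis using \<eta> k by (simp only:) (subst ennreal_mult[symmetric], auto)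
  qed
  also have "ennreal ((ln (\<eta> + 2 * k * 1) - ln (\<eta> + 2 * k * (1 - 1))) / 2 - (ln (\<eta> + 2 * k * 0) - ln (\<eta> + 2 * k * (1 - 0))) / 2)
     = (\<integral>\<^sup>+t. ennreal ((2 * k / (\<eta> + 2 * k * t) + 2 * k / (\<eta> + 2 * k * (1 - t))) / 2) * indicator {0..1} t \<partial>lborel)"
  proof (rule nn_integral_FTC_Icc[symmetric, where F = "\<lambda>t. (ln (\<eta> + 2 * k * t) - ln (\<eta> + 2 * k * (1 - t))) / 2"])
    fix t :: real assume t: "t \<in> {0..1}"
    show "((\<lambda>t. (ln (\<eta> + 2 * k * t) - ln (\<eta> + 2 * k * (1 - t))) / 2) has_real_derivative
        (2 * k / (\<eta> + 2 * k * t) + 2 * k / (\<eta> + 2 * k * (1 - t))) / 2) (at t)"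
      using den[OF t] by (auto intro!: derivative_eq_intros)
    show "0 \<le> (2 * k / (\<eta> + 2 * k * t) + 2 * k / (\<eta> + 2 * k * (1 - t))) / 2"
      using den[OF t] k by auto
  qed auto
  also have "ennreal (4 * pi / (\<eta> + k)) * \<dots>
     = (\<integral>\<^sup>+t. ennreal (4 * pi / (\<eta> + k)) * (ennreal ((2 * k / (\<eta> + 2 * k * t) + 2 * k / (\<eta> + 2 * k * (1 - t))) / 2) * indicator {0..1} t) \<partial>lborel)"
    by (rule nn_integral_cmult[symmetric]) measurable
  also have "\<dots> \<le> (\<integral>\<^sup>+t. ennreal (4 * pi / (a\<^sup>2 - (norm (?w t))\<^sup>2)) * indicator {0..1} t \<partial>lborel)"
  proof (rule nn_integral_mono)
    fix t :: real
    have "4 * pi / (\<eta> + k) * ((2 * k / (\<eta> + 2 * k * t) + 2 * k / (\<eta> + 2 * k * (1 - t))) / 2) \<le> 4 * pi / (a\<^sup>2 - (norm (?w t))\<^sup>2)"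
      if t: "t \<in> {0..1}"
    proof -
      define A B C where "A = \<eta> + 2 * k * t" and "B = \<eta> + 2 * k * (1 - t)" and "C = \<eta> + 2 * t * (1 - t) * k"
      have ABC: "0 < A" "0 < B" "0 < C" using den[OF t] by (auto simp: A_def B_def C_def)
      have sum: "A + B = 2 * (\<eta> + k)" by (simp add: A_def B_def algebra_simps)
      \<comment> \<open>The comparison of the two integrands: \<open>A B\<close> exceeds \<open>2 k C\<close> by the square \<open>\<eta>\<^sup>2\<close>.\<close>
      have "A * B = \<eta>\<^sup>2 + 2 * k * C" by (simp add: A_def B_def C_def power2_eq_square algebra_simps)
      then have "2 * k * C \<le> A * B" by simp
      then have "2 * k / (A * B) \<le> 1 / C" using ABC by (simp add: field_simps)
      moreover have "(2 * k / A + 2 * k / B) / 2 = (\<eta> + k) * (2 * k / (A * B))"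
      proof -
        have "(2 * k / A + 2 * k / B) / 2 = k * (A + B) / (A * B)" using ABC by (simp add: field_simps)
        then show ?thesis unfolding sum by simp
      qed
      ultimately have "1 / (\<eta> + k) * ((2 * k / A + 2 * k / B) / 2) \<le> 1 / C" using \<eta> k by simp
      then have "4 * pi * (1 / (\<eta> + k) * ((2 * k / A + 2 * k / B) / 2)) \<le> 4 * pi * (1 / C)"
        by (intro mult_left_mono) auto
      moreover have "a\<^sup>2 - (norm (?w t))\<^sup>2 = C" unfolding norm_w by (simp add: C_def \<eta>_def)
      ultimately show ?thesis by (simp add: A_def B_def)
    qed
    then show "ennreal (4 * pi / (\<eta> + k)) * (ennreal ((2 * k / (\<eta> + 2 * k * t) + 2 * k / (\<eta> + 2 * k * (1 - t))) / 2) * indicator {0..1} t)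
      \<le> ennreal (4 * pi / (a\<^sup>2 - (norm (?w t))\<^sup>2)) * indicator {0..1} t"
      using \<eta> k by (cases "t \<in> {0..1}") (simp_all add: ennreal_mult'[symmetric] ennreal_leI del: atLeastAtMost_iff)
  qed
  also have "\<dots> = (\<integral>\<^sup>+t. (\<integral>\<^sup>+x. ennreal (1 / (a - x \<bullet> ?w t)\<^sup>2) * indicator {0..1} t \<partial>sphere_area) \<partial>lborel)"
  proof (rule nn_integral_cong)
    fix t :: real
    show "ennreal (4 * pi / (a\<^sup>2 - (norm (?w t))\<^sup>2)) * indicator {0..1} t
      = (\<integral>\<^sup>+x. ennreal (1 / (a - x \<bullet> ?w t)\<^sup>2) * indicator {0..1} t \<partial>sphere_area)"
    proof (cases "t \<in> {0..1}")
      case True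
      have "norm (?w t) < a" using norm_w1[OF True] a by simp
      from nn_integral_sphere_inverse_square[OF this] True show ?thesis by simp
    qed simp
  qed
  also have "\<dots> = (\<integral>\<^sup>+x. (\<integral>\<^sup>+t. ennreal (1 / (a - x \<bullet> ?w t)\<^sup>2) * indicator {0..1} t \<partial>lborel) \<partial>sphere_area)"
    by (rule Fubini') measurable
  also have "\<dots> = (\<integral>\<^sup>+x. ennreal (1 / ((a - x \<bullet> y) * (a - x \<bullet> z))) \<partial>sphere_area)"
    by (rule nn_integral_cong) (simp add: feynman)
  also have "\<dots> = ennreal (\<integral>x. 1 / ((a - x \<bullet> y) * (a - x \<bullet> z)) \<partial>sphere_area)"
  proof (rule nn_integral_eq_integral)
    show "integrable sphere_area (\<lambda>x. 1 / ((a - x \<bullet> y) * (a - x \<bullet> z)))"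
    proof (rule integrable_sphere_bounded)
      fix x :: "real^3" assume x: "norm x = 1"
      have "(a - 1) * (a - 1) \<le> (a - x \<bullet> y) * (a - x \<bullet> z)"
        using sphere_inner_le(1)[of x y] sphere_inner_le(1)[of x z] x y z a by (intro mult_mono) auto
      then show "norm (1 / ((a - x \<bullet> y) * (a - x \<bullet> z))) \<le> 1 / ((a - 1) * (a - 1))"
        using a pq[OF x] by (auto simp: norm_divide intro!: divide_left_mono)
    qed measurable
    show "AE x in sphere_area. 0 \<le> 1 / ((a - x \<bullet> y) * (a - x \<bullet> z))"
      by (rule AE_I2, rule nonneg) simp
  qed
  finally have "4 * pi / (\<eta> + k) * ln ((\<eta> + 2 * k) / \<eta>) \<le> (\<integral>x. 1 / ((a - x \<bullet> y) * (a - x \<bullet> z)) \<partial>sphere_area)"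
    by (rule ennreal_le_iff[THEN iffD1, rotated]) (rule integral_nonneg_AE, rule AE_I2, rule nonneg, simp)
  then show ?thesis using \<eta> k by (simp add: field_simps)
qed

text \<open>
  On the sphere this is the gradient in \<open>x\<close> of \<open>- ln (a - x \<bullet> y) / (4 \<pi>)\<close>. The denominator is written
  with \<open>|x - y|\<^sup>2\<close>, which agrees with \<open>2 - 2 (x \<bullet> y)\<close> on the sphere and keeps it positive on
  the whole ambient space, so that the field is smooth everywhere.
\<close>

definition green_field :: "real \<Rightarrow> real^3 \<Rightarrow> real^3 \<Rightarrow> real^3" where
  "green_field a y x = (1 / (4 * pi * (a - 1 + (x - y) \<bullet> (x - y) / 2))) *\<^sub>R (y - (x \<bullet> y) *\<^sub>R x)"

lemma green_field_denominator:
  fixes x y :: "'a::real_inner" 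
  assumes "norm x = 1" "norm y = 1" shows "a - 1 + (x - y) \<bullet> (x - y) / 2 = a - x \<bullet> y"
proof -
  have "x \<bullet> x = 1" "y \<bullet> y = 1" using assms by (simp_all add: dot_square_norm)
  then show ?thesis by (simp add: inner_simps inner_commute field_simps)
qed

text \<open>
  With \<open>p = a - x \<bullet> y\<close> and \<open>q = a - x \<bullet> z\<close> the integrand equals \<open>(a/p + a/q - 1 - (\<eta> + k)/(p q)) / (4 \<pi>)\<^sup>2\<close>. The integrals of
  \<open>a/p\<close> and \<open>a/q\<close> diverge like \<open>ln (1/(a - 1))\<close> as \<open>a \<rightarrow> 1\<close>; the lower bound for the integral of \<open>1/(p q)\<close> cancels
  this and leaves \<open>- ln |y - z|\<^sup>2\<close> up to a constant that does not depend on \<open>a\<close>. Estimating the energy directly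
  avoids an integration by parts on the sphere.
\<close>

lemma green_energy_le:
  fixes y z :: "real^3"
  assumes y: "norm y = 1" and z: "norm z = 1" and a: "1 < a" "a \<le> 2"
  shows "(\<integral>x. green_field a y x \<bullet> green_field a z x \<partial>sphere_area) \<le> (5 - ln (a\<^sup>2 + 1 - 2 * (y \<bullet> z))) / (4 * pi)"
proof -
  define \<eta> k where "\<eta> = a\<^sup>2 - 1" and "k = 1 - y \<bullet> z"
  have \<eta>: "0 < \<eta>" using a by (simp add: \<eta>_def)
  have k: "0 \<le> k" using sphere_inner_le[of y z] y z by (simp add: k_def)
  have ge: "a - 1 \<le> a - x \<bullet> v" if "norm x = 1" "norm v = 1" for x v :: "real^3"
    using sphere_inner_le(1)[of x v] that by auto
  have int1: "integrable sphere_area (\<lambda>x. 1 / (a - x \<bullet> v))" if v: "norm v = 1" for v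
  proof (rule integrable_sphere_bounded)
    fix x :: "real^3" assume x: "norm x = 1"
    show "norm (1 / (a - x \<bullet> v)) \<le> 1 / (a - 1)"
      using ge[OF x v] a by (auto simp: norm_divide intro!: divide_left_mono)
  qed measurable
  have val1: "(\<integral>x. 1 / (a - x \<bullet> v) \<partial>sphere_area) = 2 * pi * ln ((a + 1) / (a - 1))" if v: "norm v = 1" for v
  proof -
    have "(\<integral>x. 1 / (a - x \<bullet> v) \<partial>sphere_area) = enn2real (\<integral>\<^sup>+x. ennreal (1 / (a - x \<bullet> v)) \<partial>sphere_area)"
    proof (rule integral_eq_nn_integral)
      show "AE x in sphere_area. 0 \<le> 1 / (a - x \<bullet> v)"
        by (rule AE_I2) (use ge[OF _ v] a in \<open>force intro!: divide_nonneg_nonneg\<close>)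
    qed measurable
    then show ?thesis unfolding nn_integral_sphere_inverse[OF v a(1)] using a by simp
  qed
  have int2: "integrable sphere_area (\<lambda>x. 1 / ((a - x \<bullet> y) * (a - x \<bullet> z)))"
  proof (rule integrable_sphere_bounded)
    fix x :: "real^3" assume x: "norm x = 1"
    have "(a - 1) * (a - 1) \<le> (a - x \<bullet> y) * (a - x \<bullet> z)"
      using ge[OF x y] ge[OF x z] a by (intro mult_mono) auto
    moreover have "0 < (a - 1) * (a - 1)" using a by simp
    ultimately show "norm (1 / ((a - x \<bullet> y) * (a - x \<bullet> z))) \<le> 1 / ((a - 1) * (a - 1))"
      by (auto simp: norm_divide abs_mult[symmetric] simp del: abs_mult intro!: divide_left_mono)
  qed measurable
  have integrand: "green_field a y x \<bullet> green_field a z x = 1 / (16 * pi\<^sup>2) *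
      (a * (1 / (a - x \<bullet> y)) + a * (1 / (a - x \<bullet> z)) - 1 - (\<eta> + k) * (1 / ((a - x \<bullet> y) * (a - x \<bullet> z))))"
    if x: "norm x = 1" for x
  proof -
    define p q where "p = a - x \<bullet> y" and "q = a - x \<bullet> z"
    have pq: "0 < p" "0 < q" using ge[OF x y] ge[OF x z] a by (auto simp: p_def q_def)
    have xx: "x \<bullet> x = 1" using x by (simp add: dot_square_norm)
    have "(y - (x \<bullet> y) *\<^sub>R x) \<bullet> (z - (x \<bullet> z) *\<^sub>R x) = y \<bullet> z - (x \<bullet> y) * (x \<bullet> z)"
      by (simp add: inner_simps xx inner_commute)
    also have "\<dots> = a * p + a * q - p * q - (\<eta> + k)"
      by (simp add: p_def q_def \<eta>_def k_def power2_eq_square algebra_simps)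
    finally have "green_field a y x \<bullet> green_field a z x = (1 / (4 * pi * p)) * (1 / (4 * pi * q)) * (a * p + a * q - p * q - (\<eta> + k))"
      unfolding green_field_def green_field_denominator[OF x y] green_field_denominator[OF x z] by (simp add: p_def q_def)
    also have "\<dots> = 1 / (16 * pi\<^sup>2) * ((a * p + a * q - p * q - (\<eta> + k)) / (p * q))"
      by (simp add: power2_eq_square)
    also have "(a * p + a * q - p * q - (\<eta> + k)) / (p * q) = a * (1 / p) + a * (1 / q) - 1 - (\<eta> + k) * (1 / (p * q))"
      using pq by (simp add: divide_simps)
    finally show ?thesis by (simp add: p_def q_def)
  qed
  define I where "I = (\<integral>x. 1 / ((a - x \<bullet> y) * (a - x \<bullet> z)) \<partial>sphere_area)"
  define L where "L = ln ((a + 1) / (a - 1))"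
  have "(\<integral>x. green_field a y x \<bullet> green_field a z x \<partial>sphere_area)
    = (\<integral>x. 1 / (16 * pi\<^sup>2) * (a * (1 / (a - x \<bullet> y)) + a * (1 / (a - x \<bullet> z)) - 1 - (\<eta> + k) * (1 / ((a - x \<bullet> y) * (a - x \<bullet> z)))) \<partial>sphere_area)"
    by (rule Bochner_Integration.integral_cong) (simp_all add: integrand)
  also have "\<dots> = 1 / (16 * pi\<^sup>2) * (a * (2 * pi * L) + a * (2 * pi * L) - 4 * pi - (\<eta> + k) * I)"
    unfolding integral_mult_right_zero
    using int1[OF y] int1[OF z] int2 val1[OF y] val1[OF z]
    by (simp add: I_def L_def Bochner_Integration.integral_diff Bochner_Integration.integral_add del: times_divide_eq_right mult_cancel_left2)
  also have "\<dots> \<le> 1 / (16 * pi\<^sup>2) * (a * (2 * pi * L) + a * (2 * pi * L) - 4 * pi - 4 * pi * ln ((\<eta> + 2 * k) / \<eta>))"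
    using integral_sphere_inverse_product_ge[OF y z a(1)] unfolding I_def \<eta>_def k_def
    by (intro mult_left_mono diff_left_mono) auto
  also have "\<dots> = (a * L - 1 - ln ((\<eta> + 2 * k) / \<eta>)) / (4 * pi)"
    by (simp add: field_simps power2_eq_square)
  also have "\<dots> \<le> (5 - ln (\<eta> + 2 * k)) / (4 * pi)"
  proof (rule divide_right_mono)
    \<comment> \<open>The excess factor \<open>a\<close> in front of the divergent logarithm costs a constant, since \<open>ln (1 + t) \<le> t\<close>.\<close>
    have "(a + 1) / (a - 1) = 1 + 2 / (a - 1)" using a by (simp add: field_simps)
    then have "L \<le> 2 / (a - 1)" unfolding L_def using a ln_add_one_self_le_self[of "2 / (a - 1)"] by simp
    then have 1: "(a - 1) * L \<le> 2" using a by (simp add: field_simps)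
    have "ln (a + 1) \<le> a" using ln_le_minus_one[of "a + 1"] a by simp
    then have 2: "ln (a + 1) \<le> 2" using a by simp
    have 3: "\<eta> = (a + 1) * (a - 1)" by (simp add: \<eta>_def power2_eq_square algebra_simps)
    have "ln \<eta> = ln (a + 1) + ln (a - 1)" unfolding 3 using a by (simp add: ln_mult)
    moreover have "L = ln (a + 1) - ln (a - 1)" unfolding L_def using a by (simp add: ln_div)
    moreover have "ln ((\<eta> + 2 * k) / \<eta>) = ln (\<eta> + 2 * k) - ln \<eta>" using \<eta> k by (simp add: ln_div)
    moreover have "a * L = (a - 1) * L + L" by (simp add: algebra_simps)
    ultimately show "a * L - 1 - ln ((\<eta> + 2 * k) / \<eta>) \<le> 5 - ln (\<eta> + 2 * k)" using 1 2 by linarith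
  qed simp
  also have "\<eta> + 2 * k = a\<^sup>2 + 1 - 2 * (y \<bullet> z)" by (simp add: \<eta>_def k_def)
  finally show ?thesis .
qed

section \<open>Smooth test fields and their divergence\<close>

text \<open>
  In the closure properties below, each an induction on the order, the Leibniz rule keeps one factor
  undifferentiated; this lemma lowers its order to that of the differentiated one.
\<close>

lemma C_k_Suc_imp: "C_k (Suc k) f \<Longrightarrow> C_k k f"
proof (induction k arbitrary: f)
  case 0
  then obtain f' where "\<And>x. (f has_derivative f' x) (at x)" by auto
  then have "continuous_on UNIV f"
    by (intro continuous_at_imp_continuous_on ballI) (rule has_derivative_continuous)
  then show ?case by simp
next
  case (Suc k)
  then obtain f' where f': "\<And>x. (f has_derivative f' x) (at x)" "\<And>h. C_k (Suc k) (\<lambda>x. f' x h)"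
    by (metis C_k.simps(2))
  then show ?case using Suc.IH by (metis C_k.simps(2))
qed

lemma C_k_const: "C_k k (\<lambda>_. c)"
proof (induction k arbitrary: c)
  case (Suc k)
  then show ?case by (auto intro!: exI[of _ "\<lambda>_ _. 0"])
qed auto

lemma C_k_bounded_linear: "bounded_linear f \<Longrightarrow> C_k k f"
proof (cases k)
  case (Suc n)
  assume "bounded_linear f"
  then show ?thesis using Suc by (auto intro!: exI[of _ "\<lambda>_. f"] C_k_const bounded_linear_imp_has_derivative)
qed (auto simp: linear_continuous_on)

lemma C_k_add: "C_k k f \<Longrightarrow> C_k k g \<Longrightarrow> C_k k (\<lambda>x. f x + g x)"
proof (induction k arbitrary: f g)
  case (Suc k)
  then obtain f' g' where "\<And>x. (f has_derivative f' x) (at x)" "\<And>h. C_k k (\<lambda>x. f' x h)"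
      "\<And>x. (g has_derivative g' x) (at x)" "\<And>h. C_k k (\<lambda>x. g' x h)" by auto
  then show ?case using Suc.IH
    by (auto intro!: exI[of _ "\<lambda>x h. f' x h + g' x h"] has_derivative_add)
qed (auto intro: continuous_intros)

lemma C_k_scaleR: "C_k k f \<Longrightarrow> C_k k g \<Longrightarrow> C_k k (\<lambda>x. f x *\<^sub>R g x)"
proof (induction k arbitrary: f g)
  case (Suc k)
  then obtain f' g' where "\<And>x. (f has_derivative f' x) (at x)" "\<And>h. C_k k (\<lambda>x. f' x h)"
      "\<And>x. (g has_derivative g' x) (at x)" "\<And>h. C_k k (\<lambda>x. g' x h)" by auto
  moreover have "C_k k f" "C_k k g" using Suc.prems by (auto intro: C_k_Suc_imp simp del: C_k.simps)
  ultimately show ?case using Suc.IH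
    by (auto intro!: exI[of _ "\<lambda>x h. f x *\<^sub>R g' x h + f' x h *\<^sub>R g x"] C_k_add has_derivative_scaleR)
qed (auto intro: continuous_intros)

lemma C_k_inverse:
  fixes f :: "'a::euclidean_space \<Rightarrow> real"
  assumes "\<And>x. f x \<noteq> 0"
  shows "C_k k f \<Longrightarrow> C_k k (\<lambda>x. inverse (f x))"
proof (induction k)
  case 0
  then show ?case using assms by (auto intro: continuous_on_inverse)
next
  case (Suc k)
  then obtain f' where f': "\<And>x. (f has_derivative f' x) (at x)" "\<And>h. C_k k (\<lambda>x. f' x h)" by auto
  have inv: "C_k k (\<lambda>x. inverse (f x))" using Suc C_k_Suc_imp by blast
  have "((\<lambda>x. inverse (f x)) has_derivative (\<lambda>h. - (inverse (f x) * f' x h * inverse (f x)))) (at x)" for x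
    by (rule Deriv.has_derivative_inverse[OF assms f'(1)])
  moreover have "C_k k (\<lambda>x. - (inverse (f x) * f' x h * inverse (f x)))" for h
    using C_k_scaleR[OF C_k_const[of k "-1::real"] C_k_scaleR[OF inv C_k_scaleR[OF f'(2)[of h] inv]]]
    by (simp add: mult.assoc)
  ultimately show ?case by (auto intro!: exI[of _ "\<lambda>x h. - (inverse (f x) * f' x h * inverse (f x))"])
qed

lemma C_k_inner:
  fixes f g :: "'a::euclidean_space \<Rightarrow> 'b::euclidean_space"
  shows "C_k k f \<Longrightarrow> C_k k g \<Longrightarrow> C_k k (\<lambda>x. f x \<bullet> g x)"
proof (induction k arbitrary: f g)
  case (Suc k)
  then obtain f' g' where "\<And>x. (f has_derivative f' x) (at x)" "\<And>h. C_k k (\<lambda>x. f' x h)"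
      "\<And>x. (g has_derivative g' x) (at x)" "\<And>h. C_k k (\<lambda>x. g' x h)" by auto
  moreover have "C_k k f" "C_k k g" using Suc.prems by (auto intro: C_k_Suc_imp simp del: C_k.simps)
  ultimately show ?case using Suc.IH
    by (auto intro!: exI[of _ "\<lambda>x h. f x \<bullet> g' x h + f' x h \<bullet> g x"] C_k_add has_derivative_inner)
qed (auto intro: continuous_intros)

lemma green_field_denominator_pos:
  fixes x y :: "'a::real_inner" shows "1 < a \<Longrightarrow> 0 < a - 1 + (x - y) \<bullet> (x - y) / 2"
  by (simp add: add_pos_nonneg)

lemma smooth_tangent_green_field:
  assumes "1 < a" shows "smooth_tangent_field (green_field a y)"
  unfolding smooth_tangent_field_def
proof (intro conjI allI ballI)
  fix k
  have id: "C_k k (\<lambda>x::real^3. x)" by (rule C_k_bounded_linear) (rule bounded_linear_ident)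
  have diff: "C_k k (\<lambda>x::real^3. x - y)" using C_k_add[OF id C_k_const[of k "- y"]] by simp
  have "C_k k (\<lambda>x. 4 * pi * (a - 1) + (2 * pi) *\<^sub>R ((x - y) \<bullet> (x - y)))"
    by (intro C_k_add C_k_scaleR C_k_const C_k_inner diff)
  moreover have "4 * pi * (a - 1) + (2 * pi) *\<^sub>R ((x - y) \<bullet> (x - y)) = 4 * pi * (a - 1 + (x - y) \<bullet> (x - y) / 2)" for x
    by (simp add: distrib_left)
  ultimately have "C_k k (\<lambda>x. 4 * pi * (a - 1 + (x - y) \<bullet> (x - y) / 2))" by simp
  then have "C_k k (\<lambda>x. inverse (4 * pi * (a - 1 + (x - y) \<bullet> (x - y) / 2)))"
    using green_field_denominator_pos[OF assms, of _ y] by (intro C_k_inverse) (simp_all add: less_imp_neq[symmetric])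
  then have "C_k k (\<lambda>x. inverse (4 * pi * (a - 1 + (x - y) \<bullet> (x - y) / 2)) *\<^sub>R (y + (-1) *\<^sub>R ((x \<bullet> y) *\<^sub>R x)))"
    by (intro C_k_scaleR C_k_add C_k_const C_k_inner id)
  then show "C_k k (green_field a y)"
    unfolding green_field_def[abs_def] by (simp add: inverse_eq_divide)
next
  fix x :: "real^3" assume "x \<in> sphere 0 1"
  then have "x \<bullet> x = 1" by (simp add: dot_square_norm)
  then show "x \<bullet> green_field a y x = 0" by (simp add: green_field_def inner_simps)
qed

text \<open>
  A kernel of Poisson type: nonnegative, of total mass one, and concentrating at \<open>t = 1\<close> as
  \<open>a \<rightarrow> 1\<close>.
\<close>

definition approximate_identity :: "real \<Rightarrow> real \<Rightarrow> real" where
  "approximate_identity a t = (a\<^sup>2 - 1) / (4 * pi * (a - t)\<^sup>2)"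

text \<open>
  The regularised Green function solves the Poisson equation with the approximate identity in place
  of the point mass; the constant \<open>1/(4 \<pi>)\<close> is the density of the normalised area.
\<close>

lemma sphere_div_green_field:
  assumes x: "norm x = 1" and y: "norm y = 1" and a: "1 < a"
  shows "sphere_div (green_field a y) x = 1 / (4 * pi) - approximate_identity a (x \<bullet> y)"
proof -
  define D where "D x = 4 * pi * (a - 1 + (x - y) \<bullet> (x - y) / 2)" for x :: "real^3"
  define t where "t = x \<bullet> y"
  have D0: "D z \<noteq> 0" for z using green_field_denominator_pos[OF a, of z y] by (simp add: D_def)
  have Dx: "D x = 4 * pi * (a - t)" unfolding D_def green_field_denominator[OF x y] t_def ..
  have at: "0 < a - t" using sphere_inner_le(1)[of x y] x y a by (simp add: t_def)
  have xx: "x \<bullet> x = 1" and yy: "y \<bullet> y = 1" using x y by (simp_all add: dot_square_norm)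
  \<comment> \<open>The derivative of \<open>x \<mapsto> (y - (x \<bullet> y) x) / D x\<close> at \<open>x\<close> in direction \<open>h\<close>.\<close>
  define X' where "X' h = inverse (D x) *\<^sub>R (- ((h \<bullet> y) *\<^sub>R x + t *\<^sub>R h))
      + (- (inverse (D x) * (4 * pi * (h \<bullet> (x - y))) * inverse (D x))) *\<^sub>R (y - t *\<^sub>R x)" for h
  have dD: "(D has_derivative (\<lambda>h. 4 * pi * (h \<bullet> (x - y)))) (at x)"
    unfolding D_def[abs_def]
    by (rule has_derivative_eq_rhs) (auto intro!: derivative_eq_intros simp: inner_commute)
  have "((\<lambda>x. inverse (D x) *\<^sub>R (y - (x \<bullet> y) *\<^sub>R x)) has_derivative X') (at x)"
    unfolding X'_def[abs_def]
    by (rule has_derivative_eq_rhs[OF has_derivative_scaleR[OF Deriv.has_derivative_inverse[OF D0 dD]]])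
       (auto intro!: derivative_eq_intros simp: fun_eq_iff t_def)
  then have "(green_field a y has_derivative X') (at x)"
    unfolding green_field_def[abs_def] D_def[symmetric] by (simp add: inverse_eq_divide)
  then have fd: "frechet_derivative (green_field a y) (at x) = X'" by (rule frechet_derivative_at[symmetric])
  have b: "(\<Sum>b\<in>Basis. (b \<bullet> v) * (w \<bullet> b)) = v \<bullet> w" for v w :: "real^3"
    by (subst euclidean_inner) (simp add: inner_commute)
  have "(\<Sum>b\<in>Basis. X' b \<bullet> b) = (\<Sum>b\<in>Basis. - inverse (D x) * ((b \<bullet> y) * (x \<bullet> b)) - inverse (D x) * t * (b \<bullet> b)
      - inverse (D x) * (4 * pi) * inverse (D x) * ((b \<bullet> (x - y)) * ((y - t *\<^sub>R x) \<bullet> b)))"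
    by (rule sum.cong) (simp_all add: X'_def inner_simps algebra_simps)
  also have "\<dots> = - inverse (D x) * (\<Sum>b\<in>Basis. (b \<bullet> y) * (x \<bullet> b)) - inverse (D x) * t * (\<Sum>b\<in>(Basis :: (real^3) set). b \<bullet> b)
      - inverse (D x) * (4 * pi) * inverse (D x) * (\<Sum>b\<in>Basis. (b \<bullet> (x - y)) * ((y - t *\<^sub>R x) \<bullet> b))"
    by (simp add: sum_subtractf sum_distrib_left)
  also have "(\<Sum>b\<in>(Basis :: (real^3) set). b \<bullet> b) = 3" by simp
  also have "- inverse (D x) * (\<Sum>b\<in>Basis. (b \<bullet> y) * (x \<bullet> b)) - inverse (D x) * t * 3
      - inverse (D x) * (4 * pi) * inverse (D x) * (\<Sum>b\<in>Basis. (b \<bullet> (x - y)) * ((y - t *\<^sub>R x) \<bullet> b))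
      = - inverse (D x) * (4 * t) - inverse (D x) * (4 * pi) * inverse (D x) * ((x - y) \<bullet> (y - t *\<^sub>R x))"
    unfolding b by (simp add: t_def inner_commute algebra_simps)
  also have "(x - y) \<bullet> (y - t *\<^sub>R x) = t\<^sup>2 - 1"
    by (simp add: inner_simps xx yy t_def inner_commute power2_eq_square right_diff_distrib)
  finally have tr: "(\<Sum>b\<in>Basis. X' b \<bullet> b) = - inverse (D x) * (4 * t) - inverse (D x) * (4 * pi) * inverse (D x) * (t\<^sup>2 - 1)" .
  have nrm: "X' x \<bullet> x = - inverse (D x) * (2 * t)"
  proof -
    have "X' x \<bullet> x = inverse (D x) * (- (t * (x \<bullet> x) + t * (x \<bullet> x)))
        - inverse (D x) * (4 * pi * (x \<bullet> (x - y))) * inverse (D x) * (t - t * (x \<bullet> x))"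
      by (simp only: X'_def inner_add_left inner_diff_left inner_scaleR_left inner_minus_left)
        (simp add: t_def inner_commute[of y x])
    then show ?thesis by (simp add: xx)
  qed
  have "sphere_div (green_field a y) x = - inverse (D x) * (2 * t) - inverse (D x) * (4 * pi) * inverse (D x) * (t\<^sup>2 - 1)"
    unfolding sphere_div_def fd tr nrm by simp
  also have "\<dots> = 1 / (4 * pi) * (- (2 * t) / (a - t) - (t\<^sup>2 - 1) / (a - t)\<^sup>2)"
    unfolding Dx by (simp add: divide_simps power2_eq_square)
  also have "- (2 * t) / (a - t) - (t\<^sup>2 - 1) / (a - t)\<^sup>2 = 1 - (a\<^sup>2 - 1) / (a - t)\<^sup>2"
    using at by (simp add: divide_simps) (simp add: power2_eq_square algebra_simps)
  also have "1 / (4 * pi) * (1 - (a\<^sup>2 - 1) / (a - t)\<^sup>2) = 1 / (4 * pi) - approximate_identity a t"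
    unfolding approximate_identity_def by (simp only: right_diff_distrib) simp
  finally show ?thesis unfolding t_def .
qed

section \<open>The approximate identity converges in mean\<close>

interpretation sphere_pair: pair_sigma_finite sphere_area sphere_area ..

lemma borel_measurable_approximate_identity [measurable]:
  "approximate_identity a \<in> borel_measurable borel"
  unfolding approximate_identity_def[abs_def] by measurable

lemma approximate_identity_nonneg: "1 < a \<Longrightarrow> 0 \<le> approximate_identity a t"
  unfolding approximate_identity_def by simp

lemma nn_integral_approximate_identity:
  assumes y: "norm y = 1" and a: "1 < a"
  shows "(\<integral>\<^sup>+x. ennreal (approximate_identity a (x \<bullet> y)) \<partial>sphere_area) = 1"
proof -
  have a2: "0 < a\<^sup>2 - 1" using a by simp
  have "(\<integral>\<^sup>+x. ennreal (approximate_identity a (x \<bullet> y)) \<partial>sphere_area)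
      = (\<integral>\<^sup>+x. ennreal ((a\<^sup>2 - 1) / (4 * pi)) * ennreal (1 / (a - x \<bullet> y)\<^sup>2) \<partial>sphere_area)"
    using a2 by (simp add: approximate_identity_def ennreal_mult[symmetric])
  also have "\<dots> = ennreal ((a\<^sup>2 - 1) / (4 * pi)) * ennreal (4 * pi / (a\<^sup>2 - (norm y)\<^sup>2))"
    using y a by (subst nn_integral_cmult) (auto simp: nn_integral_sphere_inverse_square)
  also have "\<dots> = 1" using y a2 by (subst ennreal_mult[symmetric]) auto
  finally show ?thesis .
qed

text \<open>
  This seminorm dominates the \<open>L\<^sup>1\<close>-distance between \<open>f\<close> and its mollification. The absolute value stands
  inside both integrals so that the two variables play symmetric roles.
\<close>

definition mollification_error :: "real \<Rightarrow> (real^3 \<Rightarrow> real) \<Rightarrow> ennreal" where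
  "mollification_error a f =
     (\<integral>\<^sup>+y. (\<integral>\<^sup>+x. ennreal (approximate_identity a (x \<bullet> y) * \<bar>f x - f y\<bar>) \<partial>sphere_area) \<partial>sphere_area)"

lemma mollification_error_cong:
  assumes "\<And>x. norm x = 1 \<Longrightarrow> f x = g x"
  shows "mollification_error a f = mollification_error a g"
  unfolding mollification_error_def using assms by (intro nn_integral_cong) auto

lemma mollification_error_add:
  assumes [measurable]: "f \<in> borel_measurable sphere_area" "g \<in> borel_measurable sphere_area" and a: "1 < a"
  shows "mollification_error a (\<lambda>x. f x + g x) \<le> mollification_error a f + mollification_error a g"
proof -
  have "mollification_error a (\<lambda>x. f x + g x) \<le> (\<integral>\<^sup>+y. (\<integral>\<^sup>+x. ennreal (approximate_identity a (x \<bullet> y) * \<bar>f x - f y\<bar>)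
      + ennreal (approximate_identity a (x \<bullet> y) * \<bar>g x - g y\<bar>) \<partial>sphere_area) \<partial>sphere_area)"
    unfolding mollification_error_def
  proof (intro nn_integral_mono)
    fix x y :: "real^3"
    have "approximate_identity a (x \<bullet> y) * \<bar>f x + g x - (f y + g y)\<bar> \<le> approximate_identity a (x \<bullet> y) * (\<bar>f x - f y\<bar> + \<bar>g x - g y\<bar>)"
      using approximate_identity_nonneg[OF a] by (intro mult_left_mono) auto
    then show "ennreal (approximate_identity a (x \<bullet> y) * \<bar>f x + g x - (f y + g y)\<bar>)
       \<le> ennreal (approximate_identity a (x \<bullet> y) * \<bar>f x - f y\<bar>) + ennreal (approximate_identity a (x \<bullet> y) * \<bar>g x - g y\<bar>)"
      using approximate_identity_nonneg[OF a]
      by (simp add: distrib_left ennreal_plus[symmetric] ennreal_leI del: ennreal_plus)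
  qed
  also have "\<dots> = mollification_error a f + mollification_error a g"
    unfolding mollification_error_def by (simp add: nn_integral_add)
  finally show ?thesis .
qed

text \<open>
  The kernel has mass one in each variable, so the error is continuous with respect to the
  \<open>L\<^sup>1\<close>-norm, uniformly in \<open>a\<close>. This makes the set of functions whose error vanishes closed in \<open>L\<^sup>1\<close>.
\<close>

lemma mollification_error_le_L1:
  assumes [measurable]: "f \<in> borel_measurable sphere_area" and a: "1 < a"
  shows "mollification_error a f \<le> 2 * (\<integral>\<^sup>+x. ennreal \<bar>f x\<bar> \<partial>sphere_area)"
proof -
  let ?P = "\<lambda>x y. ennreal (approximate_identity a (x \<bullet> y))"
  have "mollification_error a f \<le> (\<integral>\<^sup>+y. (\<integral>\<^sup>+x. ?P x y * ennreal \<bar>f x\<bar> + ?P x y * ennreal \<bar>f y\<bar> \<partial>sphere_area) \<partial>sphere_area)"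
    unfolding mollification_error_def
  proof (intro nn_integral_mono)
    fix x y :: "real^3"
    have "approximate_identity a (x \<bullet> y) * \<bar>f x - f y\<bar> \<le> approximate_identity a (x \<bullet> y) * (\<bar>f x\<bar> + \<bar>f y\<bar>)"
      using approximate_identity_nonneg[OF a] by (intro mult_left_mono) auto
    then show "ennreal (approximate_identity a (x \<bullet> y) * \<bar>f x - f y\<bar>) \<le> ?P x y * ennreal \<bar>f x\<bar> + ?P x y * ennreal \<bar>f y\<bar>"
      using approximate_identity_nonneg[OF a]
      by (simp add: ennreal_mult[symmetric] ennreal_plus[symmetric] distrib_left ennreal_leI del: ennreal_plus)
  qed
  also have "\<dots> = (\<integral>\<^sup>+y. (\<integral>\<^sup>+x. ?P x y * ennreal \<bar>f x\<bar> \<partial>sphere_area) \<partial>sphere_area)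
     + (\<integral>\<^sup>+y. (\<integral>\<^sup>+x. ?P x y * ennreal \<bar>f y\<bar> \<partial>sphere_area) \<partial>sphere_area)"
    by (simp add: nn_integral_add)
  also have "(\<integral>\<^sup>+y. (\<integral>\<^sup>+x. ?P x y * ennreal \<bar>f x\<bar> \<partial>sphere_area) \<partial>sphere_area)
     = (\<integral>\<^sup>+x. (\<integral>\<^sup>+y. ?P x y * ennreal \<bar>f x\<bar> \<partial>sphere_area) \<partial>sphere_area)"
    by (rule sphere_pair.Fubini') measurable
  also have "\<dots> = (\<integral>\<^sup>+x. ennreal \<bar>f x\<bar> \<partial>sphere_area)"
  proof (rule nn_integral_cong)
    fix x assume "x \<in> space sphere_area"
    then show "(\<integral>\<^sup>+y. ?P x y * ennreal \<bar>f x\<bar> \<partial>sphere_area) = ennreal \<bar>f x\<bar>"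
      using nn_integral_approximate_identity[OF _ a, of x]
      by (subst nn_integral_multc) (simp_all add: inner_commute[of x])
  qed
  also have "(\<integral>\<^sup>+y. (\<integral>\<^sup>+x. ?P x y * ennreal \<bar>f y\<bar> \<partial>sphere_area) \<partial>sphere_area) = (\<integral>\<^sup>+x. ennreal \<bar>f x\<bar> \<partial>sphere_area)"
    using nn_integral_approximate_identity[OF _ a]
    by (intro nn_integral_cong) (simp add: nn_integral_multc)
  finally show ?thesis by (simp add: mult_2)
qed

definition mollifiable :: "(real^3 \<Rightarrow> real) \<Rightarrow> bool" where
  "mollifiable f \<longleftrightarrow> (\<forall>e>0. \<forall>\<^sub>F a in at_right 1. mollification_error a f < ennreal e)"

lemma mollifiable_approx:
  assumes f: "f \<in> borel_measurable sphere_area"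
    and approx: "\<And>e. 0 < e \<Longrightarrow> \<exists>g \<in> borel_measurable sphere_area. mollifiable g \<and> (\<integral>\<^sup>+x. ennreal \<bar>f x - g x\<bar> \<partial>sphere_area) < ennreal e"
  shows "mollifiable f"
  unfolding mollifiable_def
proof (intro allI impI)
  fix e :: real assume e: "0 < e"
  obtain g where g: "g \<in> borel_measurable sphere_area" "mollifiable g"
      and less: "(\<integral>\<^sup>+x. ennreal \<bar>f x - g x\<bar> \<partial>sphere_area) < ennreal (e / 4)"
    using approx[of "e / 4"] e by auto
  have "\<forall>\<^sub>F a in at_right 1. mollification_error a g < ennreal (e / 2)"
    using g(2) e unfolding mollifiable_def by simp
  moreover have "\<forall>\<^sub>F a in at_right (1::real). 1 < a" by (rule eventually_at_right_less)
  ultimately show "\<forall>\<^sub>F a in at_right 1. mollification_error a f < ennreal e"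
  proof eventually_elim
    case (elim a)
    have "mollification_error a f \<le> mollification_error a g + mollification_error a (\<lambda>x. f x - g x)"
      using mollification_error_add[of g "\<lambda>x. f x - g x" a] f g(1) elim(2) by simp
    also have "mollification_error a (\<lambda>x. f x - g x) \<le> 2 * (\<integral>\<^sup>+x. ennreal \<bar>f x - g x\<bar> \<partial>sphere_area)"
      using f g(1) elim(2) by (intro mollification_error_le_L1) auto
    also have "\<dots> \<le> 2 * ennreal (e / 4)" using less by (intro mult_left_mono) auto
    also have "\<dots> = ennreal 2 * ennreal (e / 4)" by simp
    also have "\<dots> = ennreal (e / 2)" using e by (subst ennreal_mult[symmetric]) auto
    finally have "mollification_error a f \<le> mollification_error a g + ennreal (e / 2)" by simp
    also have "\<dots> < ennreal (e / 2) + ennreal (e / 2)"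
      using elim(1) by (simp add: ennreal_add_left_cancel_less add.commute)
    also have "\<dots> = ennreal e" using e by (subst ennreal_plus[symmetric]) auto
    finally show ?case .
  qed
qed

lemma mollifiable_limit:
  assumes s: "\<And>i::nat. s i \<in> borel_measurable sphere_area" "\<And>i. mollifiable (s i)"
    and f: "f \<in> borel_measurable sphere_area"
    and lim: "\<And>x. norm x = 1 \<Longrightarrow> (\<lambda>i. s i x) \<longlonglongrightarrow> f x"
    and w: "integrable sphere_area w" "\<And>i x. norm x = 1 \<Longrightarrow> \<bar>s i x\<bar> \<le> w x"
  shows "mollifiable f"
proof (rule mollifiable_approx[OF f])
  fix e :: real assume e: "0 < e"
  have "(\<lambda>i. \<integral>\<^sup>+x. ennreal (norm (f x - s i x)) \<partial>sphere_area) \<longlonglongrightarrow> 0"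
  proof (rule Bochner_Integration.nn_integral_dominated_convergence_norm[of _ _ _ w])
    show "AE x in sphere_area. (\<lambda>i. s i x) \<longlonglongrightarrow> f x" using lim by (intro AE_I2) simp
    show "AE x in sphere_area. norm (s j x) \<le> w x" for j using w by (intro AE_I2) simp
    show "(\<integral>\<^sup>+ x. ennreal (w x) \<partial>sphere_area) < \<infinity>"
    proof -
      have "(\<integral>\<^sup>+ x. ennreal (w x) \<partial>sphere_area) \<le> (\<integral>\<^sup>+ x. ennreal (norm (w x)) \<partial>sphere_area)"
        by (intro nn_integral_mono ennreal_leI) simp
      also have "\<dots> < \<infinity>" using w(1) by (simp add: integrable_iff_bounded)
      finally show ?thesis .
    qed
  qed (use s f w in auto)
  then have "\<forall>\<^sub>F i in sequentially. (\<integral>\<^sup>+x. ennreal (norm (f x - s i x)) \<partial>sphere_area) < ennreal e"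
    using e by (intro order_tendstoD) auto
  then obtain i where "(\<integral>\<^sup>+x. ennreal (norm (f x - s i x)) \<partial>sphere_area) < ennreal e"
    by (auto dest: eventually_happens)
  then show "\<exists>g\<in>borel_measurable sphere_area. mollifiable g \<and> (\<integral>\<^sup>+x. ennreal \<bar>f x - g x\<bar> \<partial>sphere_area) < ennreal e"
    using s by (intro bexI[of _ "s i"]) auto
qed

lemma mollifiable_add:
  assumes "f \<in> borel_measurable sphere_area" "mollifiable f" "g \<in> borel_measurable sphere_area" "mollifiable g"
  shows "mollifiable (\<lambda>x. f x + g x)"
  unfolding mollifiable_def
proof (intro allI impI)
  fix e :: real assume e: "0 < e"
  have "\<forall>\<^sub>F a in at_right 1. mollification_error a f < ennreal (e / 2)"
    "\<forall>\<^sub>F a in at_right 1. mollification_error a g < ennreal (e / 2)"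
    using assms e unfolding mollifiable_def by simp_all
  moreover have "\<forall>\<^sub>F a in at_right (1::real). 1 < a" by (rule eventually_at_right_less)
  ultimately show "\<forall>\<^sub>F a in at_right 1. mollification_error a (\<lambda>x. f x + g x) < ennreal e"
  proof eventually_elim
    case (elim a)
    have "mollification_error a (\<lambda>x. f x + g x) \<le> mollification_error a f + mollification_error a g"
      using assms elim by (intro mollification_error_add) auto
    also have "\<dots> < ennreal (e / 2) + ennreal (e / 2)" using elim by (intro add_strict_mono)
    also have "\<dots> = ennreal e" using e by (subst ennreal_plus[symmetric]) auto
    finally show ?case .
  qed
qed

lemma mollifiable_cmult:
  assumes [measurable]: "f \<in> borel_measurable sphere_area" and f: "mollifiable f"
  shows "mollifiable (\<lambda>x. c * f x)"
  unfolding mollifiable_def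
proof (intro allI impI)
  fix e :: real assume e: "0 < e"
  have "\<forall>\<^sub>F a in at_right 1. mollification_error a f < ennreal (e / (\<bar>c\<bar> + 1))"
    using f e unfolding mollifiable_def by simp
  moreover have "\<forall>\<^sub>F a in at_right (1::real). 1 < a" by (rule eventually_at_right_less)
  ultimately show "\<forall>\<^sub>F a in at_right 1. mollification_error a (\<lambda>x. c * f x) < ennreal e"
  proof eventually_elim
    case (elim a)
    have "mollification_error a (\<lambda>x. c * f x) \<le> (\<integral>\<^sup>+y. (\<integral>\<^sup>+x. ennreal (\<bar>c\<bar> + 1) * ennreal (approximate_identity a (x \<bullet> y) * \<bar>f x - f y\<bar>) \<partial>sphere_area) \<partial>sphere_area)"
      unfolding mollification_error_def
    proof (intro nn_integral_mono)
      fix x y :: "real^3"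
      have "approximate_identity a (x \<bullet> y) * \<bar>c * f x - c * f y\<bar> = \<bar>c\<bar> * (approximate_identity a (x \<bullet> y) * \<bar>f x - f y\<bar>)"
        by (simp add: abs_mult[symmetric] right_diff_distrib)
      also have "\<dots> \<le> (\<bar>c\<bar> + 1) * (approximate_identity a (x \<bullet> y) * \<bar>f x - f y\<bar>)"
        using approximate_identity_nonneg[OF elim(2)] by (intro mult_right_mono) auto
      finally show "ennreal (approximate_identity a (x \<bullet> y) * \<bar>c * f x - c * f y\<bar>)
          \<le> ennreal (\<bar>c\<bar> + 1) * ennreal (approximate_identity a (x \<bullet> y) * \<bar>f x - f y\<bar>)"
        using approximate_identity_nonneg[OF elim(2)] by (subst ennreal_mult[symmetric]) (auto intro!: ennreal_leI)
    qed
    also have "\<dots> = ennreal (\<bar>c\<bar> + 1) * mollification_error a f"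
      unfolding mollification_error_def by (simp add: nn_integral_cmult)
    also have "\<dots> < ennreal (\<bar>c\<bar> + 1) * ennreal (e / (\<bar>c\<bar> + 1))"
      using elim(1) by (intro ennreal_mult_strict_left_mono) (auto simp del: ennreal_plus)
    also have "\<dots> = ennreal e" using e by (subst ennreal_mult[symmetric]) auto
    finally show ?case .
  qed
qed

text \<open>
  For every \<open>d > 0\<close> the distance satisfies \<open>|x - y| \<le> d + |x - y|\<^sup>2 / d\<close>, and \<open>|x - y|\<^sup>2 \<le> 2 (a - x \<bullet> y)\<close> removes one power from
  the denominator of the kernel. What is left integrates to a multiple of \<open>(a\<^sup>2 - 1) ln ((a + 1)/(a - 1))\<close>,
  which tends to zero.
\<close>

lemma mollifiable_lipschitz:
  assumes f [measurable]: "f \<in> borel_measurable sphere_area"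
    and lip: "\<And>x y. norm x = 1 \<Longrightarrow> norm y = 1 \<Longrightarrow> \<bar>f x - f y\<bar> \<le> L * norm (x - y)" and L: "0 < L"
  shows "mollifiable f"
  unfolding mollifiable_def
proof (intro allI impI)
  define q where "q a = (a\<^sup>2 - 1) * sqrt ((a + 1) / (a - 1))" for a :: real
  fix e :: real assume e: "0 < e"
  define d where "d = e / (8 * pi * L + 1)"
  have d: "0 < d" "4 * pi * (L * d) < e / 2" using e L by (auto simp: d_def field_simps add_pos_pos)
  have "((\<lambda>a. 4 * pi * (L * (2 * ((a + 1) * sqrt ((a + 1) * (a - 1))) / d))) \<longlongrightarrow> 4 * pi * (L * (2 * ((1 + 1) * sqrt ((1 + 1) * (1 - 1))) / d))) (at_right (1::real))"
    using d by (intro tendsto_intros) auto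
  then have "\<forall>\<^sub>F a in at_right (1::real). 4 * pi * (L * (2 * ((a + 1) * sqrt ((a + 1) * (a - 1))) / d)) < e / 2"
    using e by (intro order_tendstoD) auto
  moreover have "\<forall>\<^sub>F a in at_right (1::real). 1 < a" by (rule eventually_at_right_less)
  ultimately show "\<forall>\<^sub>F a in at_right 1. mollification_error a f < ennreal e"
  proof eventually_elim
    case (elim a)
    note a = elim(2)
    define r where "r = (a + 1) * sqrt ((a + 1) * (a - 1))"
    have inner: "(\<integral>\<^sup>+x. ennreal (approximate_identity a (x \<bullet> y) * \<bar>f x - f y\<bar>) \<partial>sphere_area) \<le> ennreal (L * d + L * (2 * r / d))"
      if y: "norm y = 1" for y
    proof -
      have "(\<integral>\<^sup>+x. ennreal (approximate_identity a (x \<bullet> y) * \<bar>f x - f y\<bar>) \<partial>sphere_area)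
        \<le> (\<integral>\<^sup>+x. ennreal (L * d) * ennreal (approximate_identity a (x \<bullet> y)) + ennreal (L * 2 / d * ((a\<^sup>2 - 1) / (4 * pi))) * ennreal (1 / (a - x \<bullet> y)) \<partial>sphere_area)"
      proof (rule nn_integral_mono)
        fix x assume "x \<in> space sphere_area"
        then have x: "norm x = 1" by simp
        define t where "t = x \<bullet> y"
        have t: "t \<le> 1" "0 < a - t" using sphere_inner_le(1)[of x y] x y a by (auto simp: t_def)
        have n2: "(norm (x - y))\<^sup>2 = 2 - 2 * t"
        proof -
          have "x \<bullet> x = 1" "y \<bullet> y = 1" using x y by (simp_all add: dot_square_norm)
          then show ?thesis unfolding power2_norm_eq_inner by (simp add: inner_simps inner_commute t_def)
        qed
        have "norm (x - y) \<le> d + (norm (x - y))\<^sup>2 / d"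
        proof (cases "norm (x - y) \<le> d")
          case False
          then have "d * norm (x - y) \<le> norm (x - y) * norm (x - y)" by (intro mult_right_mono) auto
          then have "norm (x - y) \<le> (norm (x - y))\<^sup>2 / d" using d by (simp add: field_simps power2_eq_square)
          then show ?thesis using d by simp
        qed (use d in \<open>simp add: add_increasing2\<close>)
        then have "\<bar>f x - f y\<bar> \<le> L * (d + (2 - 2 * t) / d)"
          using lip[OF x y] L by (metis (no_types, opaque_lifting) mult_left_mono n2 order.trans order_less_imp_le)
        also have "\<dots> \<le> L * (d + 2 * (a - t) / d)"
          using L d a by (intro mult_left_mono add_left_mono divide_right_mono) auto
        finally have "approximate_identity a t * \<bar>f x - f y\<bar> \<le> approximate_identity a t * (L * (d + 2 * (a - t) / d))"
          using approximate_identity_nonneg[OF a] by (rule mult_left_mono)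
        also have "\<dots> = L * d * approximate_identity a t + L * 2 / d * ((a\<^sup>2 - 1) / (4 * pi)) * (1 / (a - t))"
          using t d by (simp add: approximate_identity_def divide_simps power2_eq_square) (simp add: algebra_simps)
        finally show "ennreal (approximate_identity a (x \<bullet> y) * \<bar>f x - f y\<bar>)
          \<le> ennreal (L * d) * ennreal (approximate_identity a (x \<bullet> y)) + ennreal (L * 2 / d * ((a\<^sup>2 - 1) / (4 * pi))) * ennreal (1 / (a - x \<bullet> y))"
          using L d a t approximate_identity_nonneg[OF a, of t]
          by (simp add: t_def[symmetric] ennreal_mult'[symmetric] ennreal_plus[symmetric] ennreal_leI less_imp_le del: ennreal_plus times_divide_eq_left times_divide_eq_right)
      qed
      also have "\<dots> = ennreal (L * d) * 1 + ennreal (L * 2 / d * ((a\<^sup>2 - 1) / (4 * pi))) * ennreal (2 * pi * ln ((a + 1) / (a - 1)))"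
        by (simp add: nn_integral_add nn_integral_cmult nn_integral_approximate_identity[OF y a] nn_integral_sphere_inverse[OF y a])
      also have "\<dots> = ennreal (L * d + L / d * ((a\<^sup>2 - 1) * ln ((a + 1) / (a - 1))))"
      proof -
        define l where "l = ln ((a + 1) / (a - 1))"
        have l: "0 \<le> l" "0 \<le> a\<^sup>2 - 1" using a by (auto simp: l_def)
        have "ennreal (L * 2 / d * ((a\<^sup>2 - 1) / (4 * pi))) * ennreal (2 * pi * l)
            = ennreal (L * 2 / d * ((a\<^sup>2 - 1) / (4 * pi)) * (2 * pi * l))"
          using L d l by (intro ennreal_mult[symmetric]) auto
        also have "L * 2 / d * ((a\<^sup>2 - 1) / (4 * pi)) * (2 * pi * l) = L / d * ((a\<^sup>2 - 1) * l)"
          using d by (simp add: field_simps)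
        finally show ?thesis using L d l
          unfolding l_def[symmetric] by (simp del: ennreal_plus add: ennreal_plus[symmetric])
      qed
      also have "\<dots> \<le> ennreal (L * d + L * (2 * r / d))"
      proof (rule ennreal_leI)
        have p: "0 < (a + 1) / (a - 1)" using a by simp
        \<comment> \<open>Halving the logarithm gives \<open>ln t \<le> 2 sqrt t\<close>, which the factor \<open>a\<^sup>2 - 1\<close> outweighs.\<close>
        have "ln ((a + 1) / (a - 1)) = 2 * ln (sqrt ((a + 1) / (a - 1)))" using p by (simp add: ln_sqrt)
        also have "\<dots> \<le> 2 * sqrt ((a + 1) / (a - 1))" using p ln_bound[of "sqrt ((a + 1) / (a - 1))"] by simp
        finally have "(a\<^sup>2 - 1) * ln ((a + 1) / (a - 1)) \<le> (a\<^sup>2 - 1) * (2 * sqrt ((a + 1) / (a - 1)))"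
          using a by (intro mult_left_mono) auto
        also have "\<dots> = 2 * r"
        proof -
          have 1: "a\<^sup>2 - 1 = (a + 1) * (a - 1)" by (simp add: power2_eq_square algebra_simps)
          have 2: "(a - 1) * sqrt ((a + 1) / (a - 1)) = sqrt ((a + 1) * (a - 1))"
          proof -
            have "(a + 1) * (a - 1) = (a - 1)\<^sup>2 * ((a + 1) / (a - 1))"
              using a by (simp add: power2_eq_square)
            then have "sqrt ((a + 1) * (a - 1)) = sqrt ((a - 1)\<^sup>2 * ((a + 1) / (a - 1)))" by (rule arg_cong)
            also have "\<dots> = sqrt ((a - 1)\<^sup>2) * sqrt ((a + 1) / (a - 1))" by (rule real_sqrt_mult)
            finally show ?thesis using a by simp
          qed
          show ?thesis unfolding r_def 1 using 2 by (metis mult.assoc mult.left_commute)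
        qed
        finally have "L / d * ((a\<^sup>2 - 1) * ln ((a + 1) / (a - 1))) \<le> L / d * (2 * r)"
          using L d by (intro mult_left_mono) auto
        then show "L * d + L / d * ((a\<^sup>2 - 1) * ln ((a + 1) / (a - 1))) \<le> L * d + L * (2 * r / d)" by simp
      qed
      finally show ?thesis .
    qed
    have "mollification_error a f \<le> (\<integral>\<^sup>+y. ennreal (L * d + L * (2 * r / d)) \<partial>sphere_area)"
      unfolding mollification_error_def by (intro nn_integral_mono inner) simp
    also have "\<dots> = ennreal ((L * d + L * (2 * r / d)) * (4 * pi))"
      using L d a by (simp add: emeasure_sphere_area_space ennreal_mult r_def)
    also have "\<dots> < ennreal e"
    proof (rule ennreal_lessI[OF e])
      have "(L * d + L * (2 * r / d)) * (4 * pi) = 4 * pi * (L * d) + 4 * pi * (L * (2 * r / d))"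
        by (simp add: distrib_right)
      also have "\<dots> < e / 2 + e / 2"
        using d(2) elim(1) unfolding r_def[symmetric] by (intro add_strict_mono)
      finally show "(L * d + L * (2 * r / d)) * (4 * pi) < e" by simp
    qed
    finally show ?case .
  qed
qed

text \<open>
  The indicator of a closed set is the decreasing limit of Lipschitz functions of the distance.
\<close>

lemma mollifiable_indicator_closed:
  assumes C: "closed C" shows "mollifiable (indicator C)"
proof (cases "C = {}")
  case True
  then show ?thesis unfolding mollifiable_def mollification_error_def by simp
next
  case False
  define s where "s i x = max 0 (1 - real i * infdist x C)" for i and x :: "real^3"
  have cont: "continuous_on UNIV (s i)" for i unfolding s_def by (intro continuous_intros)
  have meas: "s i \<in> borel_measurable borel" for i by (rule borel_measurable_continuous_onI[OF cont])
  have meas': "f \<in> borel_measurable sphere_area" if "f \<in> borel_measurable borel" for f :: "real^3 \<Rightarrow> real"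
    using measurable_compose[OF borel_measurable_sphere_area that] .
  show ?thesis
  proof (rule mollifiable_limit[of s])
    fix i
    show "s i \<in> borel_measurable sphere_area" by (rule meas'[OF meas])
    show "mollifiable (s i)"
    proof (rule mollifiable_lipschitz[of _ "real i + 1"])
      fix x y :: "real^3"
      have "\<bar>s i x - s i y\<bar> \<le> \<bar>real i * infdist x C - real i * infdist y C\<bar>" unfolding s_def by linarith
      also have "\<dots> = real i * \<bar>infdist x C - infdist y C\<bar>" by (simp add: abs_mult right_diff_distrib[symmetric])
      also have "\<dots> \<le> (real i + 1) * dist x y"
        by (intro mult_mono infdist_triangle_abs) auto
      finally show "\<bar>s i x - s i y\<bar> \<le> (real i + 1) * norm (x - y)" by (simp add: dist_norm)
    qed (auto intro: meas'[OF meas])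
    show "\<bar>s i x\<bar> \<le> 1" for x unfolding s_def by (simp add: infdist_nonneg)
  next
    fix x :: "real^3"
    show "(\<lambda>i. s i x) \<longlonglongrightarrow> indicator C x"
    proof (cases "x \<in> C")
      case True
      then show ?thesis by (simp add: s_def)
    next
      case False
      then have pos: "0 < infdist x C" using C \<open>C \<noteq> {}\<close> by (simp add: infdist_pos_not_in_closed)
      then obtain N :: nat where N: "1 < real N * infdist x C" using reals_Archimedean3 by blast
      have "s i x = 0" if "N \<le> i" for i
      proof -
        have "real N * infdist x C \<le> real i * infdist x C" using that pos by (intro mult_right_mono) auto
        then show ?thesis using N by (simp add: s_def)
      qed
      then have "(\<lambda>i. s i x) \<longlonglongrightarrow> 0" by (intro tendsto_eventually eventually_sequentiallyI[of N])
      then show ?thesis using False by simp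
    qed
    show "(indicator C :: _ \<Rightarrow> real) \<in> borel_measurable sphere_area"
      by (rule meas'[OF borel_measurable_indicator]) (rule borel_closed[OF C])
  qed simp
qed

text \<open>
  Closed sets are stable under intersections and generate the Borel sets, so Dynkin's theorem
  applies; complements leave the error unchanged and disjoint unions are \<open>L\<^sup>1\<close>-limits.
\<close>

lemma mollifiable_indicator:
  assumes "B \<in> sets borel" shows "mollifiable (indicator B)"
proof -
  have meas: "indicator A \<in> borel_measurable sphere_area" if "A \<in> sets borel" for A :: "(real^3) set"
    using measurable_compose[OF borel_measurable_sphere_area borel_measurable_indicator[OF that]] .
  have "Int_stable (Collect closed :: (real^3) set set)" "Collect closed \<subseteq> Pow (UNIV :: (real^3) set)" "B \<in> sigma_sets UNIV (Collect closed)"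
    using assms by (auto simp: Int_stable_def borel_eq_closed)
  then show ?thesis
  proof (induct B rule: sigma_sets_induct_disjoint)
    case (basic A)
    then show ?case by (simp add: mollifiable_indicator_closed)
  next
    case empty
    then show ?case by (rule mollifiable_indicator_closed) simp
  next
    case (compl A)
    have "\<bar>indicator (UNIV - A) x - indicator (UNIV - A) y\<bar> = \<bar>indicator A x - indicator A y :: real\<bar>" for x y
      by (auto simp: indicator_def)
    then show ?case using compl unfolding mollifiable_def mollification_error_def by (simp only:)
  next
    case (union D)
    have D: "D i \<in> sets borel" for i using union(2) by (auto simp: borel_eq_closed)
    define s where "s n x = (\<Sum>i<n. indicator (D i) x :: real)" for n x
    have s: "s n x = indicator (\<Union>i<n. D i) x" for n x
      unfolding s_def using union(1) by (subst indicator_UN_disjoint) (auto intro: disjoint_family_on_mono)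
    show ?case
    proof (rule mollifiable_limit[of s])
      show m: "s n \<in> borel_measurable sphere_area" for n
        unfolding s_def using meas[OF D] by (intro borel_measurable_sum) auto
      show "mollifiable (s n)" for n
      proof (induction n)
        case 0
        then show ?case unfolding s_def mollifiable_def mollification_error_def by simp
      next
        case (Suc n)
        then have "mollifiable (\<lambda>x. s n x + indicator (D n) x)"
          using m meas[OF D] union(3) by (intro mollifiable_add) auto
        then show ?case by (simp add: s_def)
      qed
      show "(\<lambda>i. s i x) \<longlonglongrightarrow> indicator (\<Union> (range D)) x" for x
        unfolding s by (rule LIMSEQ_indicator_UN)
      show "\<bar>s i x\<bar> \<le> 1" for i x unfolding s by (simp add: indicator_def)
    qed (use D in \<open>auto intro!: meas\<close>)
  qed
qed

theorem mollifiable_integrable: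
  assumes "integrable sphere_area f" shows "mollifiable f"
  using assms
proof (induction rule: integrable_induct)
  case (base A c)
  then obtain B where B: "B \<in> sets borel" "A = sphere 0 1 \<inter> B"
    by (auto simp: sets_sphere_area sets_restrict_space)
  have "mollifiable (\<lambda>x. c * indicator B x)"
    using measurable_compose[OF borel_measurable_sphere_area borel_measurable_indicator[OF B(1)]]
    by (intro mollifiable_cmult mollifiable_indicator B(1))
  moreover have "mollification_error a (\<lambda>x. indicator A x *\<^sub>R c) = mollification_error a (\<lambda>x. c * indicator B x)" for a
    by (rule mollification_error_cong) (auto simp: B(2) indicator_def)
  ultimately show ?case unfolding mollifiable_def by simp
next
  case (add f g)
  then show ?case by (intro mollifiable_add) auto
next
  case (lim f s)
  show ?case by (rule mollifiable_limit[of s _ "\<lambda>x. 2 * \<bar>f x\<bar>"]) (use lim in auto)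
qed

section \<open>Pairing a function with a density through its weak gradient\<close>

lemma integrable_sphere_pair_bounded:
  fixes f :: "real^3 \<Rightarrow> real^3 \<Rightarrow> real"
  assumes [measurable]: "case_prod f \<in> borel_measurable (sphere_area \<Otimes>\<^sub>M sphere_area)"
    and g: "integrable sphere_area g"
    and le: "\<And>x y. norm x = 1 \<Longrightarrow> norm y = 1 \<Longrightarrow> \<bar>f x y\<bar> \<le> g x"
  shows "integrable (sphere_area \<Otimes>\<^sub>M sphere_area) (case_prod f)"
proof (rule integrableI_bounded)
  have [measurable]: "g \<in> borel_measurable sphere_area" using g by simp
  have "(\<integral>\<^sup>+p. ennreal (norm (case_prod f p)) \<partial>(sphere_area \<Otimes>\<^sub>M sphere_area))
      = (\<integral>\<^sup>+x. (\<integral>\<^sup>+y. ennreal (norm (f x y)) \<partial>sphere_area) \<partial>sphere_area)"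
    by (subst sphere.nn_integral_fst[symmetric]) auto
  also have "\<dots> \<le> (\<integral>\<^sup>+x. (\<integral>\<^sup>+y. ennreal (norm (g x)) \<partial>sphere_area) \<partial>sphere_area)"
    using le by (intro nn_integral_mono ennreal_leI) force
  also have "\<dots> = (\<integral>\<^sup>+x. ennreal (norm (g x)) \<partial>sphere_area) * ennreal (4 * pi)"
    by (simp add: nn_integral_multc emeasure_sphere_area_space)
  also have "\<dots> < \<infinity>" using g by (simp add: integrable_iff_bounded ennreal_mult_less_top)
  finally show "(\<integral>\<^sup>+p. ennreal (norm (case_prod f p)) \<partial>(sphere_area \<Otimes>\<^sub>M sphere_area)) < \<infinity>" .
qed measurable

lemma integrable_sphere_bounded_mult:
  fixes f g :: "real^3 \<Rightarrow> real"
  assumes f: "integrable sphere_area f" and [measurable]: "g \<in> borel_measurable sphere_area"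
    and M: "\<And>x. norm x = 1 \<Longrightarrow> \<bar>g x\<bar> \<le> M"
  shows "integrable sphere_area (\<lambda>x. g x * f x)"
proof (rule Bochner_Integration.integrable_bound)
  show "integrable sphere_area (\<lambda>x. M * f x)" using f by simp
  have [measurable]: "f \<in> borel_measurable sphere_area" using f by simp
  show "(\<lambda>x. g x * f x) \<in> borel_measurable sphere_area" by measurable
  show "AE x in sphere_area. norm (g x * f x) \<le> norm (M * f x)"
    using M by (intro AE_I2) (auto simp: abs_mult intro!: mult_right_mono order_trans[OF M abs_ge_self])
qed

lemma abs_integral_sphere_le:
  fixes f :: "real^3 \<Rightarrow> real"
  assumes "f \<in> borel_measurable sphere_area" "\<And>x. norm x = 1 \<Longrightarrow> \<bar>f x\<bar> \<le> B"
  shows "\<bar>\<integral>x. f x \<partial>sphere_area\<bar> \<le> 4 * pi * B"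
proof -
  have int: "integrable sphere_area f" using assms by (intro integrable_sphere_bounded[of _ B]) auto
  have "\<bar>\<integral>x. f x \<partial>sphere_area\<bar> \<le> (\<integral>x. \<bar>f x\<bar> \<partial>sphere_area)"
    using integral_norm_bound[of sphere_area f] by simp
  also have "\<dots> \<le> (\<integral>x. B \<partial>sphere_area)"
    using int assms(2) by (intro integral_mono integrable_abs) auto
  finally show ?thesis by simp
qed

lemma approximate_identity_le:
  assumes a: "1 < a" and t: "t \<le> 1"
  shows "approximate_identity a t \<le> (a\<^sup>2 - 1) / (4 * pi * (a - 1)\<^sup>2)"
  unfolding approximate_identity_def using a t
  by (intro divide_left_mono mult_left_mono power_mono mult_pos_pos) auto

text \<open>
  The difference of the two pairings is at most the supremum of \<open>|\<rho>|\<close> times the mollification error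
  of \<open>u\<close>.
\<close>

lemma tendsto_mollified_pairing:
  assumes u: "integrable sphere_area u" and \<rho> [measurable]: "\<rho> \<in> borel_measurable sphere_area"
    and B: "\<And>x. norm x = 1 \<Longrightarrow> \<bar>\<rho> x\<bar> \<le> B"
  shows "((\<lambda>a. \<integral>y. \<rho> y * (\<integral>x. approximate_identity a (x \<bullet> y) * u x \<partial>sphere_area) \<partial>sphere_area)
           \<longlongrightarrow> (\<integral>y. \<rho> y * u y \<partial>sphere_area)) (at_right 1)"
proof (rule tendstoI)
  fix e :: real assume e: "0 < e"
  have [measurable]: "u \<in> borel_measurable sphere_area" using u by simp
  have B0: "0 \<le> B" using B[of "axis 1 1"] by (simp add: abs_ge_zero order_trans[OF abs_ge_zero])
  have "\<forall>\<^sub>F a in at_right 1. mollification_error a u < ennreal (e / (B + 1))"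
    using mollifiable_integrable[OF u] e B0 unfolding mollifiable_def by (simp add: add_nonneg_pos)
  moreover have "\<forall>\<^sub>F a in at_right (1::real). 1 < a" by (rule eventually_at_right_less)
  ultimately show "\<forall>\<^sub>F a in at_right 1. dist (\<integral>y. \<rho> y * (\<integral>x. approximate_identity a (x \<bullet> y) * u x \<partial>sphere_area) \<partial>sphere_area)
      (\<integral>y. \<rho> y * u y \<partial>sphere_area) < e"
  proof eventually_elim
    case (elim a)
    note a = elim(2)
    let ?P = "\<lambda>x y. approximate_identity a (x \<bullet> y)"
    define M where "M = (a\<^sup>2 - 1) / (4 * pi * (a - 1)\<^sup>2)"
    have P: "0 \<le> ?P x y" "?P x y \<le> M" if "norm x = 1" "norm y = 1" for x y :: "real^3"
      using approximate_identity_nonneg[OF a] approximate_identity_le[OF a sphere_inner_le(1)[of x y]] that by (auto simp: M_def)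
    have int1: "integrable (sphere_area \<Otimes>\<^sub>M sphere_area) (\<lambda>(x, y). \<rho> y * (?P x y * u x))"
    proof (rule integrable_sphere_pair_bounded)
      show "integrable sphere_area (\<lambda>x. B * (M * \<bar>u x\<bar>))" using u by simp
      show "\<bar>\<rho> y * (?P x y * u x)\<bar> \<le> B * (M * \<bar>u x\<bar>)" if "norm x = 1" "norm y = 1" for x y
        using P[OF that] B[OF that(2)] B0 by (simp add: abs_mult mult_mono)
    qed measurable
    have int2: "integrable sphere_area (\<lambda>y. \<rho> y * (\<integral>x. ?P x y * u x \<partial>sphere_area))"
      using sphere_pair.integrable_snd[OF int1] by simp
    have int3: "integrable sphere_area (\<lambda>y. \<rho> y * u y)"
      using B B0 by (intro Bochner_Integration.integrable_bound[OF integrable_mult_right[OF integrable_abs[OF u], of B]] AE_I2)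
        (auto simp: abs_mult mult_right_mono)
    have int4: "integrable sphere_area (\<lambda>x. ?P x y * u x)" if y: "norm y = 1" for y
      using P y by (intro integrable_sphere_bounded_mult[OF u, of _ M]) auto
    have one: "(\<integral>x. ?P x y \<partial>sphere_area) = 1" "integrable sphere_area (\<lambda>x. ?P x y)" if y: "norm y = 1" for y
    proof -
      show "(\<integral>x. ?P x y \<partial>sphere_area) = 1"
        using nn_integral_approximate_identity[OF y a] approximate_identity_nonneg[OF a]
        by (subst integral_eq_nn_integral) auto
      show "integrable sphere_area (\<lambda>x. ?P x y)"
        using P y by (intro integrable_sphere_bounded[of _ M]) auto
    qed
    let ?D = "\<lambda>y. \<integral>x. \<rho> y * (?P x y * (u x - u y)) \<partial>sphere_area"
    have D: "?D y = \<rho> y * (\<integral>x. ?P x y * u x \<partial>sphere_area) - \<rho> y * u y" if y: "norm y = 1" for y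
    proof -
      have "(\<integral>x. ?P x y * (u x - u y) \<partial>sphere_area) = (\<integral>x. ?P x y * u x \<partial>sphere_area) - u y"
        using int4[OF y] one[OF y] by (simp add: right_diff_distrib Bochner_Integration.integral_diff)
      then show ?thesis by (simp only: integral_mult_right_zero right_diff_distrib[of "\<rho> y"])
    qed
    have "(\<integral>y. \<rho> y * (\<integral>x. ?P x y * u x \<partial>sphere_area) \<partial>sphere_area) - (\<integral>y. \<rho> y * u y \<partial>sphere_area)
        = (\<integral>y. \<rho> y * (\<integral>x. ?P x y * u x \<partial>sphere_area) - \<rho> y * u y \<partial>sphere_area)"
      using int2 int3 by (rule Bochner_Integration.integral_diff[symmetric])
    also have "ennreal \<bar>\<dots>\<bar> \<le> (\<integral>\<^sup>+y. ennreal (norm (\<rho> y * (\<integral>x. ?P x y * u x \<partial>sphere_area) - \<rho> y * u y)) \<partial>sphere_area)"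
      unfolding real_norm_def[symmetric] using int2 int3 by (intro integral_norm_bound_ennreal) auto
    also have "\<dots> = (\<integral>\<^sup>+y. ennreal (norm (?D y)) \<partial>sphere_area)"
    proof (rule nn_integral_cong)
      fix y assume "y \<in> space sphere_area"
      then have "norm y = 1" by simp
      show "ennreal (norm (\<rho> y * (\<integral>x. ?P x y * u x \<partial>sphere_area) - \<rho> y * u y)) = ennreal (norm (?D y))"
        unfolding D[OF \<open>norm y = 1\<close>] by (rule refl)
    qed
    also have "\<dots> \<le> (\<integral>\<^sup>+y. (\<integral>\<^sup>+x. ennreal (B + 1) * ennreal (?P x y * \<bar>u x - u y\<bar>) \<partial>sphere_area) \<partial>sphere_area)"
    proof (rule nn_integral_mono)
      fix y assume "y \<in> space sphere_area"
      then have y: "norm y = 1" by simp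
      have "integrable sphere_area (\<lambda>x. \<rho> y * (?P x y * (u x - u y)))"
        using int4[OF y] one(2)[OF y] by (simp add: right_diff_distrib)
      then have "ennreal (norm (?D y)) \<le> (\<integral>\<^sup>+x. ennreal (norm (\<rho> y * (?P x y * (u x - u y)))) \<partial>sphere_area)"
        by (rule integral_norm_bound_ennreal)
      also have "\<dots> \<le> (\<integral>\<^sup>+x. ennreal (B + 1) * ennreal (?P x y * \<bar>u x - u y\<bar>) \<partial>sphere_area)"
      proof (rule nn_integral_mono)
        fix x :: "real^3"
        have p: "0 \<le> ?P x y" by (rule approximate_identity_nonneg[OF a])
        have "\<bar>\<rho> y\<bar> * (?P x y * \<bar>u x - u y\<bar>) \<le> (B + 1) * (?P x y * \<bar>u x - u y\<bar>)"
          using B[OF y] p by (intro mult_right_mono) auto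
        then show "ennreal (norm (\<rho> y * (?P x y * (u x - u y)))) \<le> ennreal (B + 1) * ennreal (?P x y * \<bar>u x - u y\<bar>)"
          using p B0 by (subst ennreal_mult[symmetric]) (auto simp: abs_mult intro!: ennreal_leI)
      qed
      finally show "ennreal (norm (?D y)) \<le> (\<integral>\<^sup>+x. ennreal (B + 1) * ennreal (?P x y * \<bar>u x - u y\<bar>) \<partial>sphere_area)" .
    qed
    also have "\<dots> = ennreal (B + 1) * mollification_error a u"
      unfolding mollification_error_def by (simp add: nn_integral_cmult)
    also have "\<dots> < ennreal (B + 1) * ennreal (e / (B + 1))"
      using elim(1) B0 by (intro ennreal_mult_strict_left_mono) (auto simp del: ennreal_plus)
    also have "\<dots> = ennreal e" using e B0 by (subst ennreal_mult[symmetric]) auto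
    finally show ?case using e by (simp add: dist_real_def ennreal_less_iff)
  qed
qed

lemma borel_measurable_green_field [measurable (raw)]:
  assumes [measurable]: "f \<in> borel_measurable M" "g \<in> borel_measurable M"
  shows "(\<lambda>p. green_field a (f p) (g p)) \<in> borel_measurable M"
  unfolding green_field_def by measurable

lemma norm_green_field_le:
  assumes x: "norm x = 1" and y: "norm y = 1" and a: "1 < a"
  shows "norm (green_field a y x) \<le> 1 / (a - 1)"
proof -
  have t: "\<bar>x \<bullet> y\<bar> \<le> 1" using sphere_inner_le[of x y] x y by auto
  have d: "0 < a - x \<bullet> y" using a t by linarith
  have "norm (y - (x \<bullet> y) *\<^sub>R x) \<le> norm y + norm ((x \<bullet> y) *\<^sub>R x)" by (rule norm_triangle_ineq4)
  also have "\<dots> \<le> 4 * pi" using x y t pi_ge_two by simp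
  finally have n: "norm (y - (x \<bullet> y) *\<^sub>R x) \<le> 4 * pi" .
  have "norm (green_field a y x) = 1 / (4 * pi * (a - x \<bullet> y)) * norm (y - (x \<bullet> y) *\<^sub>R x)"
    unfolding green_field_def green_field_denominator[OF x y] using d by simp
  also have "\<dots> \<le> 1 / (4 * pi * (a - 1)) * (4 * pi)"
    using n a t by (intro mult_mono divide_left_mono mult_left_mono mult_pos_pos) auto
  finally show ?thesis using a by simp
qed

definition potential_gradient :: "real \<Rightarrow> (real^3 \<Rightarrow> real) \<Rightarrow> real^3 \<Rightarrow> real^3" where
  "potential_gradient a \<rho> x = (\<integral>y. \<rho> y *\<^sub>R green_field a y x \<partial>sphere_area)"

lemma
  assumes \<rho> [measurable]: "\<rho> \<in> borel_measurable sphere_area" and B: "\<And>x. norm x = 1 \<Longrightarrow> \<bar>\<rho> x\<bar> \<le> B" and a: "1 < a"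
  shows borel_measurable_potential_gradient: "potential_gradient a \<rho> \<in> borel_measurable sphere_area"
    and norm_potential_gradient_le: "norm x = 1 \<Longrightarrow> norm (potential_gradient a \<rho> x) \<le> B * (1 / (a - 1)) * (4 * pi)"
    and integral_inner_potential_gradient: "integrable sphere_area H \<Longrightarrow> (\<integral>x. H x \<bullet> potential_gradient a \<rho> x \<partial>sphere_area)
        = (\<integral>y. \<rho> y * (\<integral>x. H x \<bullet> green_field a y x \<partial>sphere_area) \<partial>sphere_area)"
proof -
  show "potential_gradient a \<rho> \<in> borel_measurable sphere_area"
    unfolding potential_gradient_def[abs_def] by measurable
  have B0: "0 \<le> B" using B[of "axis 1 1"] by (simp add: order_trans[OF abs_ge_zero])
  have bound: "norm (\<rho> y *\<^sub>R green_field a y x) \<le> B * (1 / (a - 1))" if "norm x = 1" "norm y = 1" for x y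
    using norm_green_field_le[OF that a] B[OF that(2)] B0 a by (simp add: mult_mono del: times_divide_eq_right)
  have int: "integrable sphere_area (\<lambda>y. \<rho> y *\<^sub>R green_field a y x)" if "norm x = 1" for x
    by (rule integrable_sphere_bounded[OF _ bound[OF that]]) measurable
  show "norm (potential_gradient a \<rho> x) \<le> B * (1 / (a - 1)) * (4 * pi)" if x: "norm x = 1" for x
  proof -
    have "norm (potential_gradient a \<rho> x) \<le> (\<integral>y. norm (\<rho> y *\<^sub>R green_field a y x) \<partial>sphere_area)"
      unfolding potential_gradient_def by (rule integral_norm_bound)
    also have "\<dots> \<le> (\<integral>y. B * (1 / (a - 1)) \<partial>sphere_area)"
      using bound[OF x] by (intro integral_mono integrable_norm int[OF x]) auto
    finally show ?thesis by (simp add: mult.commute)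
  qed
  show "(\<integral>x. H x \<bullet> potential_gradient a \<rho> x \<partial>sphere_area)
        = (\<integral>y. \<rho> y * (\<integral>x. H x \<bullet> green_field a y x \<partial>sphere_area) \<partial>sphere_area)" if H: "integrable sphere_area H" for H
  proof -
    have [measurable]: "H \<in> borel_measurable sphere_area" using H by simp
    have "integrable (sphere_area \<Otimes>\<^sub>M sphere_area) (\<lambda>(x, y). \<rho> y * (H x \<bullet> green_field a y x))"
    proof (rule integrable_sphere_pair_bounded)
      show "integrable sphere_area (\<lambda>x. norm (H x) * (B * (1 / (a - 1))))" using H by simp
      show "\<bar>\<rho> y * (H x \<bullet> green_field a y x)\<bar> \<le> norm (H x) * (B * (1 / (a - 1)))" if "norm x = 1" "norm y = 1" for x y
      proof -
        have "\<bar>\<rho> y * (H x \<bullet> green_field a y x)\<bar> = \<bar>H x \<bullet> (\<rho> y *\<^sub>R green_field a y x)\<bar>" by simp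
        also have "\<dots> \<le> norm (H x) * norm (\<rho> y *\<^sub>R green_field a y x)" by (rule Cauchy_Schwarz_ineq2)
        also have "\<dots> \<le> norm (H x) * (B * (1 / (a - 1)))" by (intro mult_left_mono bound that) simp
        finally show ?thesis .
      qed
    qed measurable
    note F = sphere_pair.Fubini_integral[OF this]
    have "(\<integral>x. H x \<bullet> potential_gradient a \<rho> x \<partial>sphere_area)
        = (\<integral>x. (\<integral>y. \<rho> y * (H x \<bullet> green_field a y x) \<partial>sphere_area) \<partial>sphere_area)"
      using int by (intro Bochner_Integration.integral_cong)
        (simp_all add: potential_gradient_def flip: integral_inner_right)
    also have "\<dots> = (\<integral>y. \<rho> y * (\<integral>x. H x \<bullet> green_field a y x \<partial>sphere_area) \<partial>sphere_area)"
      unfolding F[symmetric] by simp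
    finally show ?thesis .
  qed
qed

text \<open>
  Up to the factor \<open>4 \<pi>\<close> the bound of \<open>green_energy_le\<close>; as \<open>a \<rightarrow> 1\<close> it becomes \<open>5 - ln |x - y|\<^sup>2\<close>
  at \<open>t = x \<bullet> y\<close>.
\<close>

definition log_kernel :: "real \<Rightarrow> real \<Rightarrow> real" where
  "log_kernel a t = 5 - ln (a\<^sup>2 + 1 - 2 * t)"

lemma borel_measurable_log_kernel [measurable]: "log_kernel a \<in> borel_measurable borel"
  unfolding log_kernel_def[abs_def] by measurable

lemma log_kernel_bounded:
  assumes a: "1 < a" obtains C where "\<And>x y :: real^3. norm x = 1 \<Longrightarrow> norm y = 1 \<Longrightarrow> \<bar>log_kernel a (x \<bullet> y)\<bar> \<le> C"
proof
  fix x y :: "real^3" assume xy: "norm x = 1" "norm y = 1"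
  define t where "t = x \<bullet> y"
  have t: "t \<le> 1" "- 1 \<le> t" using sphere_inner_le[of x y] xy by (auto simp: t_def)
  have 0: "0 < (a - 1)\<^sup>2" using a by simp
  have 1: "(a - 1)\<^sup>2 \<le> a\<^sup>2 + 1 - 2 * t" "a\<^sup>2 + 1 - 2 * t \<le> (a + 1)\<^sup>2"
    using a t by (auto simp: power2_eq_square algebra_simps)
  have 2: "0 < a\<^sup>2 + 1 - 2 * t" using 0 1 by linarith
  have "ln ((a - 1)\<^sup>2) \<le> ln (a\<^sup>2 + 1 - 2 * t)" using 0 1 2 by (subst ln_le_cancel_iff) auto
  moreover have "ln (a\<^sup>2 + 1 - 2 * t) \<le> ln ((a + 1)\<^sup>2)" using 0 1 2 by (subst ln_le_cancel_iff) auto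
  ultimately show "\<bar>log_kernel a (x \<bullet> y)\<bar> \<le> 5 + \<bar>ln ((a - 1)\<^sup>2)\<bar> + \<bar>ln ((a + 1)\<^sup>2)\<bar>"
    unfolding log_kernel_def t_def by linarith
qed

lemma sphere_L2_imp_integrable:
  fixes f :: "real^3 \<Rightarrow> 'b::euclidean_space"
  assumes "sphere_L2 f" shows "integrable sphere_area f"
proof (rule Bochner_Integration.integrable_bound[of _ "\<lambda>x. 1 + (norm (f x))\<^sup>2"])
  show "AE x in sphere_area. norm (f x) \<le> norm (1 + (norm (f x))\<^sup>2)"
  proof (rule AE_I2)
    fix x
    have "0 \<le> (norm (f x) - 1)\<^sup>2" by simp
    then have "2 * norm (f x) \<le> 1 + (norm (f x))\<^sup>2" by (simp add: power2_eq_square algebra_simps)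
    then show "norm (f x) \<le> norm (1 + (norm (f x))\<^sup>2)" using norm_ge_zero[of "f x"] by (simp del: norm_ge_zero)
  qed
qed (use assms in \<open>auto simp: sphere_L2_def\<close>)

text \<open>
  Testing the weak gradient against the Green field at \<open>y\<close> shows that the mollification of \<open>u\<close> at \<open>y\<close> is
  \<open>\<integral> G \<bullet> green_field a y\<close>, because \<open>u\<close> has mean zero. Averaging over \<open>\<rho>\<close> and exchanging the integrals gives the pairing
  of \<open>G\<close> with the potential gradient \<open>X\<close> of \<open>\<rho>\<close>; then \<open>2 G \<bullet> X \<le> A |G|\<^sup>2 + |X|\<^sup>2 / A\<close>, and \<open>\<integral> |X|\<^sup>2\<close> is the
  double integral of the energy kernel.
\<close>

lemma mollified_pairing_le_energy:
  assumes u: "sphere_L2 u" and G: "is_weak_gradient u G" and mean: "(\<integral>x. u x \<partial>sphere_area) = 0"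
    and \<rho> [measurable]: "\<rho> \<in> borel_measurable sphere_area" and \<rho>0: "\<And>x. 0 \<le> \<rho> x"
    and B: "\<And>x. norm x = 1 \<Longrightarrow> \<rho> x \<le> B" and a: "1 < a" "a \<le> 2" and A: "0 < A"
  shows "2 * (\<integral>y. \<rho> y * (\<integral>x. approximate_identity a (x \<bullet> y) * u x \<partial>sphere_area) \<partial>sphere_area)
     \<le> A * (\<integral>x. (norm (G x))\<^sup>2 \<partial>sphere_area)
       + (\<integral>y. \<rho> y * (\<integral>z. \<rho> z * log_kernel a (y \<bullet> z) \<partial>sphere_area) \<partial>sphere_area) / (4 * pi * A)"
proof -
  let ?X = "potential_gradient a \<rho>"
  have B': "\<And>x. norm x = 1 \<Longrightarrow> \<bar>\<rho> x\<bar> \<le> B" using B \<rho>0 by simp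
  have B0: "0 \<le> B" using B'[of "axis 1 1"] by (simp add: order_trans[OF abs_ge_zero])
  have X [measurable]: "?X \<in> borel_measurable sphere_area"
    by (rule borel_measurable_potential_gradient[OF \<rho> B' a(1)])
  have X_le: "norm (?X x) \<le> B * (1 / (a - 1)) * (4 * pi)" if "norm x = 1" for x
    by (rule norm_potential_gradient_le[OF \<rho> B' a(1) that])
  have X_inner: "(\<integral>x. H x \<bullet> ?X x \<partial>sphere_area) = (\<integral>y. \<rho> y * (\<integral>x. H x \<bullet> green_field a y x \<partial>sphere_area) \<partial>sphere_area)"
    if "integrable sphere_area H" for H
    by (rule integral_inner_potential_gradient[OF \<rho> B' a(1) that])
  define M where "M = B * (1 / (a - 1)) * (4 * pi)"
  have ui: "integrable sphere_area u" by (rule sphere_L2_imp_integrable[OF u])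
  have G2: "sphere_L2 G" using G by (simp add: is_weak_gradient_def)
  have Gi: "integrable sphere_area G" by (rule sphere_L2_imp_integrable[OF G2])
  have [measurable]: "G \<in> borel_measurable sphere_area" "u \<in> borel_measurable sphere_area" using Gi ui by simp_all
  have test: "(\<integral>x. approximate_identity a (x \<bullet> y) * u x \<partial>sphere_area) = (\<integral>x. G x \<bullet> green_field a y x \<partial>sphere_area)"
    if y: "norm y = 1" for y
  proof -
    have int: "integrable sphere_area (\<lambda>x. approximate_identity a (x \<bullet> y) * u x)"
    proof (rule integrable_sphere_bounded_mult[OF ui])
      fix x :: "real^3" assume "norm x = 1"
      then show "\<bar>approximate_identity a (x \<bullet> y)\<bar> \<le> (a\<^sup>2 - 1) / (4 * pi * (a - 1)\<^sup>2)"
        using sphere_inner_le(1)[of x y] y approximate_identity_nonneg[OF a(1)]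
        by (simp add: approximate_identity_le[OF a(1)])
    qed measurable
    have "- (\<integral>x. G x \<bullet> green_field a y x \<partial>sphere_area) = (\<integral>x. u x * sphere_div (green_field a y) x \<partial>sphere_area)"
      using G smooth_tangent_green_field[OF a(1)] by (simp add: is_weak_gradient_def)
    also have "\<dots> = (\<integral>x. u x * (1 / (4 * pi)) - approximate_identity a (x \<bullet> y) * u x \<partial>sphere_area)"
      by (rule Bochner_Integration.integral_cong) (simp_all add: sphere_div_green_field[OF _ y a(1)] algebra_simps)
    also have "\<dots> = (\<integral>x. u x \<partial>sphere_area) * (1 / (4 * pi)) - (\<integral>x. approximate_identity a (x \<bullet> y) * u x \<partial>sphere_area)"
      using ui int by (subst Bochner_Integration.integral_diff) auto
    finally show ?thesis using mean by simp
  qed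
  have XX_int: "integrable sphere_area (\<lambda>x. (norm (?X x))\<^sup>2)"
    by (rule integrable_sphere_bounded[of _ "M\<^sup>2"]) (use X_le in \<open>auto simp: M_def intro!: power_mono\<close>)
  have Xi: "integrable sphere_area ?X"
    by (rule integrable_sphere_bounded[OF X X_le])
  have GX_int: "integrable sphere_area (\<lambda>x. G x \<bullet> ?X x)"
  proof (rule Bochner_Integration.integrable_bound[OF integrable_mult_right[OF integrable_norm[OF Gi], of M]])
    show "AE x in sphere_area. norm (G x \<bullet> ?X x) \<le> norm (M * norm (G x))"
    proof (rule AE_I2)
      fix x assume x: "x \<in> space sphere_area"
      have "\<bar>G x \<bullet> ?X x\<bar> \<le> norm (G x) * norm (?X x)" by (rule Cauchy_Schwarz_ineq2)
      also have "\<dots> \<le> norm (G x) * M" unfolding M_def using x by (intro mult_left_mono X_le) auto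
      also have "\<dots> \<le> norm (M * norm (G x))" by (simp add: mult.commute abs_ge_self del: abs_mult norm_mult)
      finally show "norm (G x \<bullet> ?X x) \<le> norm (M * norm (G x))" by simp
    qed
  qed measurable
  obtain C where C: "\<And>x y :: real^3. norm x = 1 \<Longrightarrow> norm y = 1 \<Longrightarrow> \<bar>log_kernel a (x \<bullet> y)\<bar> \<le> C"
    using log_kernel_bounded[OF a(1)] by blast
  have mono: "(\<integral>y. \<rho> y * f y \<partial>sphere_area) \<le> (\<integral>y. \<rho> y * g y \<partial>sphere_area)"
    if [measurable]: "f \<in> borel_measurable sphere_area" "g \<in> borel_measurable sphere_area"
      and b: "\<And>y. norm y = 1 \<Longrightarrow> \<bar>f y\<bar> \<le> F" "\<And>y. norm y = 1 \<Longrightarrow> \<bar>g y\<bar> \<le> F'"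
      and le: "\<And>y. norm y = 1 \<Longrightarrow> f y \<le> g y" for f g F F'
  proof (rule integral_mono)
    show "integrable sphere_area (\<lambda>y. \<rho> y * f y)" "integrable sphere_area (\<lambda>y. \<rho> y * g y)"
      using b B' by (auto intro!: integrable_sphere_bounded_mult[OF integrable_sphere_bounded[of f F] _ B']
          integrable_sphere_bounded_mult[OF integrable_sphere_bounded[of g F'] _ B'])
  qed (use \<rho>0 le in \<open>auto intro!: mult_left_mono\<close>)
  have inner_le: "\<bar>v \<bullet> green_field a y x\<bar> \<le> norm v * (1 / (a - 1))" if "norm x = 1" "norm y = 1" for v x y
    using Cauchy_Schwarz_ineq2[of v "green_field a y x"] mult_left_mono[OF norm_green_field_le[OF that a(1)], of "norm v"] by simp
  define T where "T y = (\<integral>x. ?X x \<bullet> green_field a y x \<partial>sphere_area)" for y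
  define W where "W y = (\<integral>z. \<rho> z * log_kernel a (y \<bullet> z) \<partial>sphere_area)" for y
  have T [measurable]: "T \<in> borel_measurable sphere_area" unfolding T_def[abs_def] by measurable
  have W [measurable]: "W \<in> borel_measurable sphere_area" unfolding W_def[abs_def] by measurable
  have T_le: "T y \<le> W y / (4 * pi)" if y: "norm y = 1" for y
  proof -
    have Vi: "integrable sphere_area (green_field a y)"
      by (rule integrable_sphere_bounded[OF _ norm_green_field_le[OF _ y a(1)]]) measurable
    have "T y = (\<integral>x. green_field a y x \<bullet> ?X x \<partial>sphere_area)" by (simp add: T_def inner_commute)
    also have "\<dots> = (\<integral>z. \<rho> z * (\<integral>x. green_field a y x \<bullet> green_field a z x \<partial>sphere_area) \<partial>sphere_area)"
      by (rule X_inner[OF Vi])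
    also have "\<dots> \<le> (\<integral>z. \<rho> z * (log_kernel a (y \<bullet> z) / (4 * pi)) \<partial>sphere_area)"
    proof (rule mono)
      fix z :: "real^3" assume z: "norm z = 1"
      show "(\<integral>x. green_field a y x \<bullet> green_field a z x \<partial>sphere_area) \<le> log_kernel a (y \<bullet> z) / (4 * pi)"
        unfolding log_kernel_def by (rule green_energy_le[OF y z a])
      show "\<bar>log_kernel a (y \<bullet> z) / (4 * pi)\<bar> \<le> C / (4 * pi)"
        using C[OF y z] by (simp add: divide_right_mono)
      show "\<bar>\<integral>x. green_field a y x \<bullet> green_field a z x \<partial>sphere_area\<bar> \<le> 4 * pi * (1 / (a - 1) * (1 / (a - 1)))"
      proof (rule abs_integral_sphere_le)
        fix x :: "real^3" assume x: "norm x = 1"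
        show "\<bar>green_field a y x \<bullet> green_field a z x\<bar> \<le> 1 / (a - 1) * (1 / (a - 1))"
          using inner_le[OF x z, of "green_field a y x"] mult_right_mono[OF norm_green_field_le[OF x y a(1)], of "1 / (a - 1)"] a by simp
      qed measurable
    qed measurable
    also have "\<dots> = W y / (4 * pi)" by (simp add: W_def)
    finally show ?thesis .
  qed
  have "(\<integral>x. (norm (?X x))\<^sup>2 \<partial>sphere_area) = (\<integral>y. \<rho> y * T y \<partial>sphere_area)"
    unfolding T_def X_inner[OF Xi, symmetric] power2_norm_eq_inner ..
  also have "\<dots> \<le> (\<integral>y. \<rho> y * (W y / (4 * pi)) \<partial>sphere_area)"
  proof (rule mono)
    fix y :: "real^3" assume y: "norm y = 1"
    show "T y \<le> W y / (4 * pi)" by (rule T_le[OF y])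
    show "\<bar>T y\<bar> \<le> 4 * pi * (M * (1 / (a - 1)))"
      unfolding T_def
    proof (rule abs_integral_sphere_le)
      fix x :: "real^3" assume x: "norm x = 1"
      show "\<bar>?X x \<bullet> green_field a y x\<bar> \<le> M * (1 / (a - 1))"
        unfolding M_def
        by (rule order_trans[OF inner_le[OF x y] mult_right_mono[OF X_le[OF x]]]) (use a in simp)
    qed measurable
    have "\<bar>W y\<bar> \<le> 4 * pi * (B * C)"
      unfolding W_def
    proof (rule abs_integral_sphere_le)
      fix z :: "real^3" assume z: "norm z = 1"
      show "\<bar>\<rho> z * log_kernel a (y \<bullet> z)\<bar> \<le> B * C"
        unfolding abs_mult using B'[OF z] C[OF y z] B0 by (intro mult_mono) auto
    qed measurable
    then show "\<bar>W y / (4 * pi)\<bar> \<le> B * C" by (simp add: field_simps)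
  qed measurable
  also have "\<dots> = (\<integral>y. \<rho> y * W y \<partial>sphere_area) / (4 * pi)" by simp
  finally have energy: "(\<integral>x. (norm (?X x))\<^sup>2 \<partial>sphere_area) \<le> (\<integral>y. \<rho> y * W y \<partial>sphere_area) / (4 * pi)" .
  have G2i: "integrable sphere_area (\<lambda>x. (norm (G x))\<^sup>2)" using G2 by (simp add: sphere_L2_def)
  have "(\<integral>y. \<rho> y * (\<integral>x. approximate_identity a (x \<bullet> y) * u x \<partial>sphere_area) \<partial>sphere_area)
      = (\<integral>y. \<rho> y * (\<integral>x. G x \<bullet> green_field a y x \<partial>sphere_area) \<partial>sphere_area)"
    by (rule Bochner_Integration.integral_cong) (simp_all add: test)
  also have "\<dots> = (\<integral>x. G x \<bullet> ?X x \<partial>sphere_area)" by (rule X_inner[OF Gi, symmetric])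
  also have "2 * \<dots> = (\<integral>x. 2 * (G x \<bullet> ?X x) \<partial>sphere_area)" by simp
  also have "\<dots> \<le> (\<integral>x. A * (norm (G x))\<^sup>2 + (norm (?X x))\<^sup>2 / A \<partial>sphere_area)"
  proof (rule integral_mono)
    fix x
    have "0 \<le> (A * norm (G x) - norm (?X x))\<^sup>2" by simp
    then have "2 * A * (norm (G x) * norm (?X x)) \<le> A\<^sup>2 * (norm (G x))\<^sup>2 + (norm (?X x))\<^sup>2"
      by (simp add: power2_eq_square algebra_simps)
    then have "2 * (norm (G x) * norm (?X x)) \<le> A * (norm (G x))\<^sup>2 + (norm (?X x))\<^sup>2 / A"
      using A by (simp add: field_simps power2_eq_square)
    then show "2 * (G x \<bullet> ?X x) \<le> A * (norm (G x))\<^sup>2 + (norm (?X x))\<^sup>2 / A"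
      using norm_cauchy_schwarz[of "G x" "?X x"] by linarith
  qed (use GX_int G2i XX_int in auto)
  also have "\<dots> = A * (\<integral>x. (norm (G x))\<^sup>2 \<partial>sphere_area) + (\<integral>x. (norm (?X x))\<^sup>2 \<partial>sphere_area) / A"
    using G2i XX_int by simp
  also have "\<dots> \<le> A * (\<integral>x. (norm (G x))\<^sup>2 \<partial>sphere_area) + (\<integral>y. \<rho> y * W y \<partial>sphere_area) / (4 * pi) / A"
    using energy A by (intro add_left_mono divide_right_mono) auto
  finally show ?thesis by (simp add: W_def)
qed

section \<open>Gibbs densities and the logarithmic kernel\<close>

definition partition_function :: "(real^3 \<Rightarrow> real) \<Rightarrow> (real^3) set \<Rightarrow> real" where
  "partition_function u E = (\<integral>x. indicator E x * exp (2 * u x) \<partial>sphere_area)"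

definition gibbs_density :: "(real^3 \<Rightarrow> real) \<Rightarrow> (real^3) set \<Rightarrow> real^3 \<Rightarrow> real" where
  "gibbs_density u E x = indicator E x * exp (2 * u x) / partition_function u E"

lemma
  assumes [measurable]: "u \<in> borel_measurable sphere_area" "E \<in> sets sphere_area"
    and b: "\<And>x. x \<in> E \<Longrightarrow> \<bar>u x\<bar> \<le> b" and Z: "0 < partition_function u E"
  shows borel_measurable_gibbs_density: "gibbs_density u E \<in> borel_measurable sphere_area"
    and gibbs_density_nonneg: "0 \<le> gibbs_density u E x"
    and gibbs_density_le: "gibbs_density u E x \<le> exp (2 * b) / partition_function u E"
    and integrable_gibbs_density: "integrable sphere_area (gibbs_density u E)"
    and integral_gibbs_density: "(\<integral>x. gibbs_density u E x \<partial>sphere_area) = 1"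
    and integrable_gibbs_density_mult_u: "integrable sphere_area (\<lambda>x. gibbs_density u E x * u x)"
proof -
  show m: "gibbs_density u E \<in> borel_measurable sphere_area" unfolding gibbs_density_def[abs_def] by measurable
  show n: "0 \<le> gibbs_density u E x" for x using Z by (simp add: gibbs_density_def)
  show le: "gibbs_density u E x \<le> exp (2 * b) / partition_function u E" for x
    unfolding gibbs_density_def using Z b[of x]
    by (intro divide_right_mono) (auto simp: indicator_def abs_le_iff less_imp_le)
  show i: "integrable sphere_area (gibbs_density u E)"
    using n le by (intro integrable_sphere_bounded[OF m, of "exp (2 * b) / partition_function u E"]) simp
  show "(\<integral>x. gibbs_density u E x \<partial>sphere_area) = 1"
    using Z by (simp add: gibbs_density_def partition_function_def)
  show "integrable sphere_area (\<lambda>x. gibbs_density u E x * u x)"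
  proof (rule integrable_sphere_bounded)
    show "norm (gibbs_density u E x * u x) \<le> exp (2 * b) / partition_function u E * b" for x
    proof (cases "x \<in> E")
      case True
      then show ?thesis using n[of x] le[of x] b[OF True] unfolding norm_mult by (intro mult_mono) auto
    next
      case False
      then have "gibbs_density u E x = 0" by (simp add: gibbs_density_def)
      moreover have "E \<noteq> {}" using Z by (auto simp: partition_function_def)
      then have "0 \<le> b" using b by fastforce
      ultimately show ?thesis using Z by simp
    qed
  qed (use m in measurable)
qed

text \<open>
  This is \<open>\<integral> \<rho> ln \<rho>\<close> for the Gibbs density \<open>\<rho>\<close>, because \<open>ln \<rho> = 2 u - ln Z\<close> on \<open>E\<close>.
\<close>

definition gibbs_entropy :: "(real^3 \<Rightarrow> real) \<Rightarrow> (real^3) set \<Rightarrow> real" where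
  "gibbs_entropy u E = 2 * (\<integral>x. gibbs_density u E x * u x \<partial>sphere_area) - ln (partition_function u E)"

text \<open>
  The Gibbs variational principle. Let \<open>c\<close> be the mean of \<open>h - ln \<rho>\<close> under the Gibbs density \<open>\<rho>\<close>; integrating
  \<open>exp (h - c) = \<rho> exp (h - c - ln \<rho>) \<ge> \<rho> (1 + h - c - ln \<rho>)\<close> over \<open>E\<close> gives \<open>exp (- c) \<integral> exp h \<ge> 1\<close>.
\<close>

lemma gibbs_variational_inequality:
  assumes [measurable]: "u \<in> borel_measurable sphere_area" "E \<in> sets sphere_area"
    and b: "\<And>x. x \<in> E \<Longrightarrow> \<bar>u x\<bar> \<le> b" and Z: "0 < partition_function u E"
    and [measurable]: "h \<in> borel_measurable sphere_area" and C: "\<And>x. norm x = 1 \<Longrightarrow> \<bar>h x\<bar> \<le> C"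
  shows "(\<integral>x. gibbs_density u E x * h x \<partial>sphere_area) \<le> gibbs_entropy u E + ln (\<integral>x. exp (h x) \<partial>sphere_area)"
proof -
  let ?\<rho> = "gibbs_density u E"
  note g = borel_measurable_gibbs_density[OF assms(1-4)] gibbs_density_nonneg[OF assms(1-4)]
     integrable_gibbs_density[OF assms(1-4)] integral_gibbs_density[OF assms(1-4)] integrable_gibbs_density_mult_u[OF assms(1-4)]
  note g(1) [measurable]
  have hi: "integrable sphere_area (\<lambda>x. ?\<rho> x * h x)"
    using integrable_sphere_bounded_mult[OF g(3), of h C] C by (simp add: mult.commute)
  define H where "H = (\<integral>x. ?\<rho> x * h x \<partial>sphere_area)"
  define U where "U = (\<integral>x. ?\<rho> x * u x \<partial>sphere_area)"
  define c where "c = H - 2 * U + ln (partition_function u E)"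
  have expi: "integrable sphere_area (\<lambda>x. exp (h x - c))"
    using C by (intro integrable_sphere_bounded[of _ "exp (C - c)"]) (auto simp: abs_le_iff)
  have "1 = (\<integral>x. ?\<rho> x * h x + (- 2) * (?\<rho> x * u x) + (1 + ln (partition_function u E) - c) * ?\<rho> x \<partial>sphere_area)"
    using hi g(3,5) by (simp add: H_def[symmetric] U_def[symmetric] g(4) c_def)
  also have "\<dots> \<le> (\<integral>x. exp (h x - c) \<partial>sphere_area)"
  proof (rule integral_mono)
    fix x
    show "?\<rho> x * h x + (- 2) * (?\<rho> x * u x) + (1 + ln (partition_function u E) - c) * ?\<rho> x \<le> exp (h x - c)"
    proof (cases "x \<in> E")
      case True
      define t where "t = h x - 2 * u x + ln (partition_function u E) - c"
      have "?\<rho> x * h x + (- 2) * (?\<rho> x * u x) + (1 + ln (partition_function u E) - c) * ?\<rho> x = ?\<rho> x * (1 + t)"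
        by (simp add: t_def algebra_simps)
      also have "\<dots> \<le> ?\<rho> x * exp t" using g(2) by (intro mult_left_mono exp_ge_add_one_self)
      also have "\<dots> = exp (2 * u x) / partition_function u E * exp t" using True by (simp add: gibbs_density_def)
      also have "\<dots> = exp (h x - c)"
      proof -
        have "exp t = exp (h x - c) * partition_function u E / exp (2 * u x)"
          using Z by (simp add: t_def exp_add exp_diff)
        then show ?thesis using Z by simp
      qed
      finally show ?thesis .
    next
      case False
      then show ?thesis by (simp add: gibbs_density_def)
    qed
  qed (use hi g(3,5) expi in auto)
  also have "\<dots> = (\<integral>x. exp (h x) \<partial>sphere_area) * exp (- c)"
    by (simp add: exp_diff exp_minus divide_inverse)
  finally have 1: "1 \<le> (\<integral>x. exp (h x) \<partial>sphere_area) * exp (- c)" .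
  then have "exp c \<le> (\<integral>x. exp (h x) \<partial>sphere_area)" by (simp add: exp_minus field_simps)
  then have "c \<le> ln (\<integral>x. exp (h x) \<partial>sphere_area)"
    by (subst ln_ge_iff) (auto intro: less_le_trans[OF exp_gt_zero])
  then show ?thesis by (simp add: c_def H_def U_def gibbs_entropy_def)
qed

text \<open>
  A pointwise form of the logarithmic Hardy-Littlewood-Sobolev inequality with subcritical constant: the
  variational principle for \<open>h = s ln (1/|y - z|\<^sup>2)\<close>, whose exponential is integrable for \<open>s < 1\<close>.
\<close>

lemma gibbs_log_kernel_le:
  assumes u: "u \<in> borel_measurable sphere_area" and E: "E \<in> sets sphere_area"
    and b: "\<And>x. x \<in> E \<Longrightarrow> \<bar>u x\<bar> \<le> b" and Z: "0 < partition_function u E"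
    and y: "norm y = 1" and a: "1 < a" "a \<le> 2" and s: "0 < s" "s < 1"
  shows "(\<integral>z. gibbs_density u E z * log_kernel a (y \<bullet> z) \<partial>sphere_area)
    \<le> (gibbs_entropy u E + (5 * s + ln (7 * pi / (1 - s)))) / s"
proof -
  obtain C where C: "\<And>x y :: real^3. norm x = 1 \<Longrightarrow> norm y = 1 \<Longrightarrow> \<bar>log_kernel a (x \<bullet> y)\<bar> \<le> C"
    using log_kernel_bounded[OF a(1)] by blast
  let ?h = "\<lambda>z. s * log_kernel a (y \<bullet> z)"
  have "s * (\<integral>z. gibbs_density u E z * log_kernel a (y \<bullet> z) \<partial>sphere_area)
      = (\<integral>z. gibbs_density u E z * ?h z \<partial>sphere_area)"
    by (simp add: mult.left_commute[of _ s])
  also have "\<dots> \<le> gibbs_entropy u E + ln (\<integral>z. exp (?h z) \<partial>sphere_area)"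
  proof (rule gibbs_variational_inequality[OF u E b Z])
    show "\<bar>?h z\<bar> \<le> s * C" if "norm z = 1" for z
      using C[OF y that] s by (simp add: abs_mult)
  qed (auto, measurable)
  also have "ln (\<integral>z. exp (?h z) \<partial>sphere_area) \<le> 5 * s + ln (7 * pi / (1 - s))"
  proof -
    have pos: "0 < a\<^sup>2 + 1 - 2 * (z \<bullet> y)" if "norm z = 1" for z
    proof -
      have "1 < a\<^sup>2" using a by simp
      then show ?thesis using sphere_inner_le(1)[of z y] that y by auto
    qed
    have h: "exp (?h z) = exp (5 * s) * (a\<^sup>2 + 1 - 2 * (z \<bullet> y)) powr - s" if "norm z = 1" for z
      using pos[OF that] by (simp add: log_kernel_def powr_def inner_commute exp_add[symmetric] algebra_simps)
    have "(\<integral>\<^sup>+z. ennreal (exp (?h z)) \<partial>sphere_area) = (\<integral>\<^sup>+z. ennreal (exp (5 * s)) * ennreal ((a\<^sup>2 + 1 - 2 * (z \<bullet> y)) powr - s) \<partial>sphere_area)"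
      by (rule nn_integral_cong) (simp add: h ennreal_mult)
    also have "\<dots> = ennreal (exp (5 * s)) * (\<integral>\<^sup>+z. ennreal ((a\<^sup>2 + 1 - 2 * (z \<bullet> y)) powr - s) \<partial>sphere_area)"
      by (rule nn_integral_cmult) measurable
    also have "\<dots> \<le> ennreal (exp (5 * s)) * ennreal (7 * pi / (1 - s))"
      by (intro mult_left_mono nn_integral_sphere_powr y a s) simp
    also have "\<dots> = ennreal (exp (5 * s) * (7 * pi / (1 - s)))"
      using s by (intro ennreal_mult[symmetric]) auto
    finally have le: "(\<integral>\<^sup>+z. ennreal (exp (?h z)) \<partial>sphere_area) \<le> ennreal (exp (5 * s) * (7 * pi / (1 - s)))" .
    have int: "integrable sphere_area (\<lambda>z. exp (?h z))"
    proof (rule integrable_sphere_bounded)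
      show "norm (exp (?h z)) \<le> exp (s * C)" if "norm z = 1" for z
        using C[OF y that] s by (simp add: abs_le_iff)
    qed measurable
    have "(\<integral>z. exp (?h z) \<partial>sphere_area) \<le> exp (5 * s) * (7 * pi / (1 - s))"
      using le s by (subst (asm) nn_integral_eq_integral[OF int]) (auto simp: ennreal_le_iff)
    moreover have "0 < (\<integral>z. exp (?h z) \<partial>sphere_area)"
    proof -
      have "0 < exp (- (s * C)) * (4 * pi)" by simp
      also have "\<dots> = (\<integral>z. exp (- (s * C)) \<partial>sphere_area)" by simp
      also have "\<dots> \<le> (\<integral>z. exp (?h z) \<partial>sphere_area)"
      proof (rule integral_mono[OF _ int])
        fix z assume "z \<in> space sphere_area"
        then have "- C \<le> log_kernel a (y \<bullet> z)" using C[OF y, of z] by auto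
        then have "s * - C \<le> s * log_kernel a (y \<bullet> z)" using s by (intro mult_left_mono) auto
        then show "exp (- (s * C)) \<le> exp (?h z)" by simp
      qed simp
      finally show ?thesis .
    qed
    ultimately have "ln (\<integral>z. exp (?h z) \<partial>sphere_area) \<le> ln (exp (5 * s) * (7 * pi / (1 - s)))"
      using s by (subst ln_le_cancel_iff) auto
    also have "\<dots> = 5 * s + ln (7 * pi / (1 - s))" using s by (subst ln_mult) auto
    finally show ?thesis .
  qed
  finally show ?thesis using s by (simp add: field_simps)
qed

lemma log_kernel_separated_le:
  assumes x: "norm x = 1" and y: "norm y = 1" and \<delta>: "0 < \<delta>" "\<delta> \<le> norm (x - y)" and a: "1 < a"
  shows "log_kernel a (x \<bullet> y) \<le> 5 - 2 * ln \<delta>"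
proof -
  have "x \<bullet> x = 1" "y \<bullet> y = 1" using x y by (simp_all add: dot_square_norm)
  then have "(norm (x - y))\<^sup>2 = 2 - 2 * (x \<bullet> y)"
    unfolding power2_norm_eq_inner by (simp add: inner_simps inner_commute)
  moreover have "\<delta>\<^sup>2 \<le> (norm (x - y))\<^sup>2" using \<delta> by (intro power_mono) auto
  moreover have "1 < a\<^sup>2" using a by simp
  ultimately have le: "\<delta>\<^sup>2 \<le> a\<^sup>2 + 1 - 2 * (x \<bullet> y)" by linarith
  have "0 < \<delta>\<^sup>2" using \<delta> by simp
  moreover from this have "0 < a\<^sup>2 + 1 - 2 * (x \<bullet> y)" using le by linarith
  ultimately have "ln (\<delta>\<^sup>2) \<le> ln (a\<^sup>2 + 1 - 2 * (x \<bullet> y))" using le by (subst ln_le_cancel_iff) auto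
  then show ?thesis using \<delta> by (simp add: log_kernel_def ln_realpow)
qed

section \<open>The Moser-Trudinger inequality on separated sets\<close>

text \<open>
  The duality argument for sets on which \<open>u\<close> is bounded, so that the Gibbs densities are bounded and
  all integrals converge. The estimate is uniform in this bound, which permits its removal afterwards.
\<close>

lemma separated_moser_trudinger_truncated:
  fixes E :: "nat \<Rightarrow> (real^3) set"
  assumes u: "sphere_L2 u" and G: "is_weak_gradient u G" and mean: "(\<integral>x. u x \<partial>sphere_area) = 0"
    and N: "0 < N" and E: "\<And>i. i < N \<Longrightarrow> E i \<in> sets sphere_area"
    and b: "\<And>i x. i < N \<Longrightarrow> x \<in> E i \<Longrightarrow> \<bar>u x\<bar> \<le> b"
    and Z: "\<And>i. i < N \<Longrightarrow> 0 < partition_function u (E i)"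
    and sep: "\<And>i j x y. i < N \<Longrightarrow> j < N \<Longrightarrow> i \<noteq> j \<Longrightarrow> x \<in> E i \<Longrightarrow> y \<in> E j \<Longrightarrow> \<delta> \<le> norm (x - y)"
    and \<delta>: "0 < \<delta>" "\<delta> \<le> 1" and s: "0 < s" "s < 1"
  shows "(\<Sum>i<N. ln (partition_function u (E i))) / N
    \<le> 1 / (4 * pi * N * s) * (\<integral>x. (norm (G x))\<^sup>2 \<partial>sphere_area)
      + (5 * s + ln (7 * pi / (1 - s)) + s * N * (5 - 2 * ln \<delta>))"
proof -
  define g where "g i = gibbs_density u (E i)" for i
  define S where "S i = gibbs_entropy u (E i)" for i
  define c where "c = 5 * s + ln (7 * pi / (1 - s))"
  define D where "D = 5 - 2 * ln \<delta>"
  define \<rho> where "\<rho> x = (\<Sum>i<N. g i x) / N" for x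
  define G2 where "G2 = (\<integral>x. (norm (G x))\<^sup>2 \<partial>sphere_area)"
  define A where "A = 1 / (4 * pi * N * s)"
  have "ln \<delta> \<le> 0" using \<delta> by simp
  then have D: "0 \<le> D" unfolding D_def by linarith
  have A: "0 < A" using N s by (simp add: A_def)
  have ui: "integrable sphere_area u" by (rule sphere_L2_imp_integrable[OF u])
  have um [measurable]: "u \<in> borel_measurable sphere_area" using ui by simp
  have gm [measurable]: "g i \<in> borel_measurable sphere_area" if "i < N" for i
    unfolding g_def by (rule borel_measurable_gibbs_density[OF um E[OF that] b[OF that] Z[OF that]])
  have g0: "0 \<le> g i x" if "i < N" for i x
    unfolding g_def by (rule gibbs_density_nonneg[OF um E[OF that] b[OF that] Z[OF that]])
  have gle: "g i x \<le> exp (2 * b) / partition_function u (E i)" if "i < N" for i x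
    unfolding g_def by (rule gibbs_density_le[OF um E[OF that] b[OF that] Z[OF that]])
  have gi: "integrable sphere_area (g i)" if "i < N" for i
    unfolding g_def by (rule integrable_gibbs_density[OF um E[OF that] b[OF that] Z[OF that]])
  have g1: "(\<integral>x. g i x \<partial>sphere_area) = 1" if "i < N" for i
    unfolding g_def by (rule integral_gibbs_density[OF um E[OF that] b[OF that] Z[OF that]])
  have gu: "integrable sphere_area (\<lambda>x. g i x * u x)" if "i < N" for i
    unfolding g_def by (rule integrable_gibbs_density_mult_u[OF um E[OF that] b[OF that] Z[OF that]])
  have gE: "g i x = 0" if "x \<notin> E i" for i x using that by (simp add: g_def gibbs_density_def)
  have gmult: "integrable sphere_area (\<lambda>x. g i x * f x)"
    if "i < N" "f \<in> borel_measurable sphere_area" "\<And>x. norm x = 1 \<Longrightarrow> \<bar>f x\<bar> \<le> F" for i f F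
    using integrable_sphere_bounded_mult[OF gi[OF that(1)] that(2,3)] by (simp add: mult.commute)
  have \<rho>m [measurable]: "\<rho> \<in> borel_measurable sphere_area" unfolding \<rho>_def[abs_def] by measurable
  have \<rho>0: "0 \<le> \<rho> x" for x unfolding \<rho>_def using g0 by (intro divide_nonneg_nonneg sum_nonneg) auto
  define B where "B = (\<Sum>i<N. exp (2 * b) / partition_function u (E i)) / N"
  have \<rho>B: "\<rho> x \<le> B" for x unfolding \<rho>_def B_def using gle by (intro divide_right_mono sum_mono) auto
  have bound: "2 * (\<integral>y. \<rho> y * (\<integral>x. approximate_identity a (x \<bullet> y) * u x \<partial>sphere_area) \<partial>sphere_area)
      \<le> A * G2 + (\<Sum>i<N. S i) / N + (c + s * N * D)" if a: "a \<in> {1<..<2}" for a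
  proof -
    have a: "1 < a" "a \<le> 2" using a by auto
    obtain C where C: "\<And>x y :: real^3. norm x = 1 \<Longrightarrow> norm y = 1 \<Longrightarrow> \<bar>log_kernel a (x \<bullet> y)\<bar> \<le> C"
      using log_kernel_bounded[OF a(1)] by blast
    define W where "W i y = (\<integral>z. g i z * log_kernel a (y \<bullet> z) \<partial>sphere_area)" for i y
    have Wm [measurable]: "W i \<in> borel_measurable sphere_area" if "i < N" for i
      unfolding W_def[abs_def] using gm[OF that] by measurable
    have ki: "integrable sphere_area (\<lambda>z. g i z * log_kernel a (y \<bullet> z))" if "i < N" "norm y = 1" for i y
      using C[OF that(2)] by (intro gmult that) auto
    have W_bound: "\<bar>W i y\<bar> \<le> C" if i: "i < N" and y: "norm y = 1" for i y
    proof -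
      have "\<bar>W i y\<bar> \<le> (\<integral>z. norm (g i z * log_kernel a (y \<bullet> z)) \<partial>sphere_area)"
        unfolding W_def real_norm_def[symmetric] by (rule integral_norm_bound)
      also have "\<dots> \<le> (\<integral>z. g i z * C \<partial>sphere_area)"
        using ki[OF i y] gi[OF i] g0[OF i] C[OF y] by (intro integral_mono integrable_norm) (auto simp: abs_mult intro!: mult_left_mono)
      finally show ?thesis using g1[OF i] by simp
    qed
    have gW: "integrable sphere_area (\<lambda>y. g i y * W j y)" if "i < N" "j < N" for i j
      using that W_bound by (intro gmult) auto
    have diag: "(\<integral>y. g i y * W i y \<partial>sphere_area) \<le> (S i + c) / s" if i: "i < N" for i
    proof -
      have "(\<integral>y. g i y * W i y \<partial>sphere_area) \<le> (\<integral>y. g i y * ((S i + c) / s) \<partial>sphere_area)"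
      proof (rule integral_mono[OF gW[OF i i]])
        fix y assume "y \<in> space sphere_area"
        then have "W i y \<le> (S i + c) / s"
          unfolding W_def g_def S_def c_def
          using gibbs_log_kernel_le[OF um E[OF i] b[OF i] Z[OF i] _ a s, of y] by simp
        then show "g i y * W i y \<le> g i y * ((S i + c) / s)" using g0[OF i] by (rule mult_left_mono)
      qed (use gi[OF i] in simp)
      also have "\<dots> = (\<integral>y. g i y \<partial>sphere_area) * ((S i + c) / s)" by (rule integral_mult_left_zero)
      finally show ?thesis using g1[OF i] by simp
    qed
    have off: "(\<integral>y. g i y * W j y \<partial>sphere_area) \<le> D" if i: "i < N" and j: "j < N" and ij: "i \<noteq> j" for i j
    proof -
      have "(\<integral>y. g i y * W j y \<partial>sphere_area) \<le> (\<integral>y. g i y * D \<partial>sphere_area)"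
      proof (rule integral_mono[OF gW[OF i j]])
        fix y assume "y \<in> space sphere_area"
        then have y: "norm y = 1" by simp
        show "g i y * W j y \<le> g i y * D"
        proof (cases "y \<in> E i")
          case True
          have "W j y \<le> (\<integral>z. g j z * D \<partial>sphere_area)"
            unfolding W_def
          proof (rule integral_mono[OF ki[OF j y]])
            fix z assume "z \<in> space sphere_area"
            then have z: "norm z = 1" by simp
            show "g j z * log_kernel a (y \<bullet> z) \<le> g j z * D"
            proof (cases "z \<in> E j")
              case zE: True
              show ?thesis unfolding D_def
                by (intro mult_left_mono g0[OF j] log_kernel_separated_le y z \<delta>(1) sep[OF i j ij True zE] a(1))
            qed (simp add: gE)
          qed (use gi[OF j] in simp)
          then have "W j y \<le> D" using g1[OF j] by simp
          then show ?thesis using g0[OF i] by (rule mult_left_mono)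
        qed (simp add: gE)
      qed (use gi[OF i] in simp)
      then show ?thesis using g1[OF i] by simp
    qed
    have pot: "(\<integral>z. \<rho> z * log_kernel a (y \<bullet> z) \<partial>sphere_area) = (\<Sum>j<N. W j y) / N" if y: "norm y = 1" for y
    proof -
      have "(\<integral>z. \<rho> z * log_kernel a (y \<bullet> z) \<partial>sphere_area) = (\<integral>z. (\<Sum>j<N. g j z * log_kernel a (y \<bullet> z)) / N \<partial>sphere_area)"
        by (simp add: \<rho>_def sum_distrib_right)
      also have "\<dots> = (\<Sum>j<N. W j y) / N"
        unfolding integral_divide_zero W_def using ki[OF _ y] by (subst Bochner_Integration.integral_sum) auto
      finally show ?thesis .
    qed
    have "(\<integral>y. \<rho> y * (\<integral>z. \<rho> z * log_kernel a (y \<bullet> z) \<partial>sphere_area) \<partial>sphere_area)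
        = (\<integral>y. (\<Sum>i<N. \<Sum>j<N. g i y * W j y) / (real N)\<^sup>2 \<partial>sphere_area)"
      proof (rule Bochner_Integration.integral_cong)
      fix y assume "y \<in> space sphere_area"
      then show "\<rho> y * (\<integral>z. \<rho> z * log_kernel a (y \<bullet> z) \<partial>sphere_area) = (\<Sum>i<N. \<Sum>j<N. g i y * W j y) / (real N)\<^sup>2"
        by (subst pot) (simp_all add: \<rho>_def sum_product power2_eq_square)
    qed simp
    also have "\<dots> = (\<Sum>i<N. \<Sum>j<N. (\<integral>y. g i y * W j y \<partial>sphere_area)) / (real N)\<^sup>2"
      unfolding integral_divide_zero using gW
      by (subst Bochner_Integration.integral_sum, force) (auto intro!: arg_cong2[where f = divide] sum.cong Bochner_Integration.integral_sum)
    also have "\<dots> \<le> (\<Sum>i<N. (S i + c) / s + N * D) / (real N)\<^sup>2"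
    proof (intro divide_right_mono sum_mono)
      fix i assume "i \<in> {..<N}"
      then have i: "i < N" by simp
      have "(\<Sum>j<N. (\<integral>y. g i y * W j y \<partial>sphere_area)) \<le> (\<Sum>j<N. (if j = i then (S i + c) / s else 0) + D)"
        using diag[OF i] off[OF i] D by (intro sum_mono) (auto intro: order_trans)
      also have "\<dots> = (S i + c) / s + N * D" using i by (simp add: sum.distrib)
      finally show "(\<Sum>j<N. (\<integral>y. g i y * W j y \<partial>sphere_area)) \<le> (S i + c) / s + N * D" .
    qed simp
    finally have Q: "(\<integral>y. \<rho> y * (\<integral>z. \<rho> z * log_kernel a (y \<bullet> z) \<partial>sphere_area) \<partial>sphere_area)
        \<le> (\<Sum>i<N. (S i + c) / s + N * D) / (real N)\<^sup>2" .
    have "2 * (\<integral>y. \<rho> y * (\<integral>x. approximate_identity a (x \<bullet> y) * u x \<partial>sphere_area) \<partial>sphere_area)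
      \<le> A * G2 + (\<integral>y. \<rho> y * (\<integral>z. \<rho> z * log_kernel a (y \<bullet> z) \<partial>sphere_area) \<partial>sphere_area) / (4 * pi * A)"
      unfolding G2_def by (rule mollified_pairing_le_energy[OF u G mean \<rho>m \<rho>0 \<rho>B a A])
    also have "\<dots> \<le> A * G2 + (\<Sum>i<N. (S i + c) / s + N * D) / (real N)\<^sup>2 / (4 * pi * A)"
      using A Q by (intro add_left_mono divide_right_mono) auto
    also have "(\<Sum>i<N. (S i + c) / s + N * D) = (\<Sum>i<N. S i) / s + N * (c / s) + N * (N * D)"
      by (simp add: sum.distrib add_divide_distrib sum_divide_distrib)
    \<comment> \<open>The choice of \<open>A\<close> gives the entropies the same weight \<open>1/N\<close> as in the Gibbs identity.\<close>
    also have "\<dots> / (real N)\<^sup>2 / (4 * pi * A) = (\<Sum>i<N. S i) / N + (c + s * N * D)"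
      using N s by (simp add: A_def power2_eq_square field_simps)
    finally show ?thesis by simp
  qed
  have "((\<lambda>a. 2 * (\<integral>y. \<rho> y * (\<integral>x. approximate_identity a (x \<bullet> y) * u x \<partial>sphere_area) \<partial>sphere_area))
      \<longlongrightarrow> 2 * (\<integral>y. \<rho> y * u y \<partial>sphere_area)) (at_right 1)"
    using \<rho>0 \<rho>B by (intro tendsto_mult_left tendsto_mollified_pairing[OF ui \<rho>m, of B]) simp
  then have "2 * (\<integral>y. \<rho> y * u y \<partial>sphere_area) \<le> A * G2 + (\<Sum>i<N. S i) / N + (c + s * N * D)"
    by (rule tendsto_upperbound) (use bound in \<open>auto intro!: eventually_at_rightI[of 1 2]\<close>)
  moreover have "2 * (\<integral>y. \<rho> y * u y \<partial>sphere_area) = (\<Sum>i<N. S i + ln (partition_function u (E i))) / N"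
  proof -
    have "(\<integral>y. \<rho> y * u y \<partial>sphere_area) = (\<integral>y. (\<Sum>i<N. g i y * u y) / N \<partial>sphere_area)"
      by (simp add: \<rho>_def sum_distrib_right)
    also have "\<dots> = (\<Sum>i<N. (\<integral>y. g i y * u y \<partial>sphere_area)) / N"
      unfolding integral_divide_zero using gu by (subst Bochner_Integration.integral_sum) auto
    finally show ?thesis by (simp add: S_def gibbs_entropy_def g_def sum_distrib_left)
  qed
  ultimately show ?thesis
    by (simp add: sum.distrib add_divide_distrib G2_def A_def c_def D_def)
qed

lemma integral_sphere_pos:
  fixes f :: "real^3 \<Rightarrow> real"
  assumes f: "integrable sphere_area f" and pos: "\<And>x. 0 < f x"
  shows "0 < (\<integral>x. f x \<partial>sphere_area)"
proof (rule ccontr)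
  assume "\<not> 0 < (\<integral>x. f x \<partial>sphere_area)"
  moreover have "0 \<le> (\<integral>x. f x \<partial>sphere_area)" using pos by (intro integral_nonneg_AE AE_I2) (simp add: less_imp_le)
  ultimately have "(\<integral>x. f x \<partial>sphere_area) = 0" by linarith
  then have "AE x in sphere_area. f x = 0"
    using f pos by (subst (asm) integral_nonneg_eq_0_iff_AE) (auto simp: less_imp_le)
  then have "AE x in sphere_area. False" by (rule AE_mp) (use pos in \<open>auto simp: less_le\<close>)
  then have "ae_filter sphere_area = bot" by (simp only: eventually_False)
  then have "emeasure sphere_area (space sphere_area) = 0" by (simp only: ae_filter_eq_bot_iff)
  then show False by (simp add: emeasure_sphere_area_space)
qed

text \<open>
  The case of a single set. On the sets where \<open>|u| \<le> n\<close> the partition functions are bounded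
  independently of \<open>n\<close>, and monotone convergence gives the claim; the value \<open>s = 1/2\<close> is arbitrary.
\<close>

theorem integrable_exp_sphere_H1:
  assumes u: "sphere_L2 u" and G: "is_weak_gradient u G" and mean: "(\<integral>x. u x \<partial>sphere_area) = 0"
  shows "integrable sphere_area (\<lambda>x. exp (2 * u x))"
proof -
  have um [measurable]: "u \<in> borel_measurable sphere_area" using u by (simp add: sphere_L2_def)
  define E where "E n = {x \<in> space sphere_area. \<bar>u x\<bar> \<le> real n}" for n
  have E [measurable]: "E n \<in> sets sphere_area" for n unfolding E_def by measurable
  define K where "K = 1 / (4 * pi * (1 / 2)) * (\<integral>x. (norm (G x))\<^sup>2 \<partial>sphere_area) + (5 * (1 / 2) + ln (7 * pi / (1 - 1 / 2)) + (1 / 2) * (5 - 2 * ln 1))"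
  have Z_le: "partition_function u (E n) \<le> exp K" for n
  proof (cases "0 < partition_function u (E n)")
    case True
    have "(\<Sum>i<(1::nat). ln (partition_function u (E n))) / real 1
      \<le> 1 / (4 * pi * real 1 * (1 / 2)) * (\<integral>x. (norm (G x))\<^sup>2 \<partial>sphere_area)
      + (5 * (1 / 2) + ln (7 * pi / (1 - 1 / 2)) + (1 / 2) * real 1 * (5 - 2 * ln 1))"
    proof (rule separated_moser_trudinger_truncated[OF u G mean, where N = 1 and E = "\<lambda>_. E n" and b = "real n" and \<delta> = 1 and s = "1 / 2"])
      show "\<bar>u x\<bar> \<le> real n" if "x \<in> E n" for x using that by (simp add: E_def)
    qed (use True in auto)
    then have "ln (partition_function u (E n)) \<le> K" by (simp add: K_def)
    then have "exp (ln (partition_function u (E n))) \<le> exp K" by simp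
    then show ?thesis using True by simp
  next
    case False
    then show ?thesis using exp_gt_zero[of K] by linarith
  qed
  have int: "integrable sphere_area (\<lambda>x. indicator (E n) x * exp (2 * u x))" for n
    by (rule integrable_sphere_bounded[of _ "exp (2 * real n)"]) (auto simp: E_def indicator_def abs_le_iff)
  have inc: "indicator (E m) x * exp (2 * u x) \<le> indicator (E n) x * exp (2 * u x)" if "m \<le> n" for m n x
    using that by (auto simp: E_def indicator_def)
  have incZ: "incseq (\<lambda>n. partition_function u (E n))"
    unfolding partition_function_def by (intro incseq_SucI integral_mono int inc) simp
  obtain L where L: "(\<lambda>n. partition_function u (E n)) \<longlonglongrightarrow> L"
    using incseq_convergent[OF incZ, of "exp K"] Z_le by blast
  show ?thesis
  proof (rule integrable_monotone_convergence[OF int])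
    show "AE x in sphere_area. mono (\<lambda>n. indicator (E n) x * exp (2 * u x))"
      using inc by (intro AE_I2 monoI)
    show "AE x in sphere_area. (\<lambda>n. indicator (E n) x * exp (2 * u x)) \<longlonglongrightarrow> exp (2 * u x)"
    proof (rule AE_I2)
      fix x assume x: "x \<in> space sphere_area"
      obtain m :: nat where m: "\<bar>u x\<bar> \<le> real m" using real_arch_simple by blast
      have "indicator (E n) x * exp (2 * u x) = exp (2 * u x)" if "m \<le> n" for n
        using that m x by (auto simp: E_def indicator_def)
      then show "(\<lambda>n. indicator (E n) x * exp (2 * u x)) \<longlonglongrightarrow> exp (2 * u x)"
        by (intro tendsto_eventually eventually_sequentiallyI[of m])
    qed
    show "(\<lambda>n. \<integral>x. indicator (E n) x * exp (2 * u x) \<partial>sphere_area) \<longlonglongrightarrow> L"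
      using L by (simp add: partition_function_def)
  qed measurable
qed

text \<open>
  Separation into \<open>N\<close> pieces divides the constant \<open>1/(4 \<pi>)\<close> of the Moser-Trudinger inequality
  by \<open>N\<close>. The proof lets the truncation level of \<open>separated_moser_trudinger_truncated\<close> tend to infinity.
\<close>

theorem separated_moser_trudinger:
  fixes E :: "nat \<Rightarrow> (real^3) set"
  assumes u: "sphere_L2 u" and G: "is_weak_gradient u G" and mean: "(\<integral>x. u x \<partial>sphere_area) = 0"
    and N: "0 < N" and E: "\<And>i. i < N \<Longrightarrow> E i \<in> sets sphere_area"
    and Z: "\<And>i. i < N \<Longrightarrow> 0 < partition_function u (E i)"
    and sep: "\<And>i j x y. i < N \<Longrightarrow> j < N \<Longrightarrow> i \<noteq> j \<Longrightarrow> x \<in> E i \<Longrightarrow> y \<in> E j \<Longrightarrow> \<delta> \<le> norm (x - y)"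
    and \<delta>: "0 < \<delta>" "\<delta> \<le> 1" and s: "0 < s" "s < 1"
  shows "(\<Sum>i<N. ln (partition_function u (E i))) / N
    \<le> 1 / (4 * pi * N * s) * (\<integral>x. (norm (G x))\<^sup>2 \<partial>sphere_area)
      + (5 * s + ln (7 * pi / (1 - s)) + s * N * (5 - 2 * ln \<delta>))"
proof -
  have um [measurable]: "u \<in> borel_measurable sphere_area" using u by (simp add: sphere_L2_def)
  have int: "integrable sphere_area (\<lambda>x. exp (2 * u x))" by (rule integrable_exp_sphere_H1[OF u G mean])
  define T where "T i n = {x \<in> E i. \<bar>u x\<bar> \<le> real n}" for i n
  have T: "T i n \<in> sets sphere_area" if "i < N" for i n
  proof -
    have "E i \<inter> {x \<in> space sphere_area. \<bar>u x\<bar> \<le> real n} \<in> sets sphere_area"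
      using E[OF that] by measurable
    moreover have "T i n = E i \<inter> {x \<in> space sphere_area. \<bar>u x\<bar> \<le> real n}"
      using sets.sets_into_space[OF E[OF that]] by (auto simp: T_def)
    ultimately show ?thesis by simp
  qed
  have lim: "(\<lambda>n. partition_function u (T i n)) \<longlonglongrightarrow> partition_function u (E i)" if i: "i < N" for i
    unfolding partition_function_def
  proof (rule integral_dominated_convergence[where w = "\<lambda>x. exp (2 * u x)"])
    show "(\<lambda>x. indicator (E i) x * exp (2 * u x)) \<in> borel_measurable sphere_area"
      using E[OF i] by measurable
    show "(\<lambda>x. indicator (T i n) x * exp (2 * u x)) \<in> borel_measurable sphere_area" for n
      using T[OF i] by measurable
    show "AE x in sphere_area. norm (indicator (T i n) x * exp (2 * u x)) \<le> exp (2 * u x)" for n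
      by (intro AE_I2) (simp add: indicator_def)
    show "AE x in sphere_area. (\<lambda>n. indicator (T i n) x * exp (2 * u x)) \<longlonglongrightarrow> indicator (E i) x * exp (2 * u x)"
    proof (rule AE_I2)
      fix x
      obtain m :: nat where m: "\<bar>u x\<bar> \<le> real m" using real_arch_simple by blast
      have "indicator (T i n) x * exp (2 * u x) = indicator (E i) x * exp (2 * u x)" if "m \<le> n" for n
        using that m by (auto simp: T_def indicator_def)
      then show "(\<lambda>n. indicator (T i n) x * exp (2 * u x)) \<longlonglongrightarrow> indicator (E i) x * exp (2 * u x)"
        by (intro tendsto_eventually eventually_sequentiallyI[of m])
    qed
  qed (rule int)
  have "(\<lambda>n. (\<Sum>i<N. ln (partition_function u (T i n))) / N) \<longlonglongrightarrow> (\<Sum>i<N. ln (partition_function u (E i))) / N"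
  proof (intro tendsto_divide tendsto_sum tendsto_ln tendsto_const)
    fix i assume "i \<in> {..<N}"
    then have i: "i < N" by simp
    show "(\<lambda>n. partition_function u (T i n)) \<longlonglongrightarrow> partition_function u (E i)" by (rule lim[OF i])
    show "partition_function u (E i) \<noteq> 0" using Z[OF i] by simp
  qed (use N in simp)
  moreover have "\<forall>\<^sub>F n in sequentially. \<forall>i\<in>{..<N}. 0 < partition_function u (T i n)"
  proof (intro eventually_ball_finite ballI)
    fix i assume "i \<in> {..<N}"
    then show "\<forall>\<^sub>F n in sequentially. 0 < partition_function u (T i n)"
      using order_tendstoD(1)[OF lim Z] by simp
  qed simp
  then have "\<forall>\<^sub>F n in sequentially. (\<Sum>i<N. ln (partition_function u (T i n))) / N
    \<le> 1 / (4 * pi * N * s) * (\<integral>x. (norm (G x))\<^sup>2 \<partial>sphere_area)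
      + (5 * s + ln (7 * pi / (1 - s)) + s * N * (5 - 2 * ln \<delta>))"
  proof eventually_elim
    case (elim n)
    show ?case
    proof (rule separated_moser_trudinger_truncated[OF u G mean N])
      show "T i n \<in> sets sphere_area" if "i < N" for i by (rule T[OF that])
      show "\<bar>u x\<bar> \<le> real n" if "x \<in> T i n" for i x using that by (simp add: T_def)
      show "0 < partition_function u (T i n)" if "i < N" for i using elim that by simp
      show "\<delta> \<le> norm (x - y)" if "i < N" "j < N" "i \<noteq> j" "x \<in> T i n" "y \<in> T j n" for i j x y
        using sep that by (simp add: T_def)
    qed (use \<delta> s in auto)
  qed
  ultimately show ?thesis by (intro tendsto_upperbound) auto
qed

section \<open>Vanishing second moments spread the mass over four caps\<close>

lemma polynomials_le_add:
  assumes "p \<in> polynomials_le d" "q \<in> polynomials_le d"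
  shows "(\<lambda>x. p x + q x) \<in> polynomials_le d"
proof -
  obtain b c where "p = (\<lambda>x. \<Sum>\<alpha> | (\<Sum>i\<in>UNIV. \<alpha> i) \<le> d. b \<alpha> * (\<Prod>i\<in>UNIV. x $ i ^ \<alpha> i))"
    "q = (\<lambda>x. \<Sum>\<alpha> | (\<Sum>i\<in>UNIV. \<alpha> i) \<le> d. c \<alpha> * (\<Prod>i\<in>UNIV. x $ i ^ \<alpha> i))"
    using assms unfolding polynomials_le_def by blast
  then show ?thesis unfolding polynomials_le_def
    by (intro CollectI exI[of _ "\<lambda>\<alpha>. b \<alpha> + c \<alpha>"]) (simp add: distrib_right sum.distrib)
qed

lemma polynomials_le_cmult:
  assumes "p \<in> polynomials_le d" shows "(\<lambda>x. k * p x) \<in> polynomials_le d"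
proof -
  obtain c where "p = (\<lambda>x. \<Sum>\<alpha> | (\<Sum>i\<in>UNIV. \<alpha> i) \<le> d. c \<alpha> * (\<Prod>i\<in>UNIV. x $ i ^ \<alpha> i))"
    using assms unfolding polynomials_le_def by blast
  then show ?thesis unfolding polynomials_le_def
    by (intro CollectI exI[of _ "\<lambda>\<alpha>. k * c \<alpha>"]) (simp add: sum_distrib_left mult.assoc)
qed

lemma polynomials_le_sum:
  assumes "finite I" "I \<noteq> {}" "\<And>i. i \<in> I \<Longrightarrow> p i \<in> polynomials_le d"
  shows "(\<lambda>x. \<Sum>i\<in>I. p i x) \<in> polynomials_le d"
  using assms
proof (induction I rule: finite_ne_induct)
  case (insert i I)
  then show ?case using polynomials_le_add[of "p i" d "\<lambda>x. \<Sum>i\<in>I. p i x"] by simp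
qed simp

lemma monomial_in_polynomials_le:
  assumes "(\<Sum>i\<in>UNIV. \<alpha> i) \<le> d"
  shows "(\<lambda>x. \<Prod>i\<in>UNIV. x $ i ^ \<alpha> i) \<in> polynomials_le d"
proof -
  have "(\<Sum>\<beta> | (\<Sum>i\<in>UNIV. \<beta> i) \<le> d. (if \<beta> = \<alpha> then 1 else 0) * (\<Prod>i\<in>UNIV. x $ i ^ \<beta> i))
      = (\<Sum>\<beta> | (\<Sum>i\<in>UNIV. \<beta> i) \<le> d. if \<beta> = \<alpha> then (\<Prod>i\<in>UNIV. x $ i ^ \<beta> i) else 0)" for x :: "real^3"
    by (intro sum.cong) auto
  also have "\<dots> x = (\<Prod>i\<in>UNIV. x $ i ^ \<alpha> i)" for x :: "real^3"
    using assms finite_multi_indices[of d] by (subst sum.delta) auto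
  finally show ?thesis unfolding polynomials_le_def
    by (intro CollectI exI[of _ "\<lambda>\<beta>. if \<beta> = \<alpha> then 1 else 0"]) simp
qed

lemma quadratic_in_polynomials_le: "(\<lambda>x. (x \<bullet> w - c)\<^sup>2 - k) \<in> polynomials_le 2"
proof -
  define \<delta> :: "3 \<Rightarrow> 3 \<Rightarrow> nat" where "\<delta> j i = of_bool (i = j)" for i j
  have sum_\<delta>: "(\<Sum>i\<in>UNIV. \<delta> j i) = 1" for j by (simp add: \<delta>_def of_bool_def)
  have prod_\<delta>: "(\<Prod>i\<in>UNIV. x $ i ^ \<delta> j i) = x $ j" for x :: "real^3" and j
  proof -
    have "(\<Prod>i\<in>UNIV. x $ i ^ \<delta> j i) = (\<Prod>i\<in>UNIV. if i = j then x $ i else 1)"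
      by (intro prod.cong) (auto simp: \<delta>_def)
    then show ?thesis by simp
  qed
  have one: "(\<lambda>x. 1) \<in> polynomials_le 2"
    using monomial_in_polynomials_le[of "\<lambda>_. 0" 2] by simp
  have lin: "(\<lambda>x. x $ j) \<in> polynomials_le 2" for j
    using monomial_in_polynomials_le[of "\<delta> j" 2] by (simp add: sum_\<delta> prod_\<delta>)
  have quad: "(\<lambda>x. x $ i * x $ j) \<in> polynomials_le 2" for i j
    using monomial_in_polynomials_le[of "\<lambda>l. \<delta> i l + \<delta> j l" 2]
    by (simp add: sum.distrib sum_\<delta> power_add prod.distrib prod_\<delta>)
  have "(\<lambda>x. (\<Sum>i\<in>UNIV. \<Sum>j\<in>UNIV. (w $ i * w $ j) * (x $ i * x $ j))
       + ((\<Sum>i\<in>UNIV. (- 2 * c * w $ i) * x $ i) + (c\<^sup>2 - k) * 1)) \<in> polynomials_le 2"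
    by (intro polynomials_le_add polynomials_le_sum polynomials_le_cmult one lin quad) auto
  moreover have "(\<Sum>i\<in>UNIV. \<Sum>j\<in>UNIV. (w $ i * w $ j) * (x $ i * x $ j))
       + ((\<Sum>i\<in>UNIV. (- 2 * c * w $ i) * x $ i) + (c\<^sup>2 - k) * 1) = (x \<bullet> w - c)\<^sup>2 - k" for x
  proof -
    have "x \<bullet> w = (\<Sum>i\<in>UNIV. w $ i * x $ i)" by (simp add: inner_vec_def mult.commute)
    moreover have "(\<Sum>i\<in>UNIV. w $ i * x $ i) * (\<Sum>i\<in>UNIV. w $ i * x $ i) = (\<Sum>i\<in>UNIV. \<Sum>j\<in>UNIV. (w $ i * w $ j) * (x $ i * x $ j))"
      unfolding sum_product by (simp add: mult_ac)
    moreover have "(\<Sum>i\<in>UNIV. (- 2 * c * w $ i) * x $ i) = - 2 * c * (\<Sum>i\<in>UNIV. w $ i * x $ i)"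
      by (simp add: sum_distrib_left mult.assoc)
    ultimately show ?thesis by (simp add: power2_eq_square algebra_simps)
  qed
  ultimately show ?thesis by (simp only:)
qed

text \<open>
  The polynomial \<open>(x \<bullet> w - c)\<^sup>2\<close> minus its spherical mean \<open>1/3 + c\<^sup>2\<close> is an admissible test polynomial.
\<close>

lemma quadratic_moment:
  assumes int: "integrable sphere_area (\<lambda>x. exp (2 * u x))" and um [measurable]: "u \<in> borel_measurable sphere_area"
    and design: "\<forall>p \<in> mean_zero_polynomials_le 2. (\<integral>x. p x * exp (2 * u x) \<partial>sphere_area) = 0"
    and w: "norm w = 1"
  shows "integrable sphere_area (\<lambda>x. (x \<bullet> w - c)\<^sup>2 * exp (2 * u x))"
    and "(\<integral>x. (x \<bullet> w - c)\<^sup>2 * exp (2 * u x) \<partial>sphere_area) = (1 / 3 + c\<^sup>2) * (\<integral>x. exp (2 * u x) \<partial>sphere_area)"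
proof -
  let ?k = "1 / 3 + c\<^sup>2"
  have le: "\<bar>(x \<bullet> w - c)\<^sup>2\<bar> \<le> (1 + \<bar>c\<bar>)\<^sup>2" if "norm x = 1" for x
  proof -
    have "\<bar>x \<bullet> w - c\<bar> \<le> \<bar>1 + \<bar>c\<bar>\<bar>" using sphere_inner_le[of x w] that w by auto
    then have "(x \<bullet> w - c)\<^sup>2 \<le> (1 + \<bar>c\<bar>)\<^sup>2" unfolding abs_le_square_iff .
    then show ?thesis by simp
  qed
  show int2: "integrable sphere_area (\<lambda>x. (x \<bullet> w - c)\<^sup>2 * exp (2 * u x))"
    by (rule integrable_sphere_bounded_mult[OF int _ le]) measurable
  have "integrable sphere_area (\<lambda>x. (x \<bullet> w - c)\<^sup>2)"
    by (rule integrable_sphere_bounded[of _ "(1 + \<bar>c\<bar>)\<^sup>2"]) (use le in auto)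
  then have "(\<integral>x. (x \<bullet> w - c)\<^sup>2 - ?k \<partial>sphere_area) = 0"
    by (simp add: integral_sphere_inner_quadratic[OF w])
  then have "(\<lambda>x. (x \<bullet> w - c)\<^sup>2 - ?k) \<in> mean_zero_polynomials_le 2"
    using quadratic_in_polynomials_le by (simp add: mean_zero_polynomials_le_def)
  from bspec[OF design this] have "(\<integral>x. ((x \<bullet> w - c)\<^sup>2 - ?k) * exp (2 * u x) \<partial>sphere_area) = 0" .
  also have "(\<lambda>x. ((x \<bullet> w - c)\<^sup>2 - ?k) * exp (2 * u x)) = (\<lambda>x. (x \<bullet> w - c)\<^sup>2 * exp (2 * u x) - ?k * exp (2 * u x))"
    by (simp add: left_diff_distrib)
  finally show "(\<integral>x. (x \<bullet> w - c)\<^sup>2 * exp (2 * u x) \<partial>sphere_area) = ?k * (\<integral>x. exp (2 * u x) \<partial>sphere_area)"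
    using int int2 by simp
qed

lemma plane_through_three_points:
  fixes y1 y2 y3 :: "real^3"
  obtains w c where "norm w = 1" "y1 \<bullet> w = c" "y2 \<bullet> w = c" "y3 \<bullet> w = c"
proof -
  have "dim {y2 - y1, y3 - y1} \<le> card {y2 - y1, y3 - y1}" by (rule dim_le_card') simp
  also have "\<dots> \<le> 2" by (simp add: card_insert_if)
  finally have "dim {y2 - y1, y3 - y1} < DIM(real^3)" by simp
  then obtain v where v: "v \<noteq> 0" "\<And>y. y \<in> span {y2 - y1, y3 - y1} \<Longrightarrow> orthogonal v y"
    using orthogonal_to_subspace_exists by blast
  have "v \<bullet> (y2 - y1) = 0" "v \<bullet> (y3 - y1) = 0"
    using v(2)[OF span_base] by (simp_all add: orthogonal_def)
  then have "y2 \<bullet> sgn v = y1 \<bullet> sgn v" "y3 \<bullet> sgn v = y1 \<bullet> sgn v"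
    by (simp_all add: sgn_div_norm inner_simps inner_commute[of v])
  then show ?thesis using v(1) by (intro that[of "sgn v" "y1 \<bullet> sgn v"]) (simp_all add: norm_sgn)
qed

text \<open>
  In the plane \<open>x \<bullet> w = c\<close> through the three points the function \<open>(x \<bullet> w - c)\<^sup>2\<close> vanishes. It is at most
  \<open>9/100\<close> within distance \<open>3/10\<close> of the points and at most \<open>4\<close> on the sphere, while its mean is at least
  \<open>1/3\<close>; so the far region carries at least \<open>(1/3 - 9/100)/4 > 1/20\<close> of the mass.
\<close>

lemma mass_away_from_three_points:
  fixes y1 y2 y3 :: "real^3"
  assumes int: "integrable sphere_area (\<lambda>x. exp (2 * u x))" and um [measurable]: "u \<in> borel_measurable sphere_area"
    and design: "\<forall>p \<in> mean_zero_polynomials_le 2. (\<integral>x. p x * exp (2 * u x) \<partial>sphere_area) = 0"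
    and y: "norm y1 = 1"
  defines "F \<equiv> {x \<in> space sphere_area. 3 / 10 \<le> norm (x - y1) \<and> 3 / 10 \<le> norm (x - y2) \<and> 3 / 10 \<le> norm (x - y3)}"
  shows "(\<integral>x. exp (2 * u x) \<partial>sphere_area) / 20 \<le> partition_function u F"
proof -
  obtain w c where w: "norm w = 1" "y1 \<bullet> w = c" "y2 \<bullet> w = c" "y3 \<bullet> w = c"
    by (rule plane_through_three_points)
  have c: "\<bar>c\<bar> \<le> 1" using sphere_inner_le[of y1 w] y w(1,2) by auto
  have F [measurable]: "F \<in> sets sphere_area" unfolding F_def by measurable
  define Z where "Z = (\<integral>x. exp (2 * u x) \<partial>sphere_area)"
  have Z: "0 \<le> Z" unfolding Z_def by (intro integral_nonneg_AE AE_I2) simp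
  have intF: "integrable sphere_area (\<lambda>x. indicator F x * exp (2 * u x))"
    by (rule integrable_sphere_bounded_mult[OF int, of _ 1]) (auto simp: indicator_def)
  note mom = quadratic_moment[OF int um design w(1), of c]
  have near: "(x \<bullet> w - c)\<^sup>2 \<le> 9 / 100" if "norm (x - y) < 3 / 10" "y \<bullet> w = c" for x y
  proof -
    have "\<bar>(x - y) \<bullet> w\<bar> \<le> norm (x - y) * norm w" by (rule Cauchy_Schwarz_ineq2)
    then have "\<bar>x \<bullet> w - c\<bar> \<le> \<bar>3 / 10\<bar>" using that w(1) by (simp add: inner_simps)
    then have "(x \<bullet> w - c)\<^sup>2 \<le> (3 / 10)\<^sup>2" unfolding abs_le_square_iff .
    then show ?thesis by (simp add: power2_eq_square)
  qed
  have "(1 / 3 + c\<^sup>2) * Z = (\<integral>x. (x \<bullet> w - c)\<^sup>2 * exp (2 * u x) \<partial>sphere_area)"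
    unfolding Z_def by (rule mom(2)[symmetric])
  also have "\<dots> \<le> (\<integral>x. 9 / 100 * exp (2 * u x) + 4 * (indicator F x * exp (2 * u x)) \<partial>sphere_area)"
  proof (rule integral_mono[OF mom(1)])
    fix x assume x: "x \<in> space sphere_area"
    have "(x \<bullet> w - c)\<^sup>2 \<le> 9 / 100 + 4 * indicator F x"
    proof (cases "x \<in> F")
      case True
      have "\<bar>x \<bullet> w - c\<bar> \<le> \<bar>2\<bar>" using sphere_inner_le[of x w] x w(1) c by auto
      then have "(x \<bullet> w - c)\<^sup>2 \<le> 2\<^sup>2" unfolding abs_le_square_iff .
      then show ?thesis using True by simp
    next
      case False
      then have "(x \<bullet> w - c)\<^sup>2 \<le> 9 / 100"
        using x near[of x y1] near[of x y2] near[of x y3] w by (auto simp: F_def not_le)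
      then show ?thesis using False by simp
    qed
    then have "(x \<bullet> w - c)\<^sup>2 * exp (2 * u x) \<le> (9 / 100 + 4 * indicator F x) * exp (2 * u x)"
      by (intro mult_right_mono) auto
    then show "(x \<bullet> w - c)\<^sup>2 * exp (2 * u x) \<le> 9 / 100 * exp (2 * u x) + 4 * (indicator F x * exp (2 * u x))"
      by (simp add: distrib_right)
  qed (use int intF in auto)
  also have "\<dots> = 9 / 100 * Z + 4 * partition_function u F"
    using int intF by (simp add: Z_def partition_function_def)
  finally have "(1 / 3 + c\<^sup>2) * Z \<le> 9 / 100 * Z + 4 * partition_function u F" .
  moreover have "1 / 3 * Z \<le> (1 / 3 + c\<^sup>2) * Z" using Z by (intro mult_right_mono) auto
  ultimately have "Z / 20 \<le> partition_function u F" using Z by simp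
  then show ?thesis unfolding Z_def .
qed

text \<open>
  One of the finitely many caps of the cover carries its share of the mass of the far region. It meets
  that region, so its centre has distance at least \<open>3/10 - 1/20 = 1/4\<close> from the three points. The
  cover does not depend on \<open>u\<close>, hence neither does the fraction of the mass.
\<close>

lemma heavy_cap_away_from_three_points:
  fixes y1 y2 y3 :: "real^3"
  assumes cover: "finite K" "sphere 0 1 \<subseteq> (\<Union>f\<in>K. ball f (1 / 20))"
    and int: "integrable sphere_area (\<lambda>x. exp (2 * u x))" and um [measurable]: "u \<in> borel_measurable sphere_area"
    and design: "\<forall>p \<in> mean_zero_polynomials_le 2. (\<integral>x. p x * exp (2 * u x) \<partial>sphere_area) = 0"
    and y: "norm y1 = 1"
  obtains f where "f \<in> K" "1 / 4 \<le> norm (f - y1)" "1 / 4 \<le> norm (f - y2)" "1 / 4 \<le> norm (f - y3)"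
    "(\<integral>x. exp (2 * u x) \<partial>sphere_area) / (20 * card K) \<le> partition_function u (space sphere_area \<inter> ball f (1 / 20))"
proof -
  define F where "F = {x \<in> space sphere_area. 3 / 10 \<le> norm (x - y1) \<and> 3 / 10 \<le> norm (x - y2) \<and> 3 / 10 \<le> norm (x - y3)}"
  define Z where "Z = (\<integral>x. exp (2 * u x) \<partial>sphere_area)"
  have F [measurable]: "F \<in> sets sphere_area" unfolding F_def by measurable
  have ball [measurable]: "space sphere_area \<inter> ball f r \<in> sets sphere_area" for f r
  proof -
    have "{x \<in> space sphere_area. dist f x < r} \<in> sets sphere_area" by measurable
    also have "{x \<in> space sphere_area. dist f x < r} = space sphere_area \<inter> ball f r" by auto
    finally show ?thesis .
  qed
  have Zpos: "0 < Z" unfolding Z_def by (rule integral_sphere_pos[OF int]) simp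
  have intA: "integrable sphere_area (\<lambda>x. indicator A x * exp (2 * u x))" if "A \<in> sets sphere_area" for A
    by (rule integrable_sphere_bounded_mult[OF int, of _ 1]) (use that in \<open>auto simp: indicator_def\<close>)
  let ?B = "\<lambda>f. F \<inter> (space sphere_area \<inter> ball f (1 / 20))"
  have B: "?B f \<in> sets sphere_area" for f by (rule sets.Int[OF F ball])
  have K: "0 < card K" using cover by (auto simp: card_gt_0_iff)
  have "Z / 20 \<le> partition_function u F"
    unfolding Z_def F_def by (rule mass_away_from_three_points[OF int um design y])
  also have "\<dots> \<le> (\<integral>x. (\<Sum>f\<in>K. indicator (?B f) x * exp (2 * u x)) \<partial>sphere_area)"
    unfolding partition_function_def
  proof (rule integral_mono)
    fix x assume x: "x \<in> space sphere_area"
    then obtain f where f: "f \<in> K" "x \<in> ball f (1 / 20)" using cover by auto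
    have "indicator F x * exp (2 * u x) = indicator (?B f) x * exp (2 * u x)"
      using x f by (simp add: indicator_def)
    also have "\<dots> \<le> (\<Sum>f\<in>K. indicator (?B f) x * exp (2 * u x))"
      using f cover(1) by (intro member_le_sum[of f K "\<lambda>f. indicator (?B f) x * exp (2 * u x)"]) auto
    finally show "indicator F x * exp (2 * u x) \<le> (\<Sum>f\<in>K. indicator (?B f) x * exp (2 * u x))" .
  qed (rule intA[OF F], rule Bochner_Integration.integrable_sum, rule intA[OF B])
  also have "\<dots> = (\<Sum>f\<in>K. partition_function u (?B f))"
    unfolding partition_function_def by (intro Bochner_Integration.integral_sum intA B)
  finally have sum: "Z / 20 \<le> (\<Sum>f\<in>K. partition_function u (?B f))" .
  have "\<exists>f\<in>K. Z / (20 * card K) \<le> partition_function u (?B f)"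
  proof (rule ccontr)
    assume "\<not> ?thesis"
    then have "(\<Sum>f\<in>K. partition_function u (?B f)) < (\<Sum>f\<in>K. Z / (20 * card K))"
      using K cover(1) by (intro sum_strict_mono) (auto simp: not_le)
    also have "\<dots> = Z / 20" using K by simp
    finally show False using sum by simp
  qed
  then obtain f where f: "f \<in> K" "Z / (20 * card K) \<le> partition_function u (?B f)" by blast
  have "0 < partition_function u (?B f)" using f(2) Zpos K by (intro less_le_trans[OF _ f(2)]) simp
  then have "?B f \<noteq> {}" by (auto simp: partition_function_def)
  then obtain x where x: "x \<in> F" "dist f x < 1 / 20" by auto
  have far: "1 / 4 \<le> norm (f - y)" if "3 / 10 \<le> norm (x - y)" for y
    using norm_triangle_ineq[of "x - f" "f - y"] that x(2) by (simp add: dist_norm norm_minus_commute)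
  have "partition_function u (?B f) \<le> partition_function u (space sphere_area \<inter> ball f (1 / 20))"
    unfolding partition_function_def by (intro integral_mono intA B ball) (auto simp: indicator_def)
  then show ?thesis using x(1) f that[of f] far unfolding F_def Z_def by auto
qed

text \<open>
  Four heavy caps are chosen one after another, each away from the previous ones; centres at distance
  \<open>1/4\<close> and radii \<open>1/20\<close> leave a gap of \<open>3/20\<close>. Each cap contains a fixed fraction of the total mass, so the
  logarithm of the total mass exceeds the average of the logarithms over the caps by a constant at most.
\<close>

theorem corollary1p1:
  fixes \<epsilon> :: real
  assumes "\<epsilon> > 0"
  shows "\<exists>c :: real. \<forall>u \<in> sphere_H1.
           (\<integral>x. u x \<partial>sphere_area) = 0 \<longrightarrow>
           (\<forall>p \<in> mean_zero_polynomials_le 2. (\<integral>x. p x * exp (2 * u x) \<partial>sphere_area) = 0) \<longrightarrow>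
           integrable sphere_area (\<lambda>x. exp (2 * u x)) \<and>
           ln (\<integral>x. exp (2 * u x) \<partial>sphere_area)
             \<le> (1 / (16 * pi) + \<epsilon>) * (sphere_L2_norm (weak_gradient u))\<^sup>2 + c"
proof -
  obtain K0 :: "(real^3) set" where K0: "finite K0" "K0 \<subseteq> sphere 0 1" "sphere 0 1 \<subseteq> (\<Union>f\<in>K0. ball f (1 / 20))"
    by (rule compactE_image[of "sphere 0 1 :: (real^3) set" "sphere 0 1" "\<lambda>f. ball f (1 / 20)"])
      (auto intro: compact_sphere)
  \<comment> \<open>With four caps the constant is \<open>1/(16 \<pi> s)\<close>, and this \<open>s\<close> makes it \<open>1/(16 \<pi>) + \<epsilon>\<close>.\<close>
  define s where "s = 1 / (1 + 16 * pi * \<epsilon>)"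
  have "0 < 16 * pi * \<epsilon>" using assms by simp
  then have s: "0 < s" "s < 1" unfolding s_def by (simp_all add: add_pos_pos)
  define C where "C = 5 * s + ln (7 * pi / (1 - s)) + s * real 4 * (5 - 2 * ln (3 / 20)) + ln (20 * card K0)"
  show ?thesis
  proof (intro exI[of _ C] ballI impI)
    fix u assume "u \<in> sphere_H1" and mean: "(\<integral>x. u x \<partial>sphere_area) = 0"
      and design: "\<forall>p \<in> mean_zero_polynomials_le 2. (\<integral>x. p x * exp (2 * u x) \<partial>sphere_area) = 0"
    then have u: "sphere_L2 u" and G: "is_weak_gradient u (weak_gradient u)"
      by (simp_all add: sphere_H1_def weak_gradient_def some_eq_ex)
    have um: "u \<in> borel_measurable sphere_area" using u by (simp add: sphere_L2_def)
    have int: "integrable sphere_area (\<lambda>x. exp (2 * u x))" by (rule integrable_exp_sphere_H1[OF u G mean])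
    define Z where "Z = (\<integral>x. exp (2 * u x) \<partial>sphere_area)"
    have Z: "0 < Z" unfolding Z_def by (rule integral_sphere_pos[OF int]) simp
    have K: "0 < card K0" using K0(1,3) by (auto simp: card_gt_0_iff)
    let ?E = "\<lambda>f. space sphere_area \<inter> ball f (1 / 20) :: (real^3) set"
    note pick = heavy_cap_away_from_three_points[OF K0(1,3) int um design, folded Z_def]
    have K1: "norm f = 1" if "f \<in> K0" for f using K0(2) that by auto
    \<comment> \<open>Repeated points serve as placeholders until three caps have been chosen.\<close>
    obtain f0 where f0: "f0 \<in> K0" using K by fastforce
    obtain f1 where f1: "f1 \<in> K0" "Z / (20 * card K0) \<le> partition_function u (?E f1)"
      using pick[OF K1[OF f0], where ?y2.0 = f0 and ?y3.0 = f0] by blast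
    obtain f2 where f2: "f2 \<in> K0" "1 / 4 \<le> norm (f2 - f1)" "Z / (20 * card K0) \<le> partition_function u (?E f2)"
      using pick[OF K1[OF f1(1)], where ?y2.0 = f1 and ?y3.0 = f1] by blast
    obtain f3 where f3: "f3 \<in> K0" "1 / 4 \<le> norm (f3 - f1)" "1 / 4 \<le> norm (f3 - f2)" "Z / (20 * card K0) \<le> partition_function u (?E f3)"
      using pick[OF K1[OF f1(1)], where ?y2.0 = f2 and ?y3.0 = f2] by blast
    obtain f4 where f4: "f4 \<in> K0" "1 / 4 \<le> norm (f4 - f1)" "1 / 4 \<le> norm (f4 - f2)" "1 / 4 \<le> norm (f4 - f3)"
        "Z / (20 * card K0) \<le> partition_function u (?E f4)"
      using pick[OF K1[OF f1(1)], where ?y2.0 = f2 and ?y3.0 = f3] by blast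
    define f where "f i = [f1, f2, f3, f4] ! i" for i
    have four: "i = 0 \<or> i = 1 \<or> i = 2 \<or> i = 3" if "i < 4" for i :: nat using that by linarith
    have heavy: "Z / (20 * card K0) \<le> partition_function u (?E (f i))" if "i < 4" for i
      using four[OF that] f1 f2 f3 f4 by (auto simp: f_def)
    have far: "1 / 4 \<le> norm (f i - f j)" if "i < 4" "j < 4" "i \<noteq> j" for i j
      using four[OF that(1)] four[OF that(2)] that(3) f2 f3 f4 by (auto simp: f_def norm_minus_commute)
    have pos: "0 < Z / (20 * card K0)" using Z K by simp
    have mt: "(\<Sum>i<4. ln (partition_function u (?E (f i)))) / real 4
      \<le> 1 / (4 * pi * real 4 * s) * (\<integral>x. (norm (weak_gradient u x))\<^sup>2 \<partial>sphere_area)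
        + (5 * s + ln (7 * pi / (1 - s)) + s * real 4 * (5 - 2 * ln (3 / 20)))"
    proof (rule separated_moser_trudinger[OF u G mean])
      fix i j x y assume ij: "i < (4::nat)" "j < (4::nat)" "i \<noteq> j" and xy: "x \<in> ?E (f i)" "y \<in> ?E (f j)"
      have "norm (f i - f j) \<le> norm (f i - x) + norm (x - y) + norm (y - f j)"
        using norm_triangle_ineq[of "f i - x" "x - y"] norm_triangle_ineq[of "f i - y" "y - f j"] by simp
      then show "3 / 20 \<le> norm (x - y)"
        using far[OF ij] xy by (simp add: dist_norm norm_minus_commute)
    next
      fix i assume i: "i < (4::nat)"
      show "0 < partition_function u (?E (f i))" using pos heavy[OF i] by linarith
      have "{x \<in> space sphere_area. dist (f i) x < 1 / 20} \<in> sets sphere_area" by measurable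
      also have "{x \<in> space sphere_area. dist (f i) x < 1 / 20} = ?E (f i)" by auto
      finally show "?E (f i) \<in> sets sphere_area" .
    qed (use s in auto)
    have "(\<Sum>i<(4::nat). ln (Z / (20 * card K0))) \<le> (\<Sum>i<4. ln (partition_function u (?E (f i))))"
    proof (rule sum_mono)
      fix i assume "i \<in> {..<4::nat}"
      then have i: "Z / (20 * card K0) \<le> partition_function u (?E (f i))" by (intro heavy) simp
      then have "0 < partition_function u (?E (f i))" using pos by linarith
      then show "ln (Z / (20 * card K0)) \<le> ln (partition_function u (?E (f i)))"
        using i pos by (subst ln_le_cancel_iff)
    qed
    then have "ln (Z / (20 * card K0)) \<le> (\<Sum>i<4. ln (partition_function u (?E (f i)))) / real 4" by simp
    also note mt
    also have "ln (Z / (20 * card K0)) = ln Z - ln (20 * card K0)" using Z K by (subst ln_div) auto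
    also have "(\<integral>x. (norm (weak_gradient u x))\<^sup>2 \<partial>sphere_area) = (sphere_L2_norm (weak_gradient u))\<^sup>2"
      unfolding sphere_L2_norm_def by (simp add: integral_nonneg_AE)
    also have "1 / (4 * pi * real 4 * s) = 1 / (16 * pi) + \<epsilon>"
      using assms by (simp add: s_def field_simps)
    finally have "ln Z \<le> (1 / (16 * pi) + \<epsilon>) * (sphere_L2_norm (weak_gradient u))\<^sup>2 + C"
      by (simp add: C_def)
    then show "integrable sphere_area (\<lambda>x. exp (2 * u x)) \<and>
        ln (\<integral>x. exp (2 * u x) \<partial>sphere_area) \<le> (1 / (16 * pi) + \<epsilon>) * (sphere_L2_norm (weak_gradient u))\<^sup>2 + C"
      using int by (simp add: Z_def)
  qed
qed

end
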